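(* Suppose that the following two assumptions are satisfied. (I) There is a constant $c<1$ such that $\|K_n^{0}\|\le c$ for all $n\ge 1$. (II) There is a set $M$ of probability measures on $\mathrm{SL}(m,\mathbb{R})$ which is compact with respect to weak convergence and such that: (a) $\nu_n\in M$ for all $n\ge 1$; (b) for every $\nu\in M$ the group $G_\nu$ does not preserve any probability measure on $\mathcal{S}$. Let $(a_j)_{j\ge1}$ be a non-random sequence of matrices $a_j\in\mathrm{SL}(m,\mathbb{R})$ which is bounded: $\|a_n\|\le C$ for some $C$ and all $n\ge1$ (and arbitrary otherwise). Then there is $\tilde\lambda>0$ such that with probability $1$ $$\liminf_{n\to\infty}\frac1n \ln\|a_ng_n a_{n-1}g_{n-1}\cdots a_1g_1\|\ge \tilde{\lambda}.$$
   Context: Let $m$ be a positive integer, $\mathcal{S}$ the unit sphere in $\mathbb{R}^m$, and $\|\cdot\|$ the Euclidean norm of vectors and the corresponding operator norm of matrices. Markov chain. Let $(X,\mathcal{B})$ be a measurable space and $\xi=(\xi_n)_{n\ge1}$ a (not necessarily stationary) Markov chain with phase space $X$, initial distribution $\mu_1$ and transition kernels $k_n(x,B)=\mathbb{P}(\xi_{n+1}\in B\mid \xi_n=x)$, $B\in\mathcal{B}$. Let $\mu_n$ be the distribution of $\xi_n$. Let $H_n$ be the Hilbert space of real-valued $\mu_n$-square-integrable functions on $X$, and $H_n^0=\{f\in H_n:\int_X f\,d\mu_n=0\}$. Let $K_n:H_{n+1}\to H_n$, $(K_nf)(x)=\int_X k_n(x,dy)f(y)$. It maps $H_{n+1}^0$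 into $H_n^0$, and $K_n^0:H_{n+1}^0\to H_n^0$ denotes its restriction; $\|K_n^0\|$ is its operator norm. Matrices. Let $\mathfrak{g}_n:X\to\mathrm{SL}(m,\mathbb{R})$, $n\ge1$, be $\mathcal{B}$-measurable functions, $g_n=\mathfrak{g}_n(\xi_n)$, and let $\nu_n$ be the distribution of $g_n$ on $\mathrm{SL}(m,\mathbb{R})$. Groups. For a probability measure $\nu$ on $\mathrm{SL}(m,\mathbb{R})$, $G_\nu$ is the closed group generated by $\{g\tilde g^{-1}: g,\tilde g\in\mathrm{supp}(\nu)\}$. For $g\in\mathrm{SL}(m,\mathbb{R})$ and $u\in\mathcal{S}$ set $g.u=gu/\|gu\|$; $g$ preserves a probability measure $\kappa$ on $\mathcal{S}$ if the image of $\kappa$ under $u\mapsto g.u$ is $\kappa$, and a group preserves $\kappa$ if each of its elements does. *)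

theory Defs
  imports "HOL-Probability.Probability" "HOL-Algebra.Group"
begin

section \<open>Markov chains and their transition operators\<close>

text \<open>All sequences are indexed by positive integers; values at index \<open>0\<close> are irrelevant.
  The natural filtration consists of the \<open>\<sigma>\<close>-algebras generated by \<open>(\<xi> 1, \<dots>, \<xi> n)\<close>.\<close>

definition natural_filtration ::
    "'w measure \<Rightarrow> 'x measure \<Rightarrow> (nat \<Rightarrow> 'w \<Rightarrow> 'x) \<Rightarrow> nat \<Rightarrow> 'w measure" where
  "natural_filtration P X \<xi> n =
     vimage_algebra (space P) (\<lambda>\<omega>. \<lambda>i\<in>{1..n}. \<xi> i \<omega>) (Pi\<^sub>M {1..n} (\<lambda>_. X))"

definition markov_chain ::
    "'w measure \<Rightarrow> 'x measure \<Rightarrow> (nat \<Rightarrow> 'x \<Rightarrow> 'x measure) \<Rightarrow> (nat \<Rightarrow> 'w \<Rightarrow> 'x) \<Rightarrow> bool" where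
  "markov_chain P X k \<xi> \<longleftrightarrow>
     prob_space P \<and>
     (\<forall>n\<ge>1. \<xi> n \<in> P \<rightarrow>\<^sub>M X) \<and>
     (\<forall>n\<ge>1. k n \<in> X \<rightarrow>\<^sub>M prob_algebra X) \<and>
     (\<forall>n\<ge>1. \<forall>B\<in>sets X. AE \<omega> in P.
        real_cond_exp P (natural_filtration P X \<xi> n) (\<lambda>\<omega>. indicator B (\<xi> (Suc n) \<omega>)) \<omega>
          = measure (k n (\<xi> n \<omega>)) B)"

text \<open>Square-integrable functions are not identified almost everywhere, so \<open>l2_norm\<close> is a
  seminorm; this does not affect operator norms.\<close>

definition l2_space :: "'x measure \<Rightarrow> ('x \<Rightarrow> real) set" where
  "l2_space \<mu> = {f \<in> borel_measurable \<mu>. integrable \<mu> (\<lambda>x. (f x)\<^sup>2)}"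

definition l2_norm :: "'x measure \<Rightarrow> ('x \<Rightarrow> real) \<Rightarrow> real" where
  "l2_norm \<mu> f = sqrt (\<integral>x. (f x)\<^sup>2 \<partial>\<mu>)"

definition l2_space0 :: "'x measure \<Rightarrow> ('x \<Rightarrow> real) set" where
  "l2_space0 \<mu> = {f \<in> l2_space \<mu>. (\<integral>x. f x \<partial>\<mu>) = 0}"

definition kernel_op :: "('x \<Rightarrow> 'x measure) \<Rightarrow> ('x \<Rightarrow> real) \<Rightarrow> 'x \<Rightarrow> real" where
  "kernel_op \<kappa> f x = (\<integral>y. f y \<partial>\<kappa> x)"

definition op_norm0 ::
    "'x measure \<Rightarrow> 'x measure \<Rightarrow> (('x \<Rightarrow> real) \<Rightarrow> 'x \<Rightarrow> real) \<Rightarrow> ereal" where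
  "op_norm0 \<mu> \<mu>' K =
     (SUP f \<in> {f \<in> l2_space0 \<mu>. l2_norm \<mu> f \<le> 1}. ereal (l2_norm \<mu>' (K f)))"

section \<open>Probability measures on subspaces\<close>

definition prob_measures_on :: "'a::topological_space set \<Rightarrow> 'a measure set" where
  "prob_measures_on S = space (prob_algebra (restrict_space borel S))"

text \<open>The coarsest topology making \<open>\<nu> \<mapsto> \<integral>f d\<nu>\<close> continuous for every bounded continuous
  \<open>f\<close> on \<open>S\<close>.\<close>

definition weak_topology :: "'a::topological_space set \<Rightarrow> 'a measure topology" where
  "weak_topology S = topology_generated_by
     {{\<nu> \<in> prob_measures_on S. (\<integral>x. f x \<partial>\<nu>) \<in> U} | (f :: 'a \<Rightarrow> real) U.
        continuous_on S f \<and> bounded (f ` S) \<and> open U}"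

definition measure_support :: "'a::topological_space measure \<Rightarrow> 'a set" where
  "measure_support \<nu> =
     {x \<in> space \<nu>. \<forall>U. open U \<longrightarrow> x \<in> U \<longrightarrow> emeasure \<nu> (U \<inter> space \<nu>) > 0}"

section \<open>The special linear group and its action on the sphere\<close>

definition SL :: "(real^'m^'m) set" where
  "SL = {A. det A = 1}"

definition SL_group :: "(real^'m^'m) monoid" where
  "SL_group = \<lparr>carrier = SL, mult = (**), one = mat 1\<rparr>"

text \<open>As \<open>SL\<close> is closed in the space of matrices, being closed in \<open>SL\<close> and being closed in
  the space of matrices agree for subsets of \<open>SL\<close>.\<close>

definition closed_group_generated :: "(real^'m^'m) set \<Rightarrow> (real^'m^'m) set" where
  "closed_group_generated S = (\<lambda>H. subgroup H SL_group \<and> closed H) hull S"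

definition G_group :: "(real^'m^'m) measure \<Rightarrow> (real^'m^'m) set" where
  "G_group \<nu> = closed_group_generated
     {g ** matrix_inv h | g h. g \<in> measure_support \<nu> \<and> h \<in> measure_support \<nu>}"

definition sphere_action :: "real^'m^'m \<Rightarrow> real^'m \<Rightarrow> real^'m" where
  "sphere_action g u = (g *v u) /\<^sub>R norm (g *v u)"

definition preserves :: "real^'m^'m \<Rightarrow> (real^'m) measure \<Rightarrow> bool" where
  "preserves g \<kappa> \<longleftrightarrow>
     distr \<kappa> (restrict_space borel (sphere 0 1)) (sphere_action g) = \<kappa>"

text \<open>The norm of the type \<open>real^'m^'m\<close> is the Frobenius norm, hence the use of \<open>onorm\<close>.\<close>

definition mat_norm :: "real^'m^'m \<Rightarrow> real" where
  "mat_norm A = onorm ((*v) A)"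

text \<open>\<open>interleaved_prod a g n = a n ** g n ** \<dots> ** a 1 ** g 1\<close>\<close>

primrec interleaved_prod ::
    "(nat \<Rightarrow> real^'m^'m) \<Rightarrow> (nat \<Rightarrow> real^'m^'m) \<Rightarrow> nat \<Rightarrow> real^'m^'m" where
  "interleaved_prod a g 0 = mat 1"
| "interleaved_prod a g (Suc n) = a (Suc n) ** g (Suc n) ** interleaved_prod a g n"

end

theory Submission
  imports Defs
begin

text \<open>
  \<open>SL\<close> acts on functions on \<open>\<real>^m\<close> by \<open>(T g f) v = f (g v)\<close>, and since determinants are \<open>1\<close> this
  action is unitary on \<open>L^2\<close> of Lebesgue measure.  Write \<open>B\<close> for the closed unit ball and \<open>S n\<close> for the
  product of the first \<open>2 n\<close> matrices.  If \<open>S n\<close> has norm at most \<open>R\<close>, then \<open>S n\<close> maps the ball of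
  radius of order \<open>1 / R\<close> into \<open>B\<close>; so the probability of this event is controlled by the \<open>L^2\<close> norm of
  the averaged function \<open>v \<mapsto> E (1_B (S n v))\<close>.  This norm decays exponentially in \<open>n\<close>, whence, with
  \<open>R = exp (l n)\<close> and \<open>l\<close> small, the Borel-Cantelli lemma gives the theorem
  (\<open>return_energy\<close>, \<open>small_norm_probability\<close>, \<open>exponential_growth\<close>).

  The decay has two sources.

  \<^item> Averaging over one matrix contracts \<open>L^2\<close> by a factor that is uniform over \<open>M\<close> (\<open>spectral_gap\<close>).
    Otherwise there are \<open>\<nu> n \<in> M\<close> and unit vectors \<open>f n\<close> with \<open>f n (g v)\<close> asymptotically independent of
    \<open>g\<close> in \<open>L^2\<close>, for \<open>\<nu> n\<close>-random \<open>g\<close>.  Pushing the probability density \<open>(f n)^2\<close> to the sphere along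
    \<open>v \<mapsto> v / \<bar>v\<bar>\<close> gives probability measures \<open>\<kappa> n\<close> such that the image of \<open>\<kappa> n\<close> under \<open>inverse g\<close> hardly
    depends on \<open>g\<close>.  A weak limit \<open>\<kappa>\<close> of these measures and a cluster point \<open>\<nu>\<close> of the \<open>\<nu> n\<close> then satisfy
    \<open>(inverse g) \<kappa> = (inverse h) \<kappa>\<close> for all \<open>g\<close>, \<open>h\<close> in the support of \<open>\<nu>\<close>: the group \<open>G_group \<nu>\<close> preserves
    \<open>\<kappa>\<close>, which is excluded.

  \<^item> The transition operators contract the functions of mean zero by \<open>c < 1\<close>.

  For the chain these are combined in \<open>L^2\<close> of the phase space with values in \<open>L^2 (\<real>^m)\<close>.  A transition
  kernel shrinks the fluctuating part of such a function, a random matrix shrinks the constant part,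
  and neither ever increases the norm; constant and fluctuating part can exchange mass only at the cost of
  one of these losses, so that the norm drops by a fixed factor in two steps
  (\<open>two_step_contraction\<close>, \<open>backward_energy\<close>).  The Markov property identifies the average
  \<open>E (1_B (S n v))\<close> with the outcome of this backward recursion (\<open>backward_representation\<close>).

  The matrices \<open>a j\<close> act unitarily, so they may be absorbed into the function to which the spectral gap
  is applied.
\<close>

section \<open>Sequential compactness of probability measures on a compact space\<close>

text \<open>Sums of ternary digits \<open>0\<close> and \<open>2\<close> are points of the Cantor set; where two such expansions
  first differ, the sums are separated by at least the value of that digit minus the whole tail.\<close>

lemma ternary_digits_determined:
  fixes x y :: "nat \<Rightarrow> bool"
  assumes "\<bar>(\<Sum>j. 2 * of_bool (x j) / 3 ^ Suc j) - (\<Sum>j. 2 * of_bool (y j) / 3 ^ Suc j :: real)\<bar> < 1 / 3 ^ N"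
    and "j < N"
  shows "x j = y j"
proof (rule ccontr)
  assume "x j \<noteq> y j"
  define i where "i = (LEAST i. x i \<noteq> y i)"
  have i: "x i \<noteq> y i" unfolding i_def by (rule LeastI) fact
  have min: "x l = y l" if "l < i" for l using not_less_Least[of l] that unfolding i_def by blast
  have "i \<le> j" unfolding i_def by (rule Least_le) fact
  define d :: "nat \<Rightarrow> real" where "d l = 2 * (of_bool (x l) - of_bool (y l)) / 3 ^ Suc l" for l
  have geo: "summable (\<lambda>l. 2 / 3 ^ Suc l :: real)"
    using summable_mult[OF summable_geometric[of "1/3::real"], of "2/3"] by (simp add: power_one_over field_simps)
  have sum_digits: "summable (\<lambda>l. 2 * of_bool (b l) / 3 ^ Suc l :: real)" for b :: "nat \<Rightarrow> bool"
    by (rule summable_comparison_test'[OF geo, of 0]) auto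
  have d_eq: "(\<Sum>j. 2 * of_bool (x j) / 3 ^ Suc j) - (\<Sum>j. 2 * of_bool (y j) / 3 ^ Suc j) = suminf d"
    unfolding suminf_diff[OF sum_digits sum_digits] d_def by (simp add: diff_divide_distrib right_diff_distrib)
  have dsum: "summable d"
    unfolding d_def by (rule summable_comparison_test'[OF geo, of 0]) (auto simp: divide_simps)
  have split: "suminf d = (\<Sum>l. d (l + Suc i)) + d i"
    using suminf_split_initial_segment[OF dsum, of "Suc i"] min by (simp add: d_def)
  have "\<bar>\<Sum>l. d (l + Suc i)\<bar> \<le> (\<Sum>l. 2 / 3 ^ Suc (l + Suc i))"
  proof -
    have s: "summable (\<lambda>l. 2 / 3 ^ Suc (l + Suc i) :: real)"
      using geo by (rule summable_ignore_initial_segment)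
    show ?thesis
      using norm_suminf_le[of "\<lambda>l. d (l + Suc i)", OF _ s] by (auto simp: d_def divide_simps)
  qed
  also have "\<dots> = 1 / 3 ^ Suc i"
  proof -
    have "(\<lambda>l. (2 / 3 ^ Suc (Suc i)) * (1/3) ^ l :: real) sums ((2 / 3 ^ Suc (Suc i)) * (1 / (1 - 1/3)))"
      by (intro sums_mult geometric_sums) simp
    then show ?thesis by (intro sums_unique[symmetric]) (simp add: power_add power_one_over field_simps)
  qed
  finally have tail: "\<bar>\<Sum>l. d (l + Suc i)\<bar> \<le> 1 / 3 ^ Suc i" .
  have "\<bar>d i\<bar> = 2 / 3 ^ Suc i" using i by (auto simp: d_def)
  then have "1 / 3 ^ Suc i \<le> \<bar>suminf d\<bar>" using split tail by (simp add: abs_if split: if_splits) 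
  moreover have "(1::real) / 3 ^ N \<le> 1 / 3 ^ Suc i"
    using \<open>i \<le> j\<close> \<open>j < N\<close> by (intro divide_left_mono power_increasing) auto
  ultimately show False using assms(1) d_eq by linarith
qed

text \<open>The indicators of countably many balls code the points of a compact set in such a way that
  finitely many digits of the code already determine the point up to a given error.\<close>

lemma compact_separating_sequence:
  fixes S :: "'a :: metric_space set"
  assumes "compact S"
  shows "\<exists>B :: nat \<Rightarrow> 'a set. (\<forall>j. open (B j)) \<and>
    (\<forall>e>0. \<exists>N. \<forall>u\<in>S. \<forall>w\<in>S. (\<forall>j<N. u \<in> B j \<longleftrightarrow> w \<in> B j) \<longrightarrow> dist u w < e)"
proof -
  have "\<exists>F. finite F \<and> S \<subseteq> (\<Union>x\<in>F. ball x (1 / real (Suc k)))" for k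
    by (rule compactE_image[OF assms, of S "\<lambda>x. ball x (1 / real (Suc k))"]) auto
  then obtain F where F: "\<And>k. finite (F k)" "\<And>k. S \<subseteq> (\<Union>x\<in>F k. ball x (1 / real (Suc k)))"
    by metis
  define \<B> where "\<B> = insert {} (\<Union>k. (\<lambda>x. ball x (1 / real (Suc k))) ` F k)"
  have "countable \<B>" unfolding \<B>_def using F(1) by (simp add: countable_finite)
  define B where "B = from_nat_into \<B>"
  have range_B: "range B = \<B>"
    unfolding B_def using \<open>countable \<B>\<close> by (intro range_from_nat_into) (auto simp: \<B>_def)
  show ?thesis
  proof (intro exI[of _ B] conjI allI impI)
    show "open (B j)" for j
    proof -
      have "B j \<in> \<B>" using range_B by blast
      then show ?thesis by (auto simp: \<B>_def)
    qed
    fix e :: real assume "e > 0"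
    then obtain k where k: "1 / real (Suc k) < e / 2"
      using reals_Archimedean[of "e/2"] by (auto simp: inverse_eq_divide)
    have "\<forall>x\<in>F k. \<exists>j. B j = ball x (1 / real (Suc k))"
    proof
      fix x assume "x \<in> F k"
      then have "ball x (1 / real (Suc k)) \<in> range B" unfolding range_B \<B>_def by auto
      then show "\<exists>j. B j = ball x (1 / real (Suc k))" by (metis imageE)
    qed
    then obtain J where J: "\<And>x. x \<in> F k \<Longrightarrow> B (J x) = ball x (1 / real (Suc k))" by metis
    have "dist u w < e" if "u \<in> S" "w \<in> S" and eq: "\<forall>j<Suc (Max (J ` F k)). u \<in> B j \<longleftrightarrow> w \<in> B j" for u w
    proof -
      obtain x where x: "x \<in> F k" "u \<in> ball x (1 / real (Suc k))" using F(2) \<open>u \<in> S\<close> by blast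
      have "J x < Suc (Max (J ` F k))" using F(1) x(1) by (simp add: less_Suc_eq_le)
      then have "w \<in> ball x (1 / real (Suc k))" using eq x J by blast
      then show ?thesis using x(2) k dist_triangle2[of u w x] by (simp add: dist_commute)
    qed
    then show "\<exists>N. \<forall>u\<in>S. \<forall>w\<in>S. (\<forall>j<N. u \<in> B j \<longleftrightarrow> w \<in> B j) \<longrightarrow> dist u w < e" by blast
  qed
qed

lemma prob_measures_on_iff:
  "\<kappa> \<in> prob_measures_on S \<longleftrightarrow> sets \<kappa> = sets (restrict_space borel S) \<and> prob_space \<kappa>"
  by (auto simp: prob_measures_on_def space_prob_algebra)

lemma prob_measures_on_space: "\<kappa> \<in> prob_measures_on S \<Longrightarrow> space \<kappa> = S"
  by (auto simp: prob_measures_on_iff dest: sets_eq_imp_space_eq simp: space_restrict_space)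

lemma distr_in_prob_measures_on:
  "prob_space M \<Longrightarrow> f \<in> M \<rightarrow>\<^sub>M restrict_space borel S \<Longrightarrow> distr M (restrict_space borel S) f \<in> prob_measures_on S"
  by (auto simp: prob_measures_on_iff intro: prob_space.prob_space_distr)

text \<open>The code of \<open>compact_separating_sequence\<close>, read as ternary digits, is a Borel injection of \<open>S\<close> into
  \<open>[0, 1]\<close> with a uniformly continuous inverse, and this inverse extends continuously to the closure \<open>T\<close>
  of its domain.  Hence Helly's theorem on the line can be applied to the image measures, and the limit,
  which lives on \<open>T\<close>, is carried back to \<open>S\<close>.\<close>

lemma compact_prob_measures_convergent_subseq:
  fixes S :: "'a :: polish_space set" and \<kappa> :: "nat \<Rightarrow> 'a measure"
  assumes "compact S" and \<kappa>: "\<And>n. \<kappa> n \<in> prob_measures_on S"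
  obtains r \<kappa>' where "strict_mono (r :: nat \<Rightarrow> nat)" "\<kappa>' \<in> prob_measures_on S"
    "\<And>\<phi> :: 'a \<Rightarrow> real. continuous_on S \<phi> \<Longrightarrow> (\<lambda>n. \<integral>x. \<phi> x \<partial>\<kappa> (r n)) \<longlonglongrightarrow> (\<integral>x. \<phi> x \<partial>\<kappa>')"
proof -
  from compact_separating_sequence[OF \<open>compact S\<close>] obtain B :: "nat \<Rightarrow> 'a set"
    where B': "(\<forall>j. open (B j)) \<and>
      (\<forall>e>0. \<exists>N. \<forall>u\<in>S. \<forall>w\<in>S. (\<forall>j<N. u \<in> B j \<longleftrightarrow> w \<in> B j) \<longrightarrow> dist u w < e)" ..
  then have B: "\<And>j. open (B j)" "\<And>e. e > 0 \<Longrightarrow>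
      \<exists>N. \<forall>u\<in>S. \<forall>w\<in>S. (\<forall>j<N. u \<in> B j \<longleftrightarrow> w \<in> B j) \<longrightarrow> dist u w < e"
    by simp_all
  define s where "s u = (\<Sum>j. 2 * of_bool (u \<in> B j) / 3 ^ Suc j :: real)" for u
  have [measurable]: "B j \<in> sets borel" for j using B(1) by auto
  have s_meas[measurable]: "s \<in> borel_measurable borel"
    unfolding s_def by measurable
  have s_sep: "\<exists>d>0. \<forall>u\<in>S. \<forall>w\<in>S. \<bar>s u - s w\<bar> < d \<longrightarrow> dist u w < e" if "e > 0" for e
  proof -
    obtain N where "\<forall>u\<in>S. \<forall>w\<in>S. (\<forall>j<N. u \<in> B j \<longleftrightarrow> w \<in> B j) \<longrightarrow> dist u w < e"
      using B(2) \<open>e > 0\<close> by blast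
    then show ?thesis
      using ternary_digits_determined[of "\<lambda>j. _ \<in> B j" "\<lambda>j. _ \<in> B j" N, folded s_def]
      by (intro exI[of _ "1 / 3 ^ N"]) auto
  qed
  have s_inj: "u = w" if "u \<in> S" "w \<in> S" "s u = s w" for u w
  proof (rule ccontr)
    assume "u \<noteq> w"
    then obtain d where "d > 0" "\<forall>u'\<in>S. \<forall>w'\<in>S. \<bar>s u' - s w'\<bar> < d \<longrightarrow> dist u' w' < dist u w"
      using s_sep[of "dist u w"] by auto
    then have "dist u w < dist u w" using that by (metis abs_zero diff_self)
    then show False by simp
  qed
  define q where "q = the_inv_into S s"
  have q_s: "q (s u) = u" if "u \<in> S" for u
    unfolding q_def using s_inj that by (intro the_inv_into_f_f) (auto simp: inj_on_def)
  have "uniformly_continuous_on (s ` S) q"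
    unfolding uniformly_continuous_on_def
  proof (intro allI impI)
    fix e :: real assume "e > 0"
    from s_sep[OF this] show "\<exists>d>0. \<forall>x\<in>s ` S. \<forall>x'\<in>s ` S. dist x' x < d \<longrightarrow> dist (q x') (q x) < e"
      by (auto simp: q_s dist_real_def)
  qed
  then obtain p where p_uc: "uniformly_continuous_on (closure (s ` S)) p"
    and p_q: "\<And>x. x \<in> s ` S \<Longrightarrow> q x = p x"
    using uniformly_continuous_on_extension_on_closure by metis
  define T where "T = closure (s ` S)"
  have p_cont: "continuous_on T p"
    unfolding T_def using p_uc by (rule uniformly_continuous_imp_continuous)
  have p_s: "p (s u) = u" if "u \<in> S" for u using p_q[of "s u"] q_s that by auto
  have p_T: "p x \<in> S" if "x \<in> T" for x
  proof -
    have "p ` closure (s ` S) \<subseteq> S"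
      using p_cont compact_imp_closed[OF \<open>compact S\<close>]
      by (intro image_closure_subset) (auto simp: T_def p_s)
    then show ?thesis using that by (auto simp: T_def)
  qed
  have "closed T" by (simp add: T_def)
  then have [measurable]: "T \<in> sets borel" by simp
  have s_T: "s u \<in> T" if "u \<in> S" for u using that closure_subset[of "s ` S"] by (auto simp: T_def)
  have s_bounds: "0 \<le> s u \<and> s u \<le> 1" for u
  proof -
    have geo: "(\<lambda>l. (2 / 3) * (1/3) ^ l :: real) sums ((2 / 3) * (1 / (1 - 1/3)))"
      by (intro sums_mult geometric_sums) simp
    have geo': "(\<lambda>l. 2 / 3 ^ Suc l :: real) sums 1"
      using geo by (simp add: power_one_over field_simps)
    have sm: "summable (\<lambda>j. 2 * of_bool (u \<in> B j) / 3 ^ Suc j :: real)"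
      by (rule summable_comparison_test'[OF sums_summable[OF geo'], of 0]) auto
    show ?thesis unfolding s_def
      using suminf_nonneg[OF sm] suminf_le[OF _ sm sums_summable[OF geo']] sums_unique[OF geo']
      by (auto simp: divide_right_mono)
  qed
  have sp: "space (\<kappa> n) = S" for n using \<kappa> prob_measures_on_space by blast
  have sets_\<kappa>[measurable_cong]: "sets (\<kappa> n) = sets (restrict_space borel S)" for n
    using \<kappa> by (simp add: prob_measures_on_iff)
  have prob_\<kappa>: "prob_space (\<kappa> n)" for n using \<kappa> by (simp add: prob_measures_on_iff)
  have s_\<kappa>[measurable]: "s \<in> borel_measurable (\<kappa> n)" for n
    using measurable_restrict_space1[OF s_meas, of S] by (simp cong: measurable_cong_sets add: sets_\<kappa>)
  define \<eta> where "\<eta> n = distr (\<kappa> n) borel s" for n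
  have rd: "real_distribution (\<eta> n)" for n
    unfolding \<eta>_def using prob_\<kappa>
    by (intro prob_space.real_distribution_distr) auto
  have "tight \<eta>"
    unfolding tight_def
  proof (intro conjI allI impI)
    show "real_distribution (\<eta> n)" for n by (rule rd)
    fix e :: real assume "e > 0"
    have "measure (\<eta> n) {-1<..1} = 1" for n
    proof -
      have "-1 < s u" "s u \<le> 1" for u using s_bounds[of u] by linarith+
      then have "s -` {-1<..1} \<inter> space (\<kappa> n) = space (\<kappa> n)" by auto
      then show ?thesis unfolding \<eta>_def
        by (subst measure_distr) (auto simp: prob_space.prob_space[OF prob_\<kappa>])
    qed
    then show "\<exists>a b. a < b \<and> (\<forall>n. 1 - e < measure (\<eta> n) {a<..b})"
      using \<open>e > 0\<close> by (intro exI[of _ "-1"] exI[of _ 1]) auto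
  qed
  from tight_imp_convergent_subsubsequence[OF this strict_mono_id]
  obtain r M where r: "strict_mono r" and M: "real_distribution M" and wc: "weak_conv_m (\<eta> \<circ> r) M"
    by auto
  interpret M: real_distribution M by fact
  have conv: "(\<lambda>n. \<integral>x. f x \<partial>\<eta> (r n)) \<longlonglongrightarrow> (\<integral>x. f x \<partial>M)"
    if "continuous_on UNIV f" "\<And>x. \<bar>f x\<bar> \<le> b" for f :: "real \<Rightarrow> real" and b
    using weak_conv_imp_integral_bdd_continuous_conv[of "\<eta> \<circ> r" M f b] rd M wc that
    by (auto simp: continuous_on_eq_continuous_at)
  have int_\<eta>: "(\<integral>x. f x \<partial>\<eta> n) = (\<integral>u. f (s u) \<partial>\<kappa> n)" if "f \<in> borel_measurable borel" for f :: "real \<Rightarrow> real" and n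
    unfolding \<eta>_def using that by (intro integral_distr) auto
  have "S \<noteq> {}" using sp prob_space.not_empty[OF prob_\<kappa>] by auto
  then have "T \<noteq> {}" using s_T by auto
  \<comment> \<open>The limit measure is carried by the closed set \<open>T\<close>, as it integrates the distance to \<open>T\<close> to \<open>0\<close>.\<close>
  define h where "h x = min 1 (infdist x T)" for x :: real
  have h_cont: "continuous_on UNIV h" unfolding h_def by (intro continuous_intros)
  then have [measurable]: "h \<in> borel_measurable borel" by (rule borel_measurable_continuous_onI)
  have h_b: "\<bar>h x\<bar> \<le> 1" "0 \<le> h x" for x by (auto simp: h_def infdist_nonneg)
  have "(\<integral>x. h x \<partial>\<eta> n) = 0" for n
  proof -
    have "(\<integral>x. h x \<partial>\<eta> n) = (\<integral>u. h (s u) \<partial>\<kappa> n)" by (rule int_\<eta>) simp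
    also have "\<dots> = (\<integral>u. 0 \<partial>\<kappa> n)"
      by (intro Bochner_Integration.integral_cong) (auto simp: h_def s_T sp)
    finally show ?thesis by simp
  qed
  then have "(\<integral>x. h x \<partial>M) = 0"
    using conv[OF h_cont h_b(1)] by (simp add: LIMSEQ_const_iff)
  moreover have "integrable M h" using h_b by (intro M.integrable_const_bound[of _ 1]) auto
  ultimately have "AE x in M. h x = 0"
    using h_b by (subst (asm) integral_nonneg_eq_0_iff_AE) auto
  then have AE_T: "AE x in M. x \<in> T"
  proof eventually_elim
    case (elim x)
    then show ?case using \<open>closed T\<close> \<open>T \<noteq> {}\<close> in_closed_iff_infdist_zero[of T x] by (auto simp: h_def min_def split: if_splits)
  qed
  obtain u0 where "u0 \<in> S" using \<open>S \<noteq> {}\<close> by auto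
  define p' where "p' x = (if x \<in> T then p x else u0)" for x
  have p'_meas: "p' \<in> M \<rightarrow>\<^sub>M restrict_space borel S"
  proof (rule measurable_restrict_space2)
    show "p' \<in> space M \<rightarrow> S" using p_T \<open>u0 \<in> S\<close> by (auto simp: p'_def)
    have "p \<in> borel_measurable (restrict_space borel T)"
      using p_cont by (rule borel_measurable_continuous_on_restrict)
    then have "p' \<in> borel_measurable borel"
      unfolding p'_def by (subst measurable_If_restrict_space_iff) auto
    then show "p' \<in> M \<rightarrow>\<^sub>M borel" by simp
  qed
  define \<kappa>' where "\<kappa>' = distr M (restrict_space borel S) p'"
  have "\<kappa>' \<in> prob_measures_on S"
    unfolding \<kappa>'_def using M.prob_space_axioms p'_meas by (rule distr_in_prob_measures_on)
  moreover have "(\<lambda>n. \<integral>x. \<phi> x \<partial>\<kappa> (r n)) \<longlonglongrightarrow> (\<integral>x. \<phi> x \<partial>\<kappa>')" if \<phi>: "continuous_on S \<phi>" for \<phi> :: "'a \<Rightarrow> real"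
  proof -
    have \<phi>_meas: "\<phi> \<in> borel_measurable (restrict_space borel S)"
      using \<phi> by (rule borel_measurable_continuous_on_restrict)
    have "bounded (\<phi> ` S)" using compact_continuous_image[OF \<phi> \<open>compact S\<close>] by (rule compact_imp_bounded)
    then obtain b where b: "\<And>u. u \<in> S \<Longrightarrow> \<bar>\<phi> u\<bar> \<le> b" unfolding bounded_iff by auto
    have "b \<ge> 0" using b[OF \<open>u0 \<in> S\<close>] by linarith
    have cont: "continuous_on T (\<phi> \<circ> p)"
      using p_cont \<phi> p_T by (intro continuous_on_compose continuous_on_subset[OF \<phi>]) auto
    have bd: "norm ((\<phi> \<circ> p) x) \<le> b" if "x \<in> T" for x using b p_T that by simp
    have cl: "closedin (top_of_set UNIV) T" using \<open>closed T\<close> by simp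
    obtain g where g: "continuous_on UNIV g" "\<And>x. x \<in> T \<Longrightarrow> g x = (\<phi> \<circ> p) x"
        "\<And>x. x \<in> UNIV \<Longrightarrow> norm (g x) \<le> b"
      by (rule Tietze[OF cont cl \<open>0 \<le> b\<close> bd]) (assumption, rule that)
    have [measurable]: "g \<in> borel_measurable borel" using g(1) by (rule borel_measurable_continuous_onI)
    have "(\<integral>x. g x \<partial>\<eta> n) = (\<integral>x. \<phi> x \<partial>\<kappa> n)" for n
    proof -
      have "(\<integral>x. g x \<partial>\<eta> n) = (\<integral>u. g (s u) \<partial>\<kappa> n)" by (rule int_\<eta>) simp
      also have "\<dots> = (\<integral>u. \<phi> u \<partial>\<kappa> n)"
        by (intro Bochner_Integration.integral_cong) (auto simp: g s_T p_s sp)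
      finally show ?thesis .
    qed
    moreover have "(\<integral>x. g x \<partial>M) = (\<integral>x. \<phi> x \<partial>\<kappa>')"
    proof -
      have "(\<integral>x. \<phi> x \<partial>\<kappa>') = (\<integral>x. \<phi> (p' x) \<partial>M)"
        unfolding \<kappa>'_def using p'_meas \<phi>_meas by (rule integral_distr)
      also have "\<dots> = (\<integral>x. g x \<partial>M)"
      proof (rule integral_cong_AE)
        show "(\<lambda>x. \<phi> (p' x)) \<in> borel_measurable M" using measurable_compose[OF p'_meas \<phi>_meas] .
        show "AE x in M. \<phi> (p' x) = g x" using AE_T by eventually_elim (auto simp: g p'_def)
      qed auto
      finally show ?thesis by simp
    qed
    ultimately show ?thesis using conv[OF g(1), of b] g(3) by simp
  qed
  ultimately show thesis using that r by blast
qed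

section \<open>The special linear group and its action on the sphere\<close>

lemma continuous_on_det [continuous_intros]:
  fixes f :: "'a :: topological_space \<Rightarrow> real^'n^'n"
  assumes "\<And>i j. continuous_on S (\<lambda>x. f x $ i $ j)"
  shows "continuous_on S (\<lambda>x. det (f x))"
  unfolding det_def by (intro continuous_intros assms)

lemma continuous_on_entry: "continuous_on S (\<lambda>A :: real^'n^'m. A $ i $ j)"
  by (intro continuous_intros)

lemma closed_SL: "closed (SL :: (real^'n^'n) set)"
proof -
  have "continuous_on UNIV (det :: real^'n^'n \<Rightarrow> real)"
    by (intro continuous_intros continuous_on_entry)
  then have "closed (det -` {1} :: (real^'n^'n) set)" by (intro closed_vimage) auto
  then show ?thesis by (simp add: SL_def vimage_def)
qed

lemma SL_one [simp]: "mat 1 \<in> SL" by (simp add: SL_def)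

lemma SL_mult [simp]: "A \<in> SL \<Longrightarrow> B \<in> SL \<Longrightarrow> A ** B \<in> SL" by (simp add: SL_def det_mul)

lemma
  assumes "A \<in> SL"
  shows SL_inv_right [simp]: "A ** matrix_inv A = mat 1"
    and SL_inv_left [simp]: "matrix_inv A ** A = mat 1"
    and SL_inv [simp]: "matrix_inv A \<in> SL"
proof -
  have "\<exists>A'. A ** A' = mat 1 \<and> A' ** A = mat 1"
    using assms invertible_det_nz[of A] by (simp add: SL_def invertible_def)
  from someI_ex[OF this] show *: "A ** matrix_inv A = mat 1" "matrix_inv A ** A = mat 1"
    unfolding matrix_inv_def by auto
  have "det A * det (matrix_inv A) = 1" using *(1) by (metis det_mul det_I)
  then show "matrix_inv A \<in> SL" using assms by (simp add: SL_def)
qed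

lemma SL_vec_inv [simp]:
  assumes "A \<in> SL"
  shows "A *v (matrix_inv A *v x) = x" "matrix_inv A *v (A *v x) = x"
  using assms by (simp_all add: matrix_vector_mul_assoc)

lemma SL_vec_eq_0_iff [simp]: "A \<in> SL \<Longrightarrow> A *v x = 0 \<longleftrightarrow> x = 0"
  by (metis SL_vec_inv(2) matrix_vector_mult_0_right)

text \<open>By Cramer's rule the entries of the inverse are polynomials on \<open>SL\<close>.\<close>

lemma continuous_on_matrix_inv: "continuous_on (SL :: (real^'n^'n) set) matrix_inv"
proof -
  define c :: "real^'n^'n \<Rightarrow> 'n \<Rightarrow> 'n \<Rightarrow> real"
    where "c A k l = det (\<chi> i j. if j = k then axis l 1 $ i else A $ i $ j)" for A k l
  have "matrix_inv A = (\<chi> k l. c A k l)" if "A \<in> SL" for A :: "real^'n^'n"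
  proof -
    have "matrix_inv A $ k $ l = c A k l" for k l
    proof -
      have "A *v (matrix_inv A *v axis l 1) = axis l 1" using that by simp
      then have "matrix_inv A *v axis l 1 = (\<chi> k. c A k l)"
        using that by (subst (asm) cramer) (auto simp: SL_def c_def)
      then show ?thesis by (simp add: matrix_vector_mult_basis column_def vec_eq_iff)
    qed
    then show ?thesis by (simp add: vec_eq_iff)
  qed
  moreover have "continuous_on SL (\<lambda>A. \<chi> k l. c A k l)"
  proof (intro continuous_on_vec_lambda)
    fix k l
    have "continuous_on SL (\<lambda>A. (\<chi> i j. if j = k then axis l 1 $ i else A $ i $ j) $ i' $ j')" for i' j' :: 'n
      by (cases "j' = k") (auto intro: continuous_on_entry)
    then show "continuous_on SL (\<lambda>A. c A k l)" unfolding c_def by (intro continuous_on_det) 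
  qed
  ultimately show ?thesis by (simp cong: continuous_on_cong)
qed

lemma sphere_action_in_sphere: "g \<in> SL \<Longrightarrow> u \<noteq> 0 \<Longrightarrow> sphere_action g u \<in> sphere 0 1"
  by (simp add: sphere_action_def)

lemma sphere_action_mult:
  assumes "h \<in> SL" "u \<noteq> 0"
  shows "sphere_action (g ** h) u = sphere_action g (sphere_action h u)"
  using assms by (simp add: sphere_action_def matrix_vector_mult_scaleR matrix_vector_mul_assoc)

lemma sphere_action_one: "u \<in> sphere 0 1 \<Longrightarrow> sphere_action (mat 1) u = u"
  by (simp add: sphere_action_def)

lemma continuous_on_sphere_action:
  "continuous_on (SL \<times> - {0}) (\<lambda>(g, u :: real^'n). sphere_action g u)"
proof -
  have "continuous_on (SL \<times> - {0}) (\<lambda>x :: (real^'n^'n) \<times> (real^'n). fst x *v snd x)"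
    unfolding matrix_vector_mult_def by (intro continuous_intros)
  then show ?thesis
    unfolding sphere_action_def case_prod_unfold by (auto intro!: continuous_intros)
qed

lemma continuous_on_sphere_action_compose:
  assumes "continuous_on S g" "continuous_on S u" "\<And>x. x \<in> S \<Longrightarrow> g x \<in> SL" "\<And>x. x \<in> S \<Longrightarrow> u x \<noteq> 0"
  shows "continuous_on S (\<lambda>x. sphere_action (g x) (u x))"
  using continuous_on_compose2[OF continuous_on_sphere_action, of S "\<lambda>x. (g x, u x)"] assms
  by (auto intro!: continuous_intros)

lemma SL_group_is_group: "group (SL_group :: (real^'n^'n) monoid)"
proof (rule groupI)
  fix A :: "real^'n^'n" assume "A \<in> carrier SL_group"
  then show "\<exists>B\<in>carrier SL_group. B \<otimes>\<^bsub>SL_group\<^esub> A = \<one>\<^bsub>SL_group\<^esub>"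
    by (auto simp: SL_group_def intro!: bexI[of _ "matrix_inv A"])
qed (auto simp: SL_group_def matrix_mul_assoc)

lemma SL_group_inv: "A \<in> SL \<Longrightarrow> inv\<^bsub>SL_group\<^esub> A = matrix_inv A"
  using group.inv_equality[OF SL_group_is_group, of "matrix_inv A" A] by (simp add: SL_group_def)

text \<open>The indicator of a closed set is a decreasing limit of bounded continuous functions, and closed
  sets generate the Borel sets.\<close>

lemma prob_measures_on_eqI:
  fixes S :: "'a :: metric_space set"
  assumes \<kappa>: "\<kappa>1 \<in> prob_measures_on S" "\<kappa>2 \<in> prob_measures_on S"
    and eq: "\<And>\<phi> :: 'a \<Rightarrow> real. continuous_on S \<phi> \<Longrightarrow> bounded (\<phi> ` S) \<Longrightarrow> (\<integral>x. \<phi> x \<partial>\<kappa>1) = (\<integral>x. \<phi> x \<partial>\<kappa>2)"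
  shows "\<kappa>1 = \<kappa>2"
proof -
  have sets: "sets \<kappa> = sets (restrict_space borel S)" "prob_space \<kappa>" "space \<kappa> = S"
    if "\<kappa> \<in> prob_measures_on S" for \<kappa>
    using that prob_measures_on_space by (auto simp: prob_measures_on_iff)
  have id_meas: "(\<lambda>x. x) \<in> borel_measurable \<kappa>" if "\<kappa> \<in> prob_measures_on S" for \<kappa>
    using measurable_restrict_space1[of "\<lambda>x. x" borel borel S]
    by (simp add: sets[OF that] cong: measurable_cong_sets)
  have closed_lim: "(\<lambda>k. \<integral>x. max 0 (1 - real k * infdist x C) \<partial>\<kappa>) \<longlonglongrightarrow> measure \<kappa> (C \<inter> S)"
    if \<kappa>: "\<kappa> \<in> prob_measures_on S" and C: "closed C" "C \<noteq> {}" for \<kappa> and C :: "'a set"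
  proof -
    interpret prob_space \<kappa> using sets[OF \<kappa>] by simp
    note id_meas[OF \<kappa>, measurable]
    have [measurable]: "C \<in> sets borel" using C by simp
    have inf_meas: "(\<lambda>x. infdist x C) \<in> borel_measurable borel"
      by (intro borel_measurable_continuous_onI continuous_intros)
    have [measurable]: "(\<lambda>x. infdist x C) \<in> borel_measurable \<kappa>"
      using measurable_compose[OF id_meas[OF \<kappa>] inf_meas] .
    have "(\<lambda>k. \<integral>x. max 0 (1 - real k * infdist x C) \<partial>\<kappa>) \<longlonglongrightarrow> (\<integral>x. indicator C x \<partial>\<kappa>)"
    proof (rule integral_dominated_convergence[where w="\<lambda>_. 1"])
      show "(\<lambda>x. max 0 (1 - real k * infdist x C)) \<in> borel_measurable \<kappa>" for k by measurable
      show "AE x in \<kappa>. (\<lambda>k. max 0 (1 - real k * infdist x C)) \<longlonglongrightarrow> indicator C x"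
      proof (rule AE_I2)
        fix x
        show "(\<lambda>k. max 0 (1 - real k * infdist x C)) \<longlonglongrightarrow> indicator C x"
        proof (cases "x \<in> C")
          case True
          then show ?thesis by simp
        next
          case False
          then have "infdist x C > 0" using C in_closed_iff_infdist_zero[of C x] infdist_nonneg[of x C] by fastforce
          then obtain N where N: "1 < real N * infdist x C" using ex_less_of_nat_mult by blast
          have "max 0 (1 - real k * infdist x C) = indicator C x" if "k \<ge> N" for k
          proof -
            have "real N * infdist x C \<le> real k * infdist x C"
              using that \<open>infdist x C > 0\<close> by (intro mult_right_mono) auto
            then show ?thesis using N False by simp
          qed
          then show ?thesis by (intro tendsto_eventually eventually_sequentiallyI)
        qed
      qed
      show "AE x in \<kappa>. norm (max 0 (1 - real k * infdist x C)) \<le> 1" for k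
        by (rule AE_I2) (auto simp: infdist_nonneg)
    qed auto
    then show ?thesis by (simp add: sets[OF \<kappa>])
  qed
  define D where "D \<kappa> = distr \<kappa> borel (\<lambda>x. x)" for \<kappa> :: "'a measure"
  have D_em: "emeasure (D \<kappa>) A = emeasure \<kappa> (A \<inter> S)" if "\<kappa> \<in> prob_measures_on S" "A \<in> sets borel" for \<kappa> A
    unfolding D_def using that id_meas[OF that(1)] sets[OF that(1)] by (subst emeasure_distr) (auto simp: vimage_def Int_def)
  have "D \<kappa>1 = D \<kappa>2"
  proof (rule measure_eqI_generator_eq[where E="Collect closed" and \<Omega>=UNIV and A="\<lambda>_. UNIV"])
    show "Int_stable (Collect closed :: 'a set set)" by (auto simp: Int_stable_def)
    show "emeasure (D \<kappa>1) C = emeasure (D \<kappa>2) C" if "C \<in> Collect closed" for C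
    proof (cases "C = {}")
      case False
      have C: "closed C" using that by simp
      have "(\<integral>x. max 0 (1 - real k * infdist x C) \<partial>\<kappa>1) = (\<integral>x. max 0 (1 - real k * infdist x C) \<partial>\<kappa>2)" for k
        by (rule eq) (auto intro!: continuous_intros simp: bounded_iff infdist_nonneg intro!: exI[of _ 1])
      then have "measure \<kappa>1 (C \<inter> S) = measure \<kappa>2 (C \<inter> S)"
        using closed_lim[OF \<kappa>(1) C False] closed_lim[OF \<kappa>(2) C False] by (simp add: LIMSEQ_unique)
      then show ?thesis
        using D_em[OF \<kappa>(1), of C] D_em[OF \<kappa>(2), of C] sets(2)[OF \<kappa>(1)] sets(2)[OF \<kappa>(2)] C
        by (simp add: finite_measure.emeasure_eq_measure prob_space_def)
    qed simp
    show "sets (D \<kappa>1) = sigma_sets UNIV (Collect closed)" "sets (D \<kappa>2) = sigma_sets UNIV (Collect closed)"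
      by (auto simp: D_def borel_eq_closed)
    show "emeasure (D \<kappa>1) UNIV \<noteq> \<infinity>"
      using D_em[OF \<kappa>(1), of UNIV] prob_space.emeasure_space_1[OF sets(2)[OF \<kappa>(1)]] sets(3)[OF \<kappa>(1)] by simp
  qed auto
  show ?thesis
  proof (rule measure_eqI)
    show "sets \<kappa>1 = sets \<kappa>2" using \<kappa> sets by simp
    fix A assume "A \<in> sets \<kappa>1"
    then obtain A' where "A' \<in> sets borel" "A = A' \<inter> S"
      using sets(1)[OF \<kappa>(1)] by (auto simp: sets_restrict_space)
    then show "emeasure \<kappa>1 A = emeasure \<kappa>2 A" using D_em \<kappa> \<open>D \<kappa>1 = D \<kappa>2\<close> by metis
  qed
qed

lemma norm_sphere_action [simp]: "g \<in> SL \<Longrightarrow> norm u = 1 \<Longrightarrow> norm (sphere_action g u) = 1"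
  using sphere_action_in_sphere[of g u] by (cases "u = 0") auto

lemma sphere_action_inv [simp]:
  assumes "g \<in> SL" "norm u = 1"
  shows "sphere_action g (sphere_action (matrix_inv g) u) = u"
    and "sphere_action (matrix_inv g) (sphere_action g u) = u"
proof -
  have "u \<noteq> 0" using assms by auto
  then show "sphere_action g (sphere_action (matrix_inv g) u) = u"
      "sphere_action (matrix_inv g) (sphere_action g u) = u"
    using assms by (simp_all add: sphere_action_mult[symmetric] sphere_action_one)
qed

lemma sphere_action_measurable:
  assumes "g \<in> SL"
  shows "sphere_action g \<in> restrict_space borel (sphere 0 1) \<rightarrow>\<^sub>M restrict_space borel (sphere 0 1 :: (real^'n) set)"
proof (rule measurable_restrict_space3)
  have [measurable]: "(*v) g \<in> borel_measurable borel"
    by (intro borel_measurable_continuous_onI matrix_vector_mult_linear_continuous_on)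
  show "sphere_action g \<in> borel_measurable borel"
    unfolding sphere_action_def by measurable
  show "sphere_action g \<in> sphere 0 1 \<rightarrow> sphere 0 1"
    using assms by auto
qed

lemma continuous_imp_integrable:
  fixes \<phi> :: "'a :: metric_space \<Rightarrow> real"
  assumes "compact S" "continuous_on S \<phi>" "\<kappa> \<in> prob_measures_on S"
  shows "\<phi> \<in> borel_measurable \<kappa>" "integrable \<kappa> \<phi>"
proof -
  interpret prob_space \<kappa> using assms(3) by (simp add: prob_measures_on_iff)
  show *: "\<phi> \<in> borel_measurable \<kappa>"
    using borel_measurable_continuous_on_restrict[OF assms(2)] assms(3)
    by (simp add: prob_measures_on_iff cong: measurable_cong_sets)
  obtain b where "\<And>x. x \<in> S \<Longrightarrow> norm (\<phi> x) \<le> b"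
    using compact_imp_bounded[OF compact_continuous_image[OF assms(2,1)]] by (auto simp: bounded_iff)
  then show "integrable \<kappa> \<phi>"
    using * prob_measures_on_space[OF assms(3)] by (intro integrable_const_bound[of _ b]) (auto intro!: AE_I2)
qed

lemma preserves_iff:
  fixes \<kappa> :: "(real^'n) measure"
  assumes "g \<in> SL" and \<kappa>: "\<kappa> \<in> prob_measures_on (sphere 0 1)"
  shows "preserves g \<kappa> \<longleftrightarrow>
    (\<forall>\<phi>. continuous_on (sphere 0 1) \<phi> \<longrightarrow> (\<integral>u. \<phi> (sphere_action g u) \<partial>\<kappa>) = (\<integral>u. \<phi> u \<partial>\<kappa> :: real))"
proof -
  have meas: "sphere_action g \<in> \<kappa> \<rightarrow>\<^sub>M restrict_space borel (sphere 0 1)"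
    using sphere_action_measurable[OF assms(1)] \<kappa> by (simp add: prob_measures_on_iff cong: measurable_cong_sets)
  let ?D = "distr \<kappa> (restrict_space borel (sphere 0 1)) (sphere_action g)"
  have D: "?D \<in> prob_measures_on (sphere 0 1)"
    using \<kappa> meas by (intro distr_in_prob_measures_on) (auto simp: prob_measures_on_iff)
  have int: "(\<integral>u. \<phi> u \<partial>?D) = (\<integral>u. \<phi> (sphere_action g u) \<partial>\<kappa>)" if "continuous_on (sphere 0 1) \<phi>" for \<phi> :: "real^'n \<Rightarrow> real"
    using meas borel_measurable_continuous_on_restrict[OF that] by (rule integral_distr)
  show ?thesis
  proof
    assume "preserves g \<kappa>"
    then show "\<forall>\<phi>. continuous_on (sphere 0 1) \<phi> \<longrightarrow> (\<integral>u. \<phi> (sphere_action g u) \<partial>\<kappa>) = (\<integral>u. \<phi> u \<partial>\<kappa> :: real)"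
      using int by (simp add: preserves_def)
  next
    assume "\<forall>\<phi>. continuous_on (sphere 0 1) \<phi> \<longrightarrow> (\<integral>u. \<phi> (sphere_action g u) \<partial>\<kappa>) = (\<integral>u. \<phi> u \<partial>\<kappa> :: real)"
    then show "preserves g \<kappa>"
      unfolding preserves_def using int by (intro prob_measures_on_eqI[OF D \<kappa>]) auto
  qed
qed

lemma continuous_on_sphere_compose:
  assumes "g \<in> SL" "continuous_on (sphere 0 1 :: (real^'n) set) \<phi>"
  shows "continuous_on (sphere 0 1) (\<lambda>u. \<phi> (sphere_action g u))"
  using assms
  by (intro continuous_on_compose2[OF assms(2)] continuous_on_sphere_action_compose continuous_intros) auto

text \<open>Testing invariance against continuous functions turns it into a closed condition on the matrix.\<close>

lemma stabiliser_subgroup: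
  fixes \<kappa> :: "(real^'n) measure"
  assumes \<kappa>: "\<kappa> \<in> prob_measures_on (sphere 0 1)"
  shows "subgroup {g \<in> SL. preserves g \<kappa>} SL_group" "closed {g \<in> SL. preserves g \<kappa>}"
proof -
  let ?S = "sphere 0 1 :: (real^'n) set"
  let ?H = "{g \<in> SL. preserves g \<kappa>}"
  have sp: "space \<kappa> = ?S" using prob_measures_on_space[OF \<kappa>] .
  interpret prob_space \<kappa> using \<kappa> by (simp add: prob_measures_on_iff)
  have int_mult: "(\<integral>u. \<phi> (sphere_action (g ** h) u) \<partial>\<kappa>) = (\<integral>u. \<phi> (sphere_action g (sphere_action h u)) \<partial>\<kappa>)"
    if "g \<in> SL" "h \<in> SL" for g h and \<phi> :: "real^'n \<Rightarrow> real"
    by (intro Bochner_Integration.integral_cong) (auto simp: sp that intro!: arg_cong[of _ _ \<phi>] sphere_action_mult)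
  show "subgroup ?H SL_group"
  proof
    show "?H \<subseteq> carrier SL_group" by (auto simp: SL_group_def)
    show "\<one>\<^bsub>SL_group\<^esub> \<in> ?H"
    proof -
      have "(\<integral>u. \<phi> (sphere_action (mat 1) u) \<partial>\<kappa>) = (\<integral>u. \<phi> u \<partial>\<kappa>)" for \<phi> :: "real^'n \<Rightarrow> real"
        by (intro Bochner_Integration.integral_cong) (auto simp: sp sphere_action_one)
      then show ?thesis by (simp add: SL_group_def preserves_iff[OF SL_one \<kappa>])
    qed
    show "g \<otimes>\<^bsub>SL_group\<^esub> h \<in> ?H" if "g \<in> ?H" "h \<in> ?H" for g h
    proof -
      have gh: "g \<in> SL" "h \<in> SL" using that by auto
      have "(\<integral>u. \<phi> (sphere_action (g ** h) u) \<partial>\<kappa>) = (\<integral>u. \<phi> u \<partial>\<kappa>)" if "continuous_on ?S \<phi>" for \<phi> :: "real^'n \<Rightarrow> real"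
      proof -
        have "(\<integral>u. \<phi> (sphere_action g (sphere_action h u)) \<partial>\<kappa>) = (\<integral>u. \<phi> (sphere_action g u) \<partial>\<kappa>)"
          using \<open>h \<in> ?H\<close> continuous_on_sphere_compose[OF gh(1) that] preserves_iff[OF gh(2) \<kappa>] by blast
        also have "\<dots> = (\<integral>u. \<phi> u \<partial>\<kappa>)"
          using \<open>g \<in> ?H\<close> that preserves_iff[OF gh(1) \<kappa>] by blast
        finally show ?thesis using int_mult[OF gh] by simp
      qed
      then show ?thesis using gh by (simp add: SL_group_def preserves_iff[OF _ \<kappa>])
    qed
    show "inv\<^bsub>SL_group\<^esub> g \<in> ?H" if "g \<in> ?H" for g
    proof -
      have g: "g \<in> SL" using that by auto
      have "(\<integral>u. \<phi> (sphere_action (matrix_inv g) u) \<partial>\<kappa>) = (\<integral>u. \<phi> u \<partial>\<kappa>)" if \<phi>: "continuous_on ?S \<phi>" for \<phi> :: "real^'n \<Rightarrow> real"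
      proof -
        have "(\<integral>u. \<phi> (sphere_action (matrix_inv g) u) \<partial>\<kappa>)
            = (\<integral>u. \<phi> (sphere_action (matrix_inv g) (sphere_action g u)) \<partial>\<kappa>)"
          using \<open>g \<in> ?H\<close> continuous_on_sphere_compose[OF SL_inv[OF g] \<phi>]
            iffD1[OF preserves_iff[OF g \<kappa>], THEN spec, of "\<lambda>v. \<phi> (sphere_action (matrix_inv g) v)"]
          by simp
        also have "\<dots> = (\<integral>u. \<phi> u \<partial>\<kappa>)"
          using g by (intro Bochner_Integration.integral_cong) (auto simp: sp)
        finally show ?thesis .
      qed
      then show ?thesis using g by (simp add: SL_group_inv preserves_iff[OF _ \<kappa>])
    qed
  qed
  show "closed ?H"
    unfolding closed_sequential_limits
  proof (intro allI impI)
    fix x :: "nat \<Rightarrow> real^'n^'n" and l assume "(\<forall>n. x n \<in> ?H) \<and> x \<longlonglongrightarrow> l"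
    then have x: "\<And>n. x n \<in> SL" "\<And>n. preserves (x n) \<kappa>" and lim: "x \<longlonglongrightarrow> l" by auto
    have l: "l \<in> SL" using closed_SL lim x(1) closed_sequentially by blast
    have "(\<integral>u. \<phi> (sphere_action l u) \<partial>\<kappa>) = (\<integral>u. \<phi> u \<partial>\<kappa>)" if \<phi>: "continuous_on ?S \<phi>" for \<phi> :: "real^'n \<Rightarrow> real"
    proof -
      obtain b where b: "\<And>u. u \<in> ?S \<Longrightarrow> norm (\<phi> u) \<le> b"
        using compact_imp_bounded[OF compact_continuous_image[OF \<phi> compact_sphere]] unfolding bounded_iff by blast
      have meas: "(\<lambda>u. \<phi> (sphere_action g u)) \<in> borel_measurable \<kappa>" if "g \<in> SL" for g
        using continuous_imp_integrable(1)[OF _ continuous_on_sphere_compose[OF that \<phi>] \<kappa>] by simp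
      have "(\<lambda>n. \<integral>u. \<phi> (sphere_action (x n) u) \<partial>\<kappa>) \<longlonglongrightarrow> (\<integral>u. \<phi> (sphere_action l u) \<partial>\<kappa>)"
      proof (rule integral_dominated_convergence[where w="\<lambda>_. b"])
        show "AE u in \<kappa>. (\<lambda>n. \<phi> (sphere_action (x n) u)) \<longlonglongrightarrow> \<phi> (sphere_action l u)"
        proof (rule AE_I2)
          fix u assume "u \<in> space \<kappa>"
          then have u: "u \<in> ?S" by (simp add: sp)
          then have "u \<noteq> 0" by auto
          have c: "continuous_on SL (\<lambda>g. \<phi> (sphere_action g u))"
            using \<open>u \<noteq> 0\<close> sphere_action_in_sphere[OF _ \<open>u \<noteq> 0\<close>]
            by (intro continuous_on_compose2[OF \<phi>] continuous_on_sphere_action_compose continuous_intros) auto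
          show "(\<lambda>n. \<phi> (sphere_action (x n) u)) \<longlonglongrightarrow> \<phi> (sphere_action l u)"
            using continuous_on_tendsto_compose[OF c lim l] x(1) by simp
        qed
        show "AE u in \<kappa>. norm (\<phi> (sphere_action (x n) u)) \<le> b" for n
          using b x(1) by (intro AE_I2) (auto simp: sp)
      qed (use meas l x in auto)
      moreover have "(\<integral>u. \<phi> (sphere_action (x n) u) \<partial>\<kappa>) = (\<integral>u. \<phi> u \<partial>\<kappa>)" for n
        using x \<phi> preserves_iff[OF x(1) \<kappa>] by simp
      ultimately show ?thesis by (simp add: LIMSEQ_const_iff)
    qed
    then show "l \<in> ?H" using l preserves_iff[OF l \<kappa>] by simp
  qed
qed

text \<open>The condition \<open>eq\<close> says that the images of \<open>\<kappa>\<close> under \<open>inverse g\<close> and \<open>inverse h\<close> agree; applied to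
  \<open>\<phi>\<close> composed with \<open>g\<close> it says that \<open>g (inverse h)\<close> preserves \<open>\<kappa>\<close>.\<close>

lemma G_group_preserves:
  fixes \<kappa> :: "(real^'n) measure" and \<nu> :: "(real^'n^'n) measure"
  assumes \<kappa>: "\<kappa> \<in> prob_measures_on (sphere 0 1)" and sp: "space \<nu> = SL"
    and eq: "\<And>g h \<phi>. g \<in> measure_support \<nu> \<Longrightarrow> h \<in> measure_support \<nu> \<Longrightarrow> continuous_on (sphere 0 1) \<phi> \<Longrightarrow>
      (\<integral>u. \<phi> (sphere_action (matrix_inv g) u) \<partial>\<kappa>) = (\<integral>u. \<phi> (sphere_action (matrix_inv h) u) \<partial>\<kappa> :: real)"
    and "A \<in> G_group \<nu>"
  shows "preserves A \<kappa>"
proof -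
  have SL: "g \<in> SL" if "g \<in> measure_support \<nu>" for g using that sp by (auto simp: measure_support_def)
  have sp\<kappa>: "space \<kappa> = sphere 0 1" using prob_measures_on_space[OF \<kappa>] .
  have "preserves (g ** matrix_inv h) \<kappa>" if "g \<in> measure_support \<nu>" "h \<in> measure_support \<nu>" for g h
  proof -
    have gh: "g \<in> SL" "h \<in> SL" using SL that by auto
    have "(\<integral>u. \<phi> (sphere_action (g ** matrix_inv h) u) \<partial>\<kappa>) = (\<integral>u. \<phi> u \<partial>\<kappa>)"
      if \<phi>: "continuous_on (sphere 0 1) \<phi>" for \<phi> :: "real^'n \<Rightarrow> real"
    proof -
      have "(\<integral>u. \<phi> (sphere_action (g ** matrix_inv h) u) \<partial>\<kappa>)
          = (\<integral>u. \<phi> (sphere_action g (sphere_action (matrix_inv h) u)) \<partial>\<kappa>)"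
        by (intro Bochner_Integration.integral_cong) (auto simp: sp\<kappa> gh intro!: arg_cong[of _ _ \<phi>] sphere_action_mult)
      also have "\<dots> = (\<integral>u. \<phi> (sphere_action g (sphere_action (matrix_inv g) u)) \<partial>\<kappa>)"
        using eq[OF \<open>h \<in> measure_support \<nu>\<close> \<open>g \<in> measure_support \<nu>\<close> continuous_on_sphere_compose[OF gh(1) \<phi>]] .
      also have "\<dots> = (\<integral>u. \<phi> u \<partial>\<kappa>)"
        by (intro Bochner_Integration.integral_cong)
          (auto simp: sp\<kappa> gh)
      finally show ?thesis .
    qed
    then show ?thesis using gh by (subst preserves_iff[OF _ \<kappa>]) auto
  qed
  then have "G_group \<nu> \<subseteq> {g \<in> SL. preserves g \<kappa>}"
    unfolding G_group_def closed_group_generated_def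
    using stabiliser_subgroup[OF \<kappa>] SL by (intro hull_minimal) auto
  then show ?thesis using \<open>A \<in> G_group \<nu>\<close> by auto
qed

section \<open>Lebesgue measure under linear maps\<close>

lemma prod_Basis_cart:
  fixes f :: "real^'n \<Rightarrow> 'b :: comm_monoid_mult"
  shows "(\<Prod>b\<in>Basis. f b) = (\<Prod>i\<in>UNIV. f (axis i 1 :: real^'n))"
proof -
  have B: "(Basis :: (real^'n) set) = range (\<lambda>i. axis i 1)" by (auto simp: Basis_vec_def)
  have inj: "inj (\<lambda>i :: 'n. axis i (1::real))" by (auto simp: inj_on_def axis_eq_axis)
  show ?thesis unfolding B prod.reindex[OF inj] by simp
qed

lemma measurable_matrix_vector_mult [measurable]: "(*v) (A :: real^'n^'m) \<in> borel_measurable borel"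
  by (intro borel_measurable_continuous_onI matrix_vector_mult_linear_continuous_on)

lemma emeasure_lborel_box_cart:
  fixes l u :: "real^'n"
  assumes "\<And>i. l $ i \<le> u $ i"
  shows "emeasure lborel (box l u) = (\<Prod>i\<in>UNIV. u $ i - l $ i)"
proof -
  have "\<forall>b\<in>Basis. l \<bullet> b \<le> u \<bullet> b" using assms by (auto simp: Basis_vec_def inner_axis)
  then show ?thesis by (simp add: emeasure_lborel_box_eq prod_Basis_cart inner_axis)
qed

lemma lborel_distr_eq_cartI:
  fixes f :: "real^'n \<Rightarrow> real^'n"
  assumes "f \<in> borel_measurable borel"
    and "\<And>l u. (\<And>i. l $ i \<le> u $ i) \<Longrightarrow> emeasure lborel (f -` box l u) = emeasure lborel (box l u)"
  shows "distr lborel borel f = lborel"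
proof (rule lborel_eqI[symmetric])
  fix l u :: "real^'n" assume lu: "\<And>b. b \<in> Basis \<Longrightarrow> l \<bullet> b \<le> u \<bullet> b"
  have "l $ i \<le> u $ i" for i using lu[of "axis i 1"] by (simp add: inner_axis)
  then show "emeasure (distr lborel borel f) (box l u) = (\<Prod>b\<in>Basis. (u - l) \<bullet> b)"
    using assms by (simp add: emeasure_distr emeasure_lborel_box_cart prod_Basis_cart inner_axis)
qed simp

text \<open>The change of variables formula for an invertible matrix, by decomposition into elementary
  matrices.\<close>

lemma emeasure_matrix_vimage:
  fixes A :: "real^'n^'n"
  assumes "det A \<noteq> 0" "T \<in> sets borel"
  shows "ennreal \<bar>det A\<bar> * emeasure lborel ((*v) A -` T) = emeasure lborel T"
proof -
  define Q :: "real^'n^'n \<Rightarrow> bool" where "Q A \<longleftrightarrow> (det A \<noteq> 0 \<longrightarrow>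
    (\<forall>T\<in>sets borel. ennreal \<bar>det A\<bar> * emeasure lborel ((*v) A -` T) = emeasure lborel T))" for A
  have Q_distr: "Q A" if "distr lborel borel ((*v) A) = lborel" "\<bar>det A\<bar> = 1" for A
    unfolding Q_def
  proof (intro impI ballI)
    fix T :: "(real^'n) set" assume "T \<in> sets borel"
    then have "emeasure (distr lborel borel ((*v) A)) T = emeasure lborel ((*v) A -` T)"
      by (subst emeasure_distr) auto
    then show "ennreal \<bar>det A\<bar> * emeasure lborel ((*v) A -` T) = emeasure lborel T"
      using that by simp
  qed
  have "Q A"
  proof (rule induct_matrix_elementary_alt)
    fix A B assume Q: "Q A" "Q B"
    show "Q (A ** B)"
      unfolding Q_def
    proof (intro impI ballI)
      fix T :: "(real^'n) set" assume "det (A ** B) \<noteq> 0" and T[measurable]: "T \<in> sets borel"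
      then have d: "det A \<noteq> 0" "det B \<noteq> 0" by (auto simp: det_mul)
      have [measurable]: "(*v) A -` T \<in> sets borel"
        using measurable_sets[OF measurable_matrix_vector_mult T, of A] by simp
      have "ennreal \<bar>det (A ** B)\<bar> * emeasure lborel ((*v) (A ** B) -` T)
          = ennreal \<bar>det A\<bar> * (ennreal \<bar>det B\<bar> * emeasure lborel ((*v) B -` ((*v) A -` T)))"
        by (simp add: det_mul abs_mult ennreal_mult mult.assoc vimage_def matrix_vector_mul_assoc)
      also have "\<dots> = emeasure lborel T" using Q d by (simp add: Q_def)
      finally show "ennreal \<bar>det (A ** B)\<bar> * emeasure lborel ((*v) (A ** B) -` T) = emeasure lborel T" .
    qed
  next
    fix A :: "real^'n^'n" and i assume "row i A = 0"
    then show "Q A" by (simp add: Q_def det_zero_row(1))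
  next
    fix A :: "real^'n^'n" assume diag: "\<And>i j. i \<noteq> j \<Longrightarrow> A $ i $ j = 0"
    then have det: "det A = (\<Prod>i\<in>UNIV. A $ i $ i)" by (rule det_diagonal)
    show "Q A"
      unfolding Q_def
    proof (intro impI ballI)
      fix T :: "(real^'n) set" assume "det A \<noteq> 0" and T[measurable]: "T \<in> sets borel"
      define c where "c b = (\<Sum>i\<in>UNIV. b $ i * A $ i $ i)" for b :: "real^'n"
      have c_axis: "c (axis i 1) = A $ i $ i" for i
        by (simp add: c_def axis_def if_distrib[of "\<lambda>x. x * _"] cong: if_cong)
      have "c b \<noteq> 0" if "b \<in> Basis" for b
        using that \<open>det A \<noteq> 0\<close> by (auto simp: Basis_vec_def c_axis det)
      moreover have "0 + (\<Sum>b\<in>Basis. (c b * (x \<bullet> b)) *\<^sub>R b) = A *v x" for x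
      proof -
        have "(\<Sum>b\<in>Basis. (c b * (x \<bullet> b)) *\<^sub>R b) \<bullet> axis i 1 = (A *v x) \<bullet> axis i 1" for i
        proof -
          have "(\<Sum>b\<in>Basis. (c b * (x \<bullet> b)) *\<^sub>R b) \<bullet> axis i 1 = c (axis i 1) * (x \<bullet> axis i 1)"
            by (subst inner_sum_left_Basis) auto
          also have "\<dots> = (\<Sum>j\<in>UNIV. A $ i $ j * x $ j)"
            using diag by (simp add: c_axis inner_axis sum.remove[of UNIV i])
          finally show ?thesis by (simp add: inner_axis matrix_vector_mult_def)
        qed
        then show ?thesis by (simp add: inner_axis vec_eq_iff)
      qed
      ultimately have lb: "lborel = density (distr lborel borel ((*v) A)) (\<lambda>_. \<Prod>b\<in>Basis. \<bar>c b\<bar>)"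
        using lborel_affine_euclidean[of c 0] by simp
      have "(\<Prod>b\<in>Basis. \<bar>c b\<bar>) = \<bar>det A\<bar>"
        by (simp add: prod_Basis_cart c_axis det abs_prod)
      with lb have lb': "lborel = density (distr lborel borel ((*v) A)) (\<lambda>_. ennreal \<bar>det A\<bar>)" by simp
      have "emeasure lborel T = emeasure (density (distr lborel borel ((*v) A)) (\<lambda>_. ennreal \<bar>det A\<bar>)) T"
        using lb' by simp
      also have "\<dots> = ennreal \<bar>det A\<bar> * emeasure (distr lborel borel ((*v) A)) T"
        by (simp add: emeasure_density nn_integral_cmult_indicator)
      also have "emeasure (distr lborel borel ((*v) A)) T = emeasure lborel ((*v) A -` T)"
        by (subst emeasure_distr) auto
      finally show "ennreal \<bar>det A\<bar> * emeasure lborel ((*v) A -` T) = emeasure lborel T" by simp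
    qed
  next
    fix m n :: 'n assume "m \<noteq> n"
    let ?t = "Transposition.transpose m n"
    let ?A = "(\<chi> i j. mat 1 $ i $ ?t j) :: real^'n^'n"
    have A: "?A *v x = (\<chi> i. x $ ?t i)" for x
    proof -
      have "(\<Sum>j\<in>UNIV. (mat 1 :: real^'n^'n) $ i $ ?t j * x $ j) = x $ ?t i" for i
      proof -
        have "i = ?t j \<longleftrightarrow> j = ?t i" for j by (metis transpose_involutory)
        then show ?thesis by (simp add: mat_def if_distrib[of "\<lambda>y. y * _"] cong: if_cong)
      qed
      then show ?thesis by (simp add: matrix_vector_mult_def vec_eq_iff)
    qed
    show "Q ?A"
    proof (rule Q_distr)
      have "?t permutes UNIV" by (simp add: permutes_swap_id)
      then have "det ?A = of_int (sign ?t) * det (mat 1 :: real^'n^'n)" by (rule det_permute_columns)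
      then show "\<bar>det ?A\<bar> = 1" by (simp add: sign_def)
      show "distr lborel borel ((*v) ?A) = lborel"
      proof (rule lborel_distr_eq_cartI)
        fix l u :: "real^'n" assume lu: "\<And>i. l $ i \<le> u $ i"
        have "(*v) ?A -` box l u = box (\<chi> i. l $ ?t i) (\<chi> i. u $ ?t i)"
        proof (rule subset_antisym; rule subsetI)
          fix x assume "x \<in> box (\<chi> i. l $ ?t i) (\<chi> i. u $ ?t i)"
          then have *: "\<And>i. l $ ?t i < x $ i \<and> x $ i < u $ ?t i"
            by (simp add: mem_box_cart)
          have "l $ i < x $ ?t i \<and> x $ ?t i < u $ i" for i using *[of "?t i"] by simp
          then show "x \<in> (*v) ?A -` box l u" by (simp add: A mem_box_cart)
        next
          fix x assume "x \<in> (*v) ?A -` box l u"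
          then have *: "\<And>i. l $ i < x $ ?t i \<and> x $ ?t i < u $ i"
            by (simp add: A mem_box_cart)
          have "l $ ?t i < x $ i \<and> x $ i < u $ ?t i" for i using *[of "?t i"] by simp
          then show "x \<in> box (\<chi> i. l $ ?t i) (\<chi> i. u $ ?t i)" by (simp add: mem_box_cart)
        qed
        moreover have "(\<Prod>i\<in>UNIV. u $ ?t i - l $ ?t i) = (\<Prod>i\<in>UNIV. u $ i - l $ i)"
          by (rule prod.reindex_bij_betw) (simp add: bij_swap_iff)
        ultimately show "emeasure lborel ((*v) ?A -` box l u) = emeasure lborel (box l u)"
          using lu by (simp add: emeasure_lborel_box_cart)
      qed simp
    qed
  next
    fix m n :: 'n assume "m \<noteq> n"
    let ?A = "(\<chi> i j. of_bool (i = m \<and> j = n \<or> i = j)) :: real^'n^'n"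
    have Ax: "?A *v x = (\<chi> i. if i = m then x $ m + x $ n else x $ i)" for x
    proof -
      have "(\<Sum>j\<in>UNIV. of_bool (i = m \<and> j = n \<or> i = j) * x $ j) = (if i = m then x $ m + x $ n else x $ i)" for i
      proof -
        have "(\<Sum>j\<in>UNIV. of_bool (i = m \<and> j = n \<or> i = j) * x $ j) = (\<Sum>j\<in>(if i = m then {m, n} else {i}). x $ j)"
          by (intro sum.mono_neutral_cong_right) (auto split: if_splits)
        then show ?thesis using \<open>m \<noteq> n\<close> by simp
      qed
      then show ?thesis by (simp add: matrix_vector_mult_def vec_eq_iff)
    qed
    then have A: "(*v) ?A = (\<lambda>x. \<chi> i. if i = m then x $ m + x $ n else x $ i)" by (rule ext)
    have "det (\<chi> k. if k = m then row m (mat 1) + 1 *s row n (mat 1) else row k (mat 1)) = det (mat 1 :: real^'n^'n)"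
      using det_row_operation[OF \<open>m \<noteq> n\<close>, of "mat 1 :: real^'n^'n" 1] .
    moreover have "(\<chi> k. if k = m then row m (mat 1) + 1 *s row n (mat 1) else row k (mat 1)) = ?A"
      using \<open>m \<noteq> n\<close> by (auto simp: vec_eq_iff row_def mat_def)
    ultimately have det: "det ?A = 1" by simp
    show "Q ?A"
    proof (rule Q_distr)
      show "\<bar>det ?A\<bar> = 1" using det by simp
      show "distr lborel borel ((*v) ?A) = lborel"
      proof (rule lborel_distr_eq_cartI)
        fix l u :: "real^'n"
        let ?S = "(*v) ?A -` box l u"
        have SL: "?A \<in> SL" using det by (simp add: SL_def)
        have im: "(*v) ?A ` ?S = box l u"
        proof (rule subset_antisym; rule subsetI)
          fix y assume "y \<in> box l u"
          then show "y \<in> (*v) ?A ` ?S"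
            using SL_vec_inv(1)[OF SL, of y] by (intro image_eqI[of _ _ "matrix_inv ?A *v y"]) auto
        qed auto
        have "?S = (*v) (matrix_inv ?A) ` box l u"
        proof (rule subset_antisym; rule subsetI)
          fix x assume "x \<in> ?S"
          then show "x \<in> (*v) (matrix_inv ?A) ` box l u"
            using SL_vec_inv(2)[OF SL] by (intro image_eqI[of _ _ "?A *v x"]) auto
        qed (use SL_vec_inv(1)[OF SL] in auto)
        then have "bounded ?S" by (simp add: bounded_linear_image bounded_box matrix_vector_mul_bounded_linear)
        moreover have "open ?S"
          by (intro open_vimage open_box matrix_vector_mult_linear_continuous_on)
        ultimately have S: "?S \<in> lmeasurable" by (rule lmeasurable_open)
        have "1 * measure lebesgue ?S = measure lebesgue ((*v) ?A ` ?S)"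
        proof (intro measure_linear_sufficient[THEN conjunct2] S)
          show "measure lebesgue ((*v) ?A ` cbox a b) = 1 * measure lebesgue (cbox a b)" for a b
          proof (cases "cbox a b = {}")
            case False
            let ?C = "cbox 0 (b - a)"
            have tr: "cbox a b = (+) a ` ?C" by (simp flip: cbox_translation)
            have "?C \<noteq> {}" using False tr by auto
            then have "measure lebesgue ((*v) ?A ` ?C) = measure lebesgue ?C"
              unfolding A using measure_shear_interval[OF \<open>m \<noteq> n\<close>, of 0 "b - a"] by simp
            moreover have "(*v) ?A ` cbox a b = (+) (?A *v a) ` ((*v) ?A ` ?C)"
              unfolding tr by (simp add: image_image matrix_vector_right_distrib)
            ultimately show ?thesis unfolding tr by (simp add: measure_translation)
          qed simp
        qed (rule matrix_vector_mul_linear)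
        then have "measure lebesgue ?S = measure lebesgue (box l u)" unfolding im by (simp only: mult_1)
        then have "emeasure lebesgue ?S = emeasure lebesgue (box l u)"
          using S by (simp add: emeasure_eq_measure2)
        moreover have "?S \<in> sets borel" using \<open>open ?S\<close> by simp
        ultimately show "emeasure lborel ?S = emeasure lborel (box l u)" by simp
      qed simp
    qed
  qed
  then show ?thesis using assms by (simp add: Q_def)
qed

lemma lborel_SL_invariant:
  fixes g :: "real^'n^'n"
  assumes "g \<in> SL"
  shows "distr lborel borel ((*v) g) = lborel"
proof (rule measure_eqI)
  fix T :: "(real^'n) set" assume "T \<in> sets (distr lborel borel ((*v) g))"
  then show "emeasure (distr lborel borel ((*v) g)) T = emeasure lborel T"
    using emeasure_matrix_vimage[of g T] assms by (simp add: emeasure_distr SL_def)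
qed simp

section \<open>Laws of directions\<close>

text \<open>The value at \<open>0\<close> is an arbitrary unit vector, so that \<open>direction\<close> always maps into the sphere.\<close>

definition direction :: "real^'n \<Rightarrow> real^'n" where
  "direction v = (if v = 0 then axis undefined 1 else sgn v)"

lemma norm_direction [simp]: "norm (direction v) = 1"
  by (simp add: direction_def norm_sgn)

lemma direction_measurable: "direction \<in> borel \<rightarrow>\<^sub>M restrict_space borel (sphere 0 1)"
proof (rule measurable_restrict_space2)
  show "direction \<in> borel_measurable borel"
    unfolding direction_def sgn_div_norm by measurable
qed auto

lemma sphere_action_direction:
  assumes "g \<in> SL" "v \<noteq> 0"
  shows "sphere_action g (direction v) = direction (g *v v)"
  using assms by (simp add: sphere_action_def direction_def sgn_div_norm matrix_vector_mult_scaleR)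

lemma nn_integral_SL:
  assumes "g \<in> SL" and [measurable]: "F \<in> borel_measurable borel"
  shows "(\<integral>\<^sup>+v. F (g *v v) \<partial>lborel) = (\<integral>\<^sup>+v. F v \<partial>lborel)"
proof -
  have "(\<integral>\<^sup>+v. F v \<partial>lborel) = (\<integral>\<^sup>+v. F v \<partial>distr lborel borel ((*v) g))"
    using lborel_SL_invariant[OF assms(1)] by simp
  then show ?thesis by (simp add: nn_integral_distr)
qed

lemma
  fixes F :: "real^'n \<Rightarrow> real"
  assumes "g \<in> SL" and [measurable]: "F \<in> borel_measurable borel"
  shows integral_SL: "(\<integral>v. F (g *v v) \<partial>lborel) = (\<integral>v. F v \<partial>lborel)"
    and integrable_SL: "integrable lborel (\<lambda>v. F (g *v v)) \<longleftrightarrow> integrable lborel F"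
proof -
  have "(\<integral>v. F v \<partial>lborel) = (\<integral>v. F v \<partial>distr lborel borel ((*v) g))"
    using lborel_SL_invariant[OF assms(1)] by simp
  then show "(\<integral>v. F (g *v v) \<partial>lborel) = (\<integral>v. F v \<partial>lborel)" by (simp add: integral_distr)
  have "integrable lborel F \<longleftrightarrow> integrable (distr lborel borel ((*v) g)) F"
    using lborel_SL_invariant[OF assms(1)] by simp
  then show "integrable lborel (\<lambda>v. F (g *v v)) \<longleftrightarrow> integrable lborel F" by (simp add: integrable_distr_eq)
qed

definition direction_law :: "(real^'n \<Rightarrow> real) \<Rightarrow> (real^'n) measure" where
  "direction_law f = distr (density lborel (\<lambda>v. ennreal ((f v)\<^sup>2))) (restrict_space borel (sphere 0 1)) direction"

lemma direction_law_prob: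
  assumes "f \<in> borel_measurable borel" "(\<integral>\<^sup>+v. ennreal ((f v)\<^sup>2) \<partial>lborel) = 1"
  shows "direction_law f \<in> prob_measures_on (sphere 0 1)"
  unfolding direction_law_def
proof (rule distr_in_prob_measures_on)
  show "prob_space (density lborel (\<lambda>v. ennreal ((f v)\<^sup>2)))"
    using assms by (intro prob_spaceI) (simp add: emeasure_density)
qed (use direction_measurable in simp)

text \<open>The map \<open>direction\<close> intertwines the linear action and the action on the sphere, so the image of
  the law of \<open>f\<close> under \<open>inverse g\<close> is the law of \<open>f \<circ> g\<close>.\<close>

lemma integral_direction_law:
  fixes f :: "real^'n \<Rightarrow> real"
  assumes g: "g \<in> SL" and [measurable]: "f \<in> borel_measurable borel" and \<phi>: "continuous_on (sphere 0 1) \<phi>"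
  shows "(\<integral>u. \<phi> (sphere_action (matrix_inv g) u) \<partial>direction_law f) = (\<integral>v. \<phi> (direction v) * (f (g *v v))\<^sup>2 \<partial>lborel)"
proof -
  note direction_measurable[measurable]
  have [measurable]: "(\<lambda>u. \<phi> (sphere_action (matrix_inv g) u)) \<in> borel_measurable (restrict_space borel (sphere 0 1))"
    using borel_measurable_continuous_on_restrict[OF continuous_on_sphere_compose[OF SL_inv[OF g] \<phi>]] .
  have [measurable]: "\<phi> \<in> borel_measurable (restrict_space borel (sphere 0 1))"
    using borel_measurable_continuous_on_restrict[OF \<phi>] .
  let ?F = "\<lambda>v. (f v)\<^sup>2 * \<phi> (sphere_action (matrix_inv g) (direction v))"
  have Fm: "?F \<in> borel_measurable borel" by measurable
  have "(\<integral>u. \<phi> (sphere_action (matrix_inv g) u) \<partial>direction_law f)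
      = (\<integral>v. \<phi> (sphere_action (matrix_inv g) (direction v)) \<partial>density lborel (\<lambda>v. ennreal ((f v)\<^sup>2)))"
    unfolding direction_law_def by (rule integral_distr) auto
  also have "\<dots> = (\<integral>v. ?F v \<partial>lborel)"
    by (subst integral_density) auto
  also have "\<dots> = (\<integral>v. ?F (g *v v) \<partial>lborel)"
    by (rule integral_SL[OF g Fm, symmetric])
  also have "\<dots> = (\<integral>v. \<phi> (direction v) * (f (g *v v))\<^sup>2 \<partial>lborel)"
  proof (rule integral_cong_AE)
    have "AE v in lborel. v \<noteq> (0 :: real^'n)" by (rule AE_lborel_singleton)
    then show "AE v in lborel. ?F (g *v v) = \<phi> (direction v) * (f (g *v v))\<^sup>2"
    proof eventually_elim
      case (elim v)
      then show ?case using g by (simp flip: sphere_action_direction)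
    qed
    have [measurable]: "(*v) g \<in> borel_measurable lborel" using measurable_matrix_vector_mult[of g] by simp
    show "(\<lambda>v. ?F (g *v v)) \<in> borel_measurable lborel"
      using measurable_compose[OF measurable_matrix_vector_mult Fm, of g] by simp
    show "(\<lambda>v. \<phi> (direction v) * (f (g *v v))\<^sup>2) \<in> borel_measurable lborel" by measurable
  qed
  finally show ?thesis .
qed

text \<open>For unit vectors \<open>p\<close>, \<open>q\<close> of \<open>L^2\<close> the densities \<open>p^2\<close> and \<open>q^2\<close> are close in \<open>L^1\<close> when \<open>p\<close> and \<open>q\<close> are
  close in \<open>L^2\<close>, because \<open>p^2 - q^2 = (p + q) (p - q)\<close>.  Read contrapositively, a difference
  of size \<open>e\<close> between the two laws forces a distance in \<open>L^2\<close>.\<close>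

lemma direction_law_gap:
  fixes f :: "real^'n \<Rightarrow> real"
  assumes g: "g \<in> SL" and h: "h \<in> SL" and [measurable]: "f \<in> borel_measurable borel"
    and f1: "(\<integral>\<^sup>+v. ennreal ((f v)\<^sup>2) \<partial>lborel) = 1"
    and \<phi>: "continuous_on (sphere 0 1) \<phi>" and B: "\<And>u. norm u = 1 \<Longrightarrow> \<bar>\<phi> u\<bar> \<le> B" "B > 0"
    and diff: "\<bar>(\<integral>u. \<phi> (sphere_action (matrix_inv g) u) \<partial>direction_law f)
      - (\<integral>u. \<phi> (sphere_action (matrix_inv h) u) \<partial>direction_law f)\<bar> \<ge> e" and "e > 0"
  shows "ennreal (e\<^sup>2 / (4 * B\<^sup>2)) \<le> (\<integral>\<^sup>+v. ennreal ((f (g *v v) - f (h *v v))\<^sup>2) \<partial>lborel)"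
proof -
  note direction_measurable[measurable] measurable_matrix_vector_mult[measurable]
  have [measurable]: "\<phi> \<in> borel_measurable (restrict_space borel (sphere 0 1))"
    using borel_measurable_continuous_on_restrict[OF \<phi>] .
  have int_f: "integrable lborel (\<lambda>v. (f v)\<^sup>2)" "(\<integral>v. (f v)\<^sup>2 \<partial>lborel) = 1"
    using f1 by (auto intro!: integrableI_nonneg simp: integral_eq_nn_integral)
  have sq_m: "(\<lambda>v. (f v)\<^sup>2) \<in> borel_measurable borel" by measurable
  have int_k: "integrable lborel (\<lambda>v. (f (k *v v))\<^sup>2)" "(\<integral>v. (f (k *v v))\<^sup>2 \<partial>lborel) = 1" if "k \<in> SL" for k
    using integral_SL[OF that sq_m] integrable_SL[OF that sq_m] int_f by auto
  let ?p = "\<lambda>v. f (g *v v)" and ?q = "\<lambda>v. f (h *v v)"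
  have pq: "integrable lborel (\<lambda>v. (?p v)\<^sup>2 + (?q v)\<^sup>2)" using int_k g h by auto
  have [measurable]: "?p \<in> borel_measurable lborel" "?q \<in> borel_measurable lborel" by measurable
  have ipm: "integrable lborel (\<lambda>v. (?p v + ?q v)\<^sup>2)" "integrable lborel (\<lambda>v. (?p v - ?q v)\<^sup>2)"
  proof -
    have "(x + y)\<^sup>2 \<le> 2 * (x\<^sup>2 + y\<^sup>2)" "(x - y)\<^sup>2 \<le> 2 * (x\<^sup>2 + y\<^sup>2)" for x y :: real
      using zero_le_power2[of "x - y"] zero_le_power2[of "x + y"] by (auto simp: power2_eq_square algebra_simps)
    then show "integrable lborel (\<lambda>v. (?p v + ?q v)\<^sup>2)" "integrable lborel (\<lambda>v. (?p v - ?q v)\<^sup>2)"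
      by (auto intro!: Bochner_Integration.integrable_bound[OF integrable_mult_right[OF pq, of 2]])
  qed
  define D where "D = (\<integral>v. (?p v - ?q v)\<^sup>2 \<partial>lborel)"
  have i\<phi>: "integrable lborel (\<lambda>v. \<phi> (direction v) * (f (k *v v))\<^sup>2)" if k: "k \<in> SL" for k
  proof (rule Bochner_Integration.integrable_bound[OF integrable_mult_right[OF int_k(1)[OF k], of B]])
    show "AE v in lborel. norm (\<phi> (direction v) * (f (k *v v))\<^sup>2) \<le> norm (B * (f (k *v v))\<^sup>2)"
      using B by (auto simp: abs_mult intro!: AE_I2 mult_right_mono)
  qed measurable
  \<comment> \<open>This weight in the inequality \<open>\<bar>x y\<bar> \<le> t x^2 / 2 + y^2 / (2 t)\<close> makes the first summand contribute at most \<open>e / 2\<close>.\<close>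
  define t where "t = e / (4 * B)"
  have "t > 0" using \<open>e > 0\<close> \<open>B > 0\<close> by (simp add: t_def)
  have "e \<le> \<bar>(\<integral>v. \<phi> (direction v) * (?p v)\<^sup>2 \<partial>lborel) - (\<integral>v. \<phi> (direction v) * (?q v)\<^sup>2 \<partial>lborel)\<bar>"
    using diff by (simp add: integral_direction_law[OF _ _ \<phi>] g h)
  also have "\<dots> = \<bar>\<integral>v. \<phi> (direction v) * (?p v)\<^sup>2 - \<phi> (direction v) * (?q v)\<^sup>2 \<partial>lborel\<bar>"
    using i\<phi> g h by simp
  also have "\<dots> \<le> (\<integral>v. B * (t / 2 * (?p v + ?q v)\<^sup>2 + (?p v - ?q v)\<^sup>2 / (2 * t)) \<partial>lborel)"
  proof (rule integral_abs_bound_integral)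
    show "integrable lborel (\<lambda>v. \<phi> (direction v) * (?p v)\<^sup>2 - \<phi> (direction v) * (?q v)\<^sup>2)" using i\<phi> g h by simp
    show "integrable lborel (\<lambda>v. B * (t / 2 * (?p v + ?q v)\<^sup>2 + (?p v - ?q v)\<^sup>2 / (2 * t)))" using ipm by simp
    fix v :: "real^'n"
    have "\<bar>\<phi> (direction v) * (?p v)\<^sup>2 - \<phi> (direction v) * (?q v)\<^sup>2\<bar> = \<bar>\<phi> (direction v)\<bar> * \<bar>(?p v + ?q v) * (?p v - ?q v)\<bar>"
      by (simp add: abs_mult[symmetric] power2_eq_square algebra_simps)
    also have "\<dots> \<le> B * (t / 2 * (?p v + ?q v)\<^sup>2 + (?p v - ?q v)\<^sup>2 / (2 * t))"
    proof (rule mult_mono)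
      have "\<bar>x * y\<bar> \<le> t / 2 * x\<^sup>2 + y\<^sup>2 / (2 * t)" for x y :: real
      proof -
        have "0 \<le> (t * \<bar>x\<bar> - \<bar>y\<bar>)\<^sup>2 / (2 * t)" using \<open>t > 0\<close> by simp
        also have "\<dots> = t / 2 * x\<^sup>2 + y\<^sup>2 / (2 * t) - \<bar>x * y\<bar>"
          using \<open>t > 0\<close> by (simp add: power2_eq_square field_simps abs_mult)
        finally show ?thesis by simp
      qed
      then show "\<bar>(?p v + ?q v) * (?p v - ?q v)\<bar> \<le> t / 2 * (?p v + ?q v)\<^sup>2 + (?p v - ?q v)\<^sup>2 / (2 * t)" .
    qed (use B in auto)
    finally show "\<bar>\<phi> (direction v) * (?p v)\<^sup>2 - \<phi> (direction v) * (?q v)\<^sup>2\<bar> \<le>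
        B * (t / 2 * (?p v + ?q v)\<^sup>2 + (?p v - ?q v)\<^sup>2 / (2 * t))" .
  qed
  also have "\<dots> = B * (t / 2 * (\<integral>v. (?p v + ?q v)\<^sup>2 \<partial>lborel) + D / (2 * t))"
    using ipm by (simp add: D_def)
  also have "\<dots> \<le> B * (t / 2 * 4 + D / (2 * t))"
  proof -
    have "(\<integral>v. (?p v + ?q v)\<^sup>2 \<partial>lborel) \<le> (\<integral>v. 2 * ((?p v)\<^sup>2 + (?q v)\<^sup>2) \<partial>lborel)"
    proof (rule integral_mono)
      show "(?p v + ?q v)\<^sup>2 \<le> 2 * ((?p v)\<^sup>2 + (?q v)\<^sup>2)" for v
        using zero_le_power2[of "?p v - ?q v"] by (simp add: power2_eq_square algebra_simps)
    qed (use ipm(1) integrable_mult_right[OF pq, of 2] in auto)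
    also have "\<dots> = 4" using int_k g h by simp
    finally show ?thesis using B \<open>t > 0\<close> by (intro mult_left_mono add_right_mono) auto
  qed
  also have "\<dots> = e / 2 + D * 2 * B\<^sup>2 / e"
    using B \<open>e > 0\<close> by (simp add: t_def field_simps power2_eq_square)
  finally have "e / 2 \<le> D * 2 * B\<^sup>2 / e" by simp
  then have "e\<^sup>2 / (4 * B\<^sup>2) \<le> D" using B \<open>e > 0\<close> by (simp add: field_simps power2_eq_square)
  then have "ennreal (e\<^sup>2 / (4 * B\<^sup>2)) \<le> ennreal D" by (rule ennreal_leI)
  also have "\<dots> = (\<integral>\<^sup>+v. ennreal ((?p v - ?q v)\<^sup>2) \<partial>lborel)"
    unfolding D_def using ipm by (intro nn_integral_eq_integral[symmetric]) auto
  finally show ?thesis .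
qed

section \<open>The spectral gap\<close>

lemma compactin_cluster_point:
  assumes "compactin T M" and x: "\<And>n :: nat. x n \<in> M"
  obtains l where "l \<in> M" "\<And>U N. openin T U \<Longrightarrow> l \<in> U \<Longrightarrow> \<exists>n\<ge>N. x n \<in> U"
proof (rule ccontr)
  assume "\<not> thesis"
  then have "\<forall>l\<in>M. \<exists>U N. openin T U \<and> l \<in> U \<and> (\<forall>n\<ge>N. x n \<notin> U)" using that by metis
  then obtain U N where UN: "\<And>l. l \<in> M \<Longrightarrow> openin T (U l) \<and> l \<in> U l \<and> (\<forall>n\<ge>N l. x n \<notin> U l)" by metis
  have "\<exists>F. finite F \<and> F \<subseteq> U ` M \<and> M \<subseteq> \<Union>F"
    using assms(1) UN by (intro compactinD[OF assms(1)]) auto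
  then obtain L where L: "finite L" "L \<subseteq> M" "M \<subseteq> \<Union>(U ` L)" by (metis finite_subset_image)
  define n where "n = Max (insert 0 (N ` L))"
  obtain l where l: "l \<in> L" "x n \<in> U l" using x[of n] L by auto
  have "N l \<le> n" unfolding n_def using L l by (intro Max_ge) auto
  then show False using UN l L by auto
qed

lemma weak_topology_memD:
  assumes "M \<subseteq> topspace (weak_topology S)" "\<nu> \<in> M"
  shows "\<nu> \<in> prob_measures_on S"
  using assms unfolding weak_topology_def topology_generated_by_topspace by auto

lemma openin_weak_integral_greater:
  fixes f :: "'a :: topological_space \<Rightarrow> real"
  assumes "continuous_on S f" "bounded (f ` S)"
  shows "openin (weak_topology S) {\<nu> \<in> prob_measures_on S. (\<integral>x. f x \<partial>\<nu>) > c}"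
  unfolding weak_topology_def
proof (rule topology_generated_by_Basis)
  have "{\<nu> \<in> prob_measures_on S. (\<integral>x. f x \<partial>\<nu>) > c} = {\<nu> \<in> prob_measures_on S. (\<integral>x. f x \<partial>\<nu>) \<in> {c<..}}" by simp
  then show "{\<nu> \<in> prob_measures_on S. (\<integral>x. f x \<partial>\<nu>) > c} \<in> {{\<nu> \<in> prob_measures_on S. (\<integral>x. f x \<partial>\<nu>) \<in> U} |(f :: 'a \<Rightarrow> real) U.
      continuous_on S f \<and> bounded (f ` S) \<and> open U}" using assms open_greaterThan by blast
qed

text \<open>A continuous substitute for the indicator of a ball: its integral depends continuously on the
  measure in the weak topology.\<close>

definition tent :: "'a :: metric_space \<Rightarrow> real \<Rightarrow> 'a \<Rightarrow> real" where
  "tent g0 r g = max 0 (1 - dist g g0 / r)"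

lemma tent_bounds [simp]: "0 \<le> tent g0 r g" "r > 0 \<Longrightarrow> tent g0 r g \<le> 1"
  by (auto simp: tent_def)

lemma tent_outside: "r > 0 \<Longrightarrow> dist g g0 \<ge> r \<Longrightarrow> tent g0 r g = 0"
  by (simp add: tent_def)

lemma continuous_on_tent: "continuous_on S (tent g0 r)"
  unfolding tent_def by (cases "r = 0") (auto intro!: continuous_intros)

lemma integrable_tent:
  assumes "\<nu> \<in> prob_measures_on S" "r > 0"
  shows "tent g0 r \<in> borel_measurable \<nu>" "integrable \<nu> (tent g0 r)"
proof -
  interpret prob_space \<nu> using assms by (simp add: prob_measures_on_iff)
  show *: "tent g0 r \<in> borel_measurable \<nu>"
    using borel_measurable_continuous_on_restrict[OF continuous_on_tent[of S g0 r]] assms(1)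
    by (simp add: prob_measures_on_iff cong: measurable_cong_sets)
  show "integrable \<nu> (tent g0 r)"
  proof (rule integrable_const_bound)
    show "AE x in \<nu>. norm (tent g0 r x) \<le> 1" using assms(2) by (intro AE_I2) (simp add: abs_of_nonneg)
  qed (rule *)
qed

lemma tent_support_pos:
  fixes \<nu> :: "'a :: metric_space measure"
  assumes \<nu>: "\<nu> \<in> prob_measures_on S" and g0: "g0 \<in> measure_support \<nu>" and "r > 0"
  shows "(\<integral>g. tent g0 r g \<partial>\<nu>) > 0"
proof -
  interpret prob_space \<nu> using \<nu> by (simp add: prob_measures_on_iff)
  let ?A = "ball g0 (r / 2) \<inter> space \<nu>"
  have A: "?A \<in> sets \<nu>"
  proof -
    have "sets \<nu> = (\<inter>) S ` sets borel" using \<nu> by (simp add: prob_measures_on_iff sets_restrict_space)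
    then show ?thesis by (simp add: prob_measures_on_space[OF \<nu>] Int_commute)
  qed
  have "emeasure \<nu> ?A > 0" using g0 \<open>r > 0\<close> unfolding measure_support_def by simp
  then have "0 < measure \<nu> ?A / 2" by (simp add: emeasure_eq_measure)
  also have "\<dots> = (\<integral>g. indicator ?A g / 2 \<partial>\<nu>)" using A by simp
  also have "\<dots> \<le> (\<integral>g. tent g0 r g \<partial>\<nu>)"
  proof (rule integral_mono)
    show "indicator ?A g / 2 \<le> tent g0 r g" for g
      using \<open>r > 0\<close> by (auto simp: tent_def indicator_def dist_commute field_simps)
    show "integrable \<nu> (\<lambda>g. indicator ?A g / 2 :: real)"
      using A by (intro integrable_divide_zero integrable_real_indicator) (auto simp: emeasure_eq_measure)
  qed (rule integrable_tent[OF \<nu> \<open>r > 0\<close>])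
  finally show ?thesis .
qed

text \<open>Uniformity in \<open>u\<close> makes the estimate survive integration against any measure on the sphere, in
  particular against a whole sequence of measures at once.\<close>

lemma sphere_action_inv_uniform_near:
  fixes \<phi> :: "real^'n \<Rightarrow> real"
  assumes \<phi>: "continuous_on (sphere 0 1) \<phi>" and g0: "g0 \<in> SL" and "e > 0"
  obtains r where "r > 0" "\<And>g u. g \<in> SL \<Longrightarrow> dist g g0 < r \<Longrightarrow> norm u = 1 \<Longrightarrow>
    \<bar>\<phi> (sphere_action (matrix_inv g) u) - \<phi> (sphere_action (matrix_inv g0) u)\<bar> < e"
proof -
  let ?K = "(SL \<inter> cball g0 1) \<times> (sphere 0 1 :: (real^'n) set)"
  let ?F = "\<lambda>(g, u). \<phi> (sphere_action (matrix_inv g) u)"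
  have "continuous_on ?K (\<lambda>x. \<phi> (sphere_action (matrix_inv (fst x)) (snd x)))"
    by (intro continuous_on_compose2[OF \<phi>] continuous_on_sphere_action_compose
        continuous_on_compose2[OF continuous_on_matrix_inv] continuous_intros) auto
  moreover have "compact ?K"
    by (intro compact_Times closed_Int_compact closed_SL) auto
  ultimately have "uniformly_continuous_on ?K (\<lambda>x. \<phi> (sphere_action (matrix_inv (fst x)) (snd x)))"
    by (intro compact_uniformly_continuous)
  then obtain d where d: "d > 0" "\<And>x x'. x \<in> ?K \<Longrightarrow> x' \<in> ?K \<Longrightarrow> dist x' x < d \<Longrightarrow>
      dist (\<phi> (sphere_action (matrix_inv (fst x')) (snd x'))) (\<phi> (sphere_action (matrix_inv (fst x)) (snd x))) < e"
    using \<open>e > 0\<close> unfolding uniformly_continuous_on_def by blast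
  show thesis
  proof (rule that[of "min 1 d"])
    show "min 1 d > 0" using d(1) by simp
    fix g u assume "g \<in> SL" "dist g g0 < min 1 d" "norm (u :: real^'n) = 1"
    then show "\<bar>\<phi> (sphere_action (matrix_inv g) u) - \<phi> (sphere_action (matrix_inv g0) u)\<bar> < e"
      using d(2)[of "(g0, u)" "(g, u)"] g0 by (simp add: dist_Pair_Pair dist_commute dist_real_def)
  qed
qed

text \<open>The set \<open>M\<close> is only known to be compact, so instead of a convergent subsequence of the measures
  \<open>N n\<close> a cluster point is used.  It is chosen after the laws of directions have been made to converge:
  the events compared below hold for all large \<open>n\<close> on one side and for arbitrarily large \<open>n\<close> on the
  other.\<close>

lemma spectral_gap_normalised:
  fixes M :: "(real^'n^'n) measure set"
  assumes M: "compactin (weak_topology SL) M"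
    and no_inv: "\<forall>\<nu>\<in>M. \<not> (\<exists>\<kappa>\<in>prob_measures_on (sphere 0 1 :: (real^'n) set). \<forall>g\<in>G_group \<nu>. preserves g \<kappa>)"
  shows "\<exists>d>0. \<forall>\<nu>\<in>M. \<forall>f\<in>borel_measurable borel. (\<integral>\<^sup>+v. ennreal ((f v)\<^sup>2) \<partial>lborel) = 1 \<longrightarrow>
    ennreal d \<le> (\<integral>\<^sup>+g. \<integral>\<^sup>+h. \<integral>\<^sup>+v. ennreal ((f (g *v v) - f (h *v v))\<^sup>2) \<partial>(lborel :: (real^'n) measure) \<partial>\<nu> \<partial>\<nu>)"
proof (rule ccontr)
  define I where "I \<nu> f = (\<integral>\<^sup>+g. \<integral>\<^sup>+h. \<integral>\<^sup>+v. ennreal ((f (g *v v) - f (h *v v))\<^sup>2) \<partial>(lborel :: (real^'n) measure) \<partial>\<nu> \<partial>\<nu>)"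
    for \<nu> and f :: "real^'n \<Rightarrow> real"
  assume "\<not> ?thesis"
  then have "\<exists>\<nu>\<in>M. \<exists>f\<in>borel_measurable borel. (\<integral>\<^sup>+v. ennreal ((f v)\<^sup>2) \<partial>lborel) = 1 \<and> I \<nu> f < ennreal (1 / Suc n)" for n
    unfolding I_def[symmetric] by (metis not_le zero_less_divide_1_iff of_nat_0_less_iff zero_less_Suc)
  then obtain N f where Nf: "\<And>n. N n \<in> M" "\<And>n. f n \<in> borel_measurable borel"
      "\<And>n. (\<integral>\<^sup>+v. ennreal ((f n v)\<^sup>2) \<partial>lborel) = 1" "\<And>n. I (N n) (f n) < ennreal (1 / Suc n)" by metis
  have law: "direction_law (f n) \<in> prob_measures_on (sphere 0 1)" for n
    using Nf by (intro direction_law_prob) auto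
  obtain r \<kappa> where r: "strict_mono r" and \<kappa>: "\<kappa> \<in> prob_measures_on (sphere 0 1)"
    and conv: "\<And>\<phi> :: real^'n \<Rightarrow> real. continuous_on (sphere 0 1) \<phi> \<Longrightarrow>
      (\<lambda>n. \<integral>x. \<phi> x \<partial>direction_law (f (r n))) \<longlonglongrightarrow> (\<integral>x. \<phi> x \<partial>\<kappa>)"
    using compact_prob_measures_convergent_subseq[of "sphere 0 1 :: (real^'n) set" "\<lambda>n. direction_law (f n)"] law
    by (auto simp: comp_def)
  obtain \<nu> where \<nu>: "\<nu> \<in> M" and clus: "\<And>U k. openin (weak_topology SL) U \<Longrightarrow> \<nu> \<in> U \<Longrightarrow> \<exists>n\<ge>k. N (r n) \<in> U"
    using compactin_cluster_point[OF M, of "\<lambda>n. N (r n)"] Nf(1) by metis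
  have prob: "\<nu>' \<in> prob_measures_on SL" if "\<nu>' \<in> M" for \<nu>'
    using weak_topology_memD[OF compactin_subset_topspace[OF M] that] .
  have sp: "space \<nu>' = SL" if "\<nu>' \<in> M" for \<nu>' using prob_measures_on_space[OF prob[OF that]] .
  obtain A where "A \<in> G_group \<nu>" "\<not> preserves A \<kappa>" using bspec[OF no_inv \<nu>] \<kappa> by blast
  then obtain g0 h0 \<phi> where gh0: "g0 \<in> measure_support \<nu>" "h0 \<in> measure_support \<nu>"
    and \<phi>: "continuous_on (sphere 0 1) \<phi>"
    and ne: "(\<integral>u. \<phi> (sphere_action (matrix_inv g0) u) \<partial>\<kappa>) \<noteq> (\<integral>u. \<phi> (sphere_action (matrix_inv h0) u) \<partial>\<kappa> :: real)"
    using G_group_preserves[OF \<kappa> sp[OF \<nu>]] by metis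
  have gSL: "g0 \<in> SL" "h0 \<in> SL" using gh0 sp[OF \<nu>] by (auto simp: measure_support_def)
  define F where "F \<kappa>' g = (\<integral>u. \<phi> (sphere_action (matrix_inv g) u) \<partial>\<kappa>')" for \<kappa>' :: "(real^'n) measure" and g
  define e where "e = \<bar>F \<kappa> g0 - F \<kappa> h0\<bar> / 4"
  have "e > 0" using ne by (simp add: e_def F_def)
  obtain b where b: "\<And>u. u \<in> sphere 0 1 \<Longrightarrow> norm (\<phi> u) \<le> b"
    using compact_imp_bounded[OF compact_continuous_image[OF \<phi> compact_sphere]] unfolding bounded_iff by blast
  define B where "B = max b 1"
  have B: "B > 0" "\<bar>\<phi> u\<bar> \<le> B" if "norm u = 1" for u using b[of u] that by (auto simp: B_def)
  have "B > 0" by (simp add: B_def)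
  have near: "\<exists>\<rho>>0. \<forall>g\<in>SL. dist g k < \<rho> \<longrightarrow> (\<forall>\<kappa>'\<in>prob_measures_on (sphere 0 1). \<bar>F \<kappa>' g - F \<kappa>' k\<bar> \<le> e / 2)"
    if k: "k \<in> SL" for k
  proof -
    obtain \<rho> where \<rho>: "\<rho> > 0" "\<And>g u. g \<in> SL \<Longrightarrow> dist g k < \<rho> \<Longrightarrow> norm u = 1 \<Longrightarrow>
        \<bar>\<phi> (sphere_action (matrix_inv g) u) - \<phi> (sphere_action (matrix_inv k) u)\<bar> < e / 2"
      using sphere_action_inv_uniform_near[OF \<phi> k, of "e / 2"] \<open>e > 0\<close> by auto
    have "\<bar>F \<kappa>' g - F \<kappa>' k\<bar> \<le> e / 2"
      if g: "g \<in> SL" "dist g k < \<rho>" and \<kappa>': "\<kappa>' \<in> prob_measures_on (sphere 0 1)" for g \<kappa>'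
    proof -
      interpret \<kappa>': prob_space \<kappa>' using \<kappa>' by (simp add: prob_measures_on_iff)
      have i: "integrable \<kappa>' (\<lambda>u. \<phi> (sphere_action (matrix_inv g') u))" if "g' \<in> SL" for g'
        using continuous_imp_integrable(2)[OF _ continuous_on_sphere_compose[OF SL_inv[OF that] \<phi>] \<kappa>'] by simp
      have "\<bar>F \<kappa>' g - F \<kappa>' k\<bar> = \<bar>\<integral>u. \<phi> (sphere_action (matrix_inv g) u) - \<phi> (sphere_action (matrix_inv k) u) \<partial>\<kappa>'\<bar>"
        unfolding F_def using i g k by simp
      also have "\<dots> \<le> (\<integral>u. \<bar>\<phi> (sphere_action (matrix_inv g) u) - \<phi> (sphere_action (matrix_inv k) u)\<bar> \<partial>\<kappa>')"
        by (rule integral_abs_bound)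
      also have "\<dots> \<le> (\<integral>u. e / 2 \<partial>\<kappa>')"
        using \<rho>(2)[OF g] i g k prob_measures_on_space[OF \<kappa>']
        by (intro integral_mono) (auto intro: less_imp_le)
      finally show ?thesis by (simp add: \<kappa>'.prob_space)
    qed
    then show ?thesis using \<rho>(1) by blast
  qed
  obtain \<rho>1 where \<rho>1: "\<rho>1 > 0" "\<And>g \<kappa>'. g \<in> SL \<Longrightarrow> dist g g0 < \<rho>1 \<Longrightarrow> \<kappa>' \<in> prob_measures_on (sphere 0 1) \<Longrightarrow> \<bar>F \<kappa>' g - F \<kappa>' g0\<bar> \<le> e / 2"
    using near[OF gSL(1)] by blast
  obtain \<rho>2 where \<rho>2: "\<rho>2 > 0" "\<And>g \<kappa>'. g \<in> SL \<Longrightarrow> dist g h0 < \<rho>2 \<Longrightarrow> \<kappa>' \<in> prob_measures_on (sphere 0 1) \<Longrightarrow> \<bar>F \<kappa>' g - F \<kappa>' h0\<bar> \<le> e / 2"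
    using near[OF gSL(2)] by blast
  have convF: "(\<lambda>n. F (direction_law (f (r n))) g) \<longlonglongrightarrow> F \<kappa> g" if "g \<in> SL" for g
    unfolding F_def using conv[OF continuous_on_sphere_compose[OF SL_inv[OF that] \<phi>]] .
  have "\<forall>\<^sub>F n in sequentially. \<bar>F (direction_law (f (r n))) g0 - F \<kappa> g0\<bar> < e / 2"
    "\<forall>\<^sub>F n in sequentially. \<bar>F (direction_law (f (r n))) h0 - F \<kappa> h0\<bar> < e / 2"
    using convF[OF gSL(1), THEN tendstoD, of "e / 2"] convF[OF gSL(2), THEN tendstoD, of "e / 2"] \<open>e > 0\<close>
    by (simp_all add: dist_real_def)
  from eventually_conj[OF this] obtain n1 where n1: "\<And>n. n \<ge> n1 \<Longrightarrow>
      \<bar>F (direction_law (f (r n))) g0 - F \<kappa> g0\<bar> < e / 2 \<and> \<bar>F (direction_law (f (r n))) h0 - F \<kappa> h0\<bar> < e / 2"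
    unfolding eventually_sequentially by blast
  define \<eta> where "\<eta> = e\<^sup>2 / (4 * B\<^sup>2)"
  have "\<eta> > 0" using \<open>e > 0\<close> \<open>B > 0\<close> by (simp add: \<eta>_def)
  have sep: "ennreal (\<eta> * (tent g0 \<rho>1 g * tent h0 \<rho>2 h)) \<le> (\<integral>\<^sup>+v. ennreal ((f (r n) (g *v v) - f (r n) (h *v v))\<^sup>2) \<partial>lborel)"
    if "n \<ge> n1" and gh: "g \<in> SL" "h \<in> SL" for n g h
  proof (cases "dist g g0 < \<rho>1 \<and> dist h h0 < \<rho>2")
    case True
    have "e \<le> \<bar>F (direction_law (f (r n))) g - F (direction_law (f (r n))) h\<bar>"
    proof -
      have 1: "\<bar>F (direction_law (f (r n))) g - F (direction_law (f (r n))) g0\<bar> \<le> e / 2"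
        using \<rho>1(2)[OF gh(1) _ law] True by blast
      have 2: "\<bar>F (direction_law (f (r n))) h - F (direction_law (f (r n))) h0\<bar> \<le> e / 2"
        using \<rho>2(2)[OF gh(2) _ law] True by blast
      have 3: "\<bar>F \<kappa> g0 - F \<kappa> h0\<bar> = 4 * e" by (simp add: e_def)
      show ?thesis using 1 2 3 n1[OF \<open>n \<ge> n1\<close>] by arith
    qed
    then have "ennreal \<eta> \<le> (\<integral>\<^sup>+v. ennreal ((f (r n) (g *v v) - f (r n) (h *v v))\<^sup>2) \<partial>lborel)"
      unfolding \<eta>_def F_def using gh Nf \<phi> B \<open>B > 0\<close> \<open>e > 0\<close> by (intro direction_law_gap[where \<phi>=\<phi>]) auto
    moreover have "tent g0 \<rho>1 g * tent h0 \<rho>2 h \<le> 1"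
      using tent_bounds \<rho>1(1) \<rho>2(1) by (intro mult_le_one) auto
    then have "ennreal (\<eta> * (tent g0 \<rho>1 g * tent h0 \<rho>2 h)) \<le> ennreal \<eta>"
      using \<open>\<eta> > 0\<close> by (intro ennreal_leI) (simp add: mult_left_le)
    ultimately show ?thesis by simp
  next
    case False
    then have zero: "tent g0 \<rho>1 g * tent h0 \<rho>2 h = 0"
      using tent_outside[OF \<rho>1(1), of g g0] tent_outside[OF \<rho>2(1), of h h0] by auto
    show ?thesis unfolding zero by simp
  qed
  define p where "p = (\<integral>g. tent g0 \<rho>1 g \<partial>\<nu>)"
  define q where "q = (\<integral>g. tent h0 \<rho>2 g \<partial>\<nu>)"
  have pq: "p > 0" "q > 0"
    unfolding p_def q_def using tent_support_pos[OF prob[OF \<nu>] gh0(1) \<rho>1(1)]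
      tent_support_pos[OF prob[OF \<nu>] gh0(2) \<rho>2(1)] by auto
  have bdd: "bounded (tent k \<rho> ` SL)" if "\<rho> > 0" for k \<rho>
    using that unfolding bounded_iff by (intro exI[of _ 1]) (simp add: abs_of_nonneg tent_bounds)
  let ?U = "{\<nu> \<in> prob_measures_on SL. (\<integral>g. tent g0 \<rho>1 g \<partial>\<nu>) > p / 2} \<inter> {\<nu> \<in> prob_measures_on SL. (\<integral>g. tent h0 \<rho>2 g \<partial>\<nu>) > q / 2}"
  have "openin (weak_topology SL) ?U"
    using bdd \<rho>1(1) \<rho>2(1) by (intro openin_Int openin_weak_integral_greater continuous_on_tent) auto
  moreover have "\<nu> \<in> ?U" using prob[OF \<nu>] pq by (simp add: p_def q_def)
  moreover obtain n2 where n2: "1 / Suc n2 < \<eta> * (p / 2 * (q / 2))"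
    using reals_Archimedean[of "\<eta> * (p / 2 * (q / 2))"] \<open>\<eta> > 0\<close> pq by (auto simp: inverse_eq_divide)
  ultimately obtain n where n: "n \<ge> max n1 n2" "N (r n) \<in> ?U" using clus by blast
  let ?\<nu> = "N (r n)"
  have \<nu>': "?\<nu> \<in> prob_measures_on SL" using n by auto
  have sp': "space ?\<nu> = SL" using sp Nf(1) by blast
  note meas = integrable_tent(1)[OF \<nu>' \<rho>1(1), of g0] integrable_tent(1)[OF \<nu>' \<rho>2(1), of h0]
  have int1: "(\<integral>\<^sup>+g. ennreal (tent g0 \<rho>1 g) \<partial>?\<nu>) = ennreal (\<integral>g. tent g0 \<rho>1 g \<partial>?\<nu>)"
    using integrable_tent[OF \<nu>' \<rho>1(1)] by (intro nn_integral_eq_integral) auto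
  have int2: "(\<integral>\<^sup>+g. ennreal (tent h0 \<rho>2 g) \<partial>?\<nu>) = ennreal (\<integral>g. tent h0 \<rho>2 g \<partial>?\<nu>)"
    using integrable_tent[OF \<nu>' \<rho>2(1)] by (intro nn_integral_eq_integral) auto
  have "ennreal (\<eta> * (p / 2 * (q / 2))) \<le> ennreal \<eta> * (ennreal (\<integral>g. tent g0 \<rho>1 g \<partial>?\<nu>) * ennreal (\<integral>g. tent h0 \<rho>2 g \<partial>?\<nu>))"
  proof -
    have "p / 2 * (q / 2) \<le> (\<integral>g. tent g0 \<rho>1 g \<partial>?\<nu>) * (\<integral>g. tent h0 \<rho>2 g \<partial>?\<nu>)"
      using n(2) pq by (intro mult_mono) auto
    then have "\<eta> * (p / 2 * (q / 2)) \<le> \<eta> * ((\<integral>g. tent g0 \<rho>1 g \<partial>?\<nu>) * (\<integral>g. tent h0 \<rho>2 g \<partial>?\<nu>))"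
      using \<open>\<eta> > 0\<close> by (intro mult_left_mono) auto
    then have "ennreal (\<eta> * (p / 2 * (q / 2))) \<le> ennreal (\<eta> * ((\<integral>g. tent g0 \<rho>1 g \<partial>?\<nu>) * (\<integral>g. tent h0 \<rho>2 g \<partial>?\<nu>)))"
      by (rule ennreal_leI)
    also have "\<dots> = ennreal \<eta> * (ennreal (\<integral>g. tent g0 \<rho>1 g \<partial>?\<nu>) * ennreal (\<integral>g. tent h0 \<rho>2 g \<partial>?\<nu>))"
      using \<open>\<eta> > 0\<close> by (subst ennreal_mult; simp add: ennreal_mult integral_nonneg_AE)
    finally show ?thesis .
  qed
  also have "\<dots> = (\<integral>\<^sup>+g. \<integral>\<^sup>+h. ennreal (\<eta> * (tent g0 \<rho>1 g * tent h0 \<rho>2 h)) \<partial>?\<nu> \<partial>?\<nu>)"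
  proof -
    have "(\<integral>\<^sup>+g. \<integral>\<^sup>+h. ennreal (\<eta> * (tent g0 \<rho>1 g * tent h0 \<rho>2 h)) \<partial>?\<nu> \<partial>?\<nu>)
        = (\<integral>\<^sup>+g. \<integral>\<^sup>+h. ennreal \<eta> * ennreal (tent g0 \<rho>1 g) * ennreal (tent h0 \<rho>2 h) \<partial>?\<nu> \<partial>?\<nu>)"
      using \<open>\<eta> > 0\<close> by (simp add: ennreal_mult mult.assoc)
    also have "\<dots> = (\<integral>\<^sup>+g. ennreal \<eta> * (ennreal (tent g0 \<rho>1 g) * ennreal (\<integral>g. tent h0 \<rho>2 g \<partial>?\<nu>)) \<partial>?\<nu>)"
      using meas by (simp add: nn_integral_cmult int2 mult.assoc)
    also have "\<dots> = ennreal \<eta> * (ennreal (\<integral>g. tent g0 \<rho>1 g \<partial>?\<nu>) * ennreal (\<integral>g. tent h0 \<rho>2 g \<partial>?\<nu>))"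
      using meas by (simp add: nn_integral_cmult nn_integral_multc int1)
    finally show ?thesis by simp
  qed
  also have "\<dots> \<le> I ?\<nu> (f (r n))"
    unfolding I_def using n(1) sp' by (intro nn_integral_mono sep) auto
  also have "\<dots> < ennreal (1 / Suc (r n))" by (rule Nf(4))
  also have "\<dots> \<le> ennreal (1 / Suc n2)"
    using n(1) seq_suble[OF r, of n] by (intro ennreal_leI divide_left_mono) auto
  also have "\<dots> < ennreal (\<eta> * (p / 2 * (q / 2)))" using n2 \<open>\<eta> > 0\<close> pq by (intro ennreal_lessI) auto
  finally show False .
qed

lemma borel_measurable_mat_vec [measurable (raw)]:
  fixes g :: "'a \<Rightarrow> real^'n^'m"
  assumes "g \<in> borel_measurable N" "v \<in> borel_measurable N"
  shows "(\<lambda>x. g x *v v x) \<in> borel_measurable N"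
  using assms by (rule borel_measurable_continuous_Pair)
    (unfold matrix_vector_mult_def, intro continuous_intros)

text \<open>The squared norm of an average is the mean squared norm minus half the mean squared distance of two
  independent copies: \<open>\<parallel>E f\<parallel>^2 = \<parallel>f\<parallel>^2 - E \<parallel>f g - f h\<parallel>^2 / 2\<close>, by unitarity.\<close>

lemma spectral_gap:
  fixes M :: "(real^'n^'n) measure set"
  assumes M: "compactin (weak_topology SL) M"
    and no_inv: "\<forall>\<nu>\<in>M. \<not> (\<exists>\<kappa>\<in>prob_measures_on (sphere 0 1 :: (real^'n) set). \<forall>g\<in>G_group \<nu>. preserves g \<kappa>)"
  shows "\<exists>d>0. d \<le> 1 / 2 \<and> (\<forall>\<nu>\<in>M. \<forall>f\<in>borel_measurable borel. (\<forall>v. 0 \<le> f v \<and> f v \<le> 1) \<longrightarrow>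
      (\<integral>\<^sup>+v. ennreal ((f v)\<^sup>2) \<partial>lborel) < \<infinity> \<longrightarrow>
      (\<integral>\<^sup>+v. ennreal ((\<integral>g. f (g *v v) \<partial>\<nu>)\<^sup>2) \<partial>lborel) \<le> ennreal (1 - d) * (\<integral>\<^sup>+v. ennreal ((f v)\<^sup>2) \<partial>lborel))"
proof -
  have "\<exists>d>0. \<forall>\<nu>\<in>M. \<forall>f\<in>borel_measurable borel. (\<integral>\<^sup>+v. ennreal ((f v)\<^sup>2) \<partial>lborel) = 1 \<longrightarrow>
    ennreal d \<le> (\<integral>\<^sup>+g. \<integral>\<^sup>+h. \<integral>\<^sup>+v. ennreal ((f (g *v v) - f (h *v v))\<^sup>2) \<partial>(lborel :: (real^'n) measure) \<partial>\<nu> \<partial>\<nu>)"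
    by (rule spectral_gap_normalised[OF M no_inv])
  then obtain d where "d > 0" and d': "\<forall>\<nu>\<in>M. \<forall>f\<in>borel_measurable borel. (\<integral>\<^sup>+v. ennreal ((f v)\<^sup>2) \<partial>lborel) = 1 \<longrightarrow>
    ennreal d \<le> (\<integral>\<^sup>+g. \<integral>\<^sup>+h. \<integral>\<^sup>+v. ennreal ((f (g *v v) - f (h *v v))\<^sup>2) \<partial>(lborel :: (real^'n) measure) \<partial>\<nu> \<partial>\<nu>)"
    by (elim exE conjE) (rule that)
  note d = d'[rule_format]
  show ?thesis
  proof (intro exI[of _ "min (d / 2) (1 / 2)"] conjI ballI impI)
    fix \<nu> and f :: "real^'n \<Rightarrow> real"
    assume \<nu>: "\<nu> \<in> M" and f[measurable]: "f \<in> borel_measurable borel" and bd': "\<forall>v. 0 \<le> f v \<and> f v \<le> 1"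
      and fin: "(\<integral>\<^sup>+v. ennreal ((f v)\<^sup>2) \<partial>lborel) < \<infinity>"
    note bd = bd'[rule_format]
    have prob: "\<nu> \<in> prob_measures_on SL"
      using weak_topology_memD[OF compactin_subset_topspace[OF M] \<nu>] .
    interpret \<nu>: prob_space \<nu> using prob by (simp add: prob_measures_on_iff)
    interpret P: pair_sigma_finite \<nu> "lborel :: (real^'n) measure" ..
    have sp: "space \<nu> = SL" using prob_measures_on_space[OF prob] .
    have [measurable]: "(\<lambda>g. g) \<in> borel_measurable \<nu>"
      using measurable_restrict_space1[of "\<lambda>g. g" borel borel SL] prob
      by (simp add: prob_measures_on_iff cong: measurable_cong_sets)
    have int: "integrable \<nu> (\<lambda>g. f (g *v v))" "integrable \<nu> (\<lambda>g. (f (g *v v))\<^sup>2)" for v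
      using bd by (auto intro!: \<nu>.integrable_const_bound[of _ 1] AE_I2 simp: abs_le_iff power_le_one)
    define p where "p v = (\<integral>g. f (g *v v) \<partial>\<nu>)" for v
    define q where "q v = (\<integral>g. (f (g *v v))\<^sup>2 \<partial>\<nu>)" for v
    have [measurable]: "p \<in> borel_measurable borel" "q \<in> borel_measurable borel"
      unfolding p_def q_def by measurable
    obtain s where s: "(\<integral>\<^sup>+v. ennreal ((f v)\<^sup>2) \<partial>lborel) = ennreal s" "s \<ge> 0"
      using fin by (metis enn2real_nonneg ennreal_enn2real infinity_ennreal_def)
    have q_nn: "ennreal (q v) = (\<integral>\<^sup>+g. ennreal ((f (g *v v))\<^sup>2) \<partial>\<nu>)" for v
      unfolding q_def using int by (intro nn_integral_eq_integral[symmetric]) auto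
    have int_q: "(\<integral>\<^sup>+v. ennreal (q v) \<partial>lborel) = ennreal s"
    proof -
      have "(\<integral>\<^sup>+v. ennreal (q v) \<partial>lborel) = (\<integral>\<^sup>+g. \<integral>\<^sup>+v. ennreal ((f (g *v v))\<^sup>2) \<partial>lborel \<partial>\<nu>)"
        unfolding q_nn by (rule P.Fubini') measurable
      also have "\<dots> = (\<integral>\<^sup>+g. ennreal s \<partial>\<nu>)"
        unfolding s(1)[symmetric]
      proof (rule nn_integral_cong)
        fix g assume "g \<in> space \<nu>"
        then show "(\<integral>\<^sup>+v. ennreal ((f (g *v v))\<^sup>2) \<partial>lborel) = (\<integral>\<^sup>+v. ennreal ((f v)\<^sup>2) \<partial>lborel)"
          unfolding sp by (intro nn_integral_SL) auto
      qed
      finally show ?thesis by (simp add: \<nu>.emeasure_space_1)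
    qed
    have pq: "(p v)\<^sup>2 \<le> q v" for v
    proof -
      have "0 \<le> (\<integral>g. (f (g *v v) - p v)\<^sup>2 \<partial>\<nu>)" by simp
      also have "\<dots> = (\<integral>g. (f (g *v v))\<^sup>2 + (p v)\<^sup>2 - 2 * p v * f (g *v v) \<partial>\<nu>)"
        by (simp add: power2_eq_square algebra_simps)
      also have "\<dots> = q v - (p v)\<^sup>2"
        using int by (simp add: q_def p_def[symmetric] \<nu>.prob_space power2_eq_square)
      finally show ?thesis by simp
    qed
    have double: "(\<integral>\<^sup>+g. \<integral>\<^sup>+h. ennreal ((f (g *v v) - f (h *v v))\<^sup>2) \<partial>\<nu> \<partial>\<nu>) = ennreal (2 * q v - 2 * (p v)\<^sup>2)" for v
    proof -
      have i1: "integrable \<nu> (\<lambda>h. (f (g *v v) - f (h *v v))\<^sup>2)" for g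
        using bd by (auto intro!: \<nu>.integrable_const_bound[of _ 1] AE_I2 simp: power2_le_iff_abs_le abs_square_le_1 abs_le_iff) (smt (verit))+
      have e1: "(\<integral>h. (f (g *v v) - f (h *v v))\<^sup>2 \<partial>\<nu>) = (f (g *v v))\<^sup>2 + q v - 2 * p v * f (g *v v)" for g
      proof -
        have "(\<integral>h. (f (g *v v) - f (h *v v))\<^sup>2 \<partial>\<nu>) = (\<integral>h. (f (g *v v))\<^sup>2 + (f (h *v v))\<^sup>2 - 2 * f (g *v v) * f (h *v v) \<partial>\<nu>)"
          by (simp add: power2_eq_square algebra_simps)
        also have "\<dots> = (f (g *v v))\<^sup>2 + q v - 2 * f (g *v v) * p v"
          using int by (simp add: q_def p_def \<nu>.prob_space)
        finally show ?thesis by simp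
      qed
      have nn1: "(\<integral>\<^sup>+h. ennreal ((f (g *v v) - f (h *v v))\<^sup>2) \<partial>\<nu>) = ennreal ((f (g *v v))\<^sup>2 + q v - 2 * p v * f (g *v v))" for g
        using i1 by (subst nn_integral_eq_integral) (auto simp: e1)
      have "(\<integral>\<^sup>+g. ennreal ((f (g *v v))\<^sup>2 + q v - 2 * p v * f (g *v v)) \<partial>\<nu>)
          = ennreal (\<integral>g. (f (g *v v))\<^sup>2 + q v - 2 * p v * f (g *v v) \<partial>\<nu>)"
      proof (rule nn_integral_eq_integral)
        show "AE g in \<nu>. 0 \<le> (f (g *v v))\<^sup>2 + q v - 2 * p v * f (g *v v)"
          unfolding e1[symmetric] by (intro AE_I2) simp
      qed (use int in auto)
      also have "(\<integral>g. (f (g *v v))\<^sup>2 + q v - 2 * p v * f (g *v v) \<partial>\<nu>) = q v + q v - 2 * p v * p v"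
        using int by (simp add: q_def[symmetric] p_def[symmetric] \<nu>.prob_space)
      also have "\<dots> = 2 * q v - 2 * (p v)\<^sup>2" by (simp add: power2_eq_square)
      finally show ?thesis by (simp add: nn1)
    qed
    have "(\<integral>\<^sup>+g. \<integral>\<^sup>+h. \<integral>\<^sup>+v. ennreal ((f (g *v v) - f (h *v v))\<^sup>2) \<partial>lborel \<partial>\<nu> \<partial>\<nu>)
        = (\<integral>\<^sup>+g. \<integral>\<^sup>+v. \<integral>\<^sup>+h. ennreal ((f (g *v v) - f (h *v v))\<^sup>2) \<partial>\<nu> \<partial>lborel \<partial>\<nu>)"
      by (intro nn_integral_cong P.Fubini'[symmetric]) measurable
    also have "\<dots> = (\<integral>\<^sup>+v. \<integral>\<^sup>+g. \<integral>\<^sup>+h. ennreal ((f (g *v v) - f (h *v v))\<^sup>2) \<partial>\<nu> \<partial>\<nu> \<partial>lborel)"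
      by (rule P.Fubini'[symmetric]) measurable
    also have "\<dots> = (\<integral>\<^sup>+v. ennreal (2 * q v - 2 * (p v)\<^sup>2) \<partial>lborel)"
      by (simp add: double)
    finally have J: "(\<integral>\<^sup>+g. \<integral>\<^sup>+h. \<integral>\<^sup>+v. ennreal ((f (g *v v) - f (h *v v))\<^sup>2) \<partial>lborel \<partial>\<nu> \<partial>\<nu>)
        = (\<integral>\<^sup>+v. ennreal (2 * q v - 2 * (p v)\<^sup>2) \<partial>lborel)" .
    have scaled: "ennreal (d * s) \<le> (\<integral>\<^sup>+g. \<integral>\<^sup>+h. \<integral>\<^sup>+v. ennreal ((f (g *v v) - f (h *v v))\<^sup>2) \<partial>lborel \<partial>\<nu> \<partial>\<nu>)"
    proof (cases "s = 0")
      case False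
      with s have "s > 0" by simp
      let ?f = "\<lambda>v. f v / sqrt s"
      have sq: "ennreal ((x / sqrt s)\<^sup>2) = ennreal (1 / s) * ennreal (x\<^sup>2)" for x
        using \<open>s > 0\<close> by (simp add: power_divide flip: ennreal_mult)
      have "(\<integral>\<^sup>+v. ennreal ((?f v)\<^sup>2) \<partial>lborel) = ennreal (1 / s) * ennreal s"
        unfolding sq by (simp add: nn_integral_cmult s)
      also have "\<dots> = 1" using \<open>s > 0\<close> by (simp flip: ennreal_mult)
      finally have "ennreal d \<le> (\<integral>\<^sup>+g. \<integral>\<^sup>+h. \<integral>\<^sup>+v. ennreal ((?f (g *v v) - ?f (h *v v))\<^sup>2) \<partial>lborel \<partial>\<nu> \<partial>\<nu>)"
        by (intro d[OF \<nu>]) auto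
      also have "\<dots> = ennreal (1 / s) * (\<integral>\<^sup>+g. \<integral>\<^sup>+h. \<integral>\<^sup>+v. ennreal ((f (g *v v) - f (h *v v))\<^sup>2) \<partial>lborel \<partial>\<nu> \<partial>\<nu>)"
        unfolding diff_divide_distrib[symmetric] sq by (simp add: nn_integral_cmult)
      finally have "ennreal s * ennreal d \<le> ennreal s * (ennreal (1 / s) * (\<integral>\<^sup>+g. \<integral>\<^sup>+h. \<integral>\<^sup>+v. ennreal ((f (g *v v) - f (h *v v))\<^sup>2) \<partial>lborel \<partial>\<nu> \<partial>\<nu>))"
        by (rule mult_left_mono) simp
      then show ?thesis
        using \<open>s > 0\<close> \<open>d > 0\<close> by (simp add: mult.assoc[symmetric] mult.commute flip: ennreal_mult)
    qed simp
    have iq: "integrable lborel q" "(\<integral>v. q v \<partial>lborel) = s"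
    proof -
      have q0: "0 \<le> q v" for v unfolding q_def by simp
      show "integrable lborel q" using int_q q0 by (intro integrableI_nonneg) auto
      show "(\<integral>v. q v \<partial>lborel) = s" using int_q q0 s by (simp add: integral_eq_nn_integral)
    qed
    have ip: "integrable lborel (\<lambda>v. (p v)\<^sup>2)"
      by (rule Bochner_Integration.integrable_bound[OF iq(1)]) (use pq in \<open>auto intro!: AE_I2 intro: order_trans[OF _ abs_ge_self]\<close>)
    have "(\<integral>\<^sup>+v. ennreal (2 * q v - 2 * (p v)\<^sup>2) \<partial>lborel) = ennreal (\<integral>v. 2 * q v - 2 * (p v)\<^sup>2 \<partial>lborel)"
      using iq ip pq by (intro nn_integral_eq_integral) auto
    also have "(\<integral>v. 2 * q v - 2 * (p v)\<^sup>2 \<partial>lborel) = 2 * s - 2 * (\<integral>v. (p v)\<^sup>2 \<partial>lborel)"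
      using iq ip by simp
    finally have "ennreal (d * s) \<le> ennreal (2 * s - 2 * (\<integral>v. (p v)\<^sup>2 \<partial>lborel))"
      using scaled J by simp
    moreover have "(\<integral>v. (p v)\<^sup>2 \<partial>lborel) \<le> s"
      using integral_mono[OF ip iq(1)] pq iq(2) by simp
    ultimately have "d * s \<le> 2 * s - 2 * (\<integral>v. (p v)\<^sup>2 \<partial>lborel)"
      by (subst (asm) ennreal_le_iff) auto
    moreover have "min (d / 2) (1 / 2) * s \<le> d / 2 * s" using s by (intro mult_right_mono) auto
    ultimately have "(\<integral>v. (p v)\<^sup>2 \<partial>lborel) \<le> (1 - min (d / 2) (1 / 2)) * s"
      by (simp add: left_diff_distrib)
    then have "ennreal (\<integral>v. (p v)\<^sup>2 \<partial>lborel) \<le> ennreal ((1 - min (d / 2) (1 / 2)) * s)" by (rule ennreal_leI)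
    also have "\<dots> = ennreal (1 - min (d / 2) (1 / 2)) * ennreal s" using s by (intro ennreal_mult) auto
    also have "ennreal (\<integral>v. (p v)\<^sup>2 \<partial>lborel) = (\<integral>\<^sup>+v. ennreal ((p v)\<^sup>2) \<partial>lborel)"
      using ip by (intro nn_integral_eq_integral[symmetric]) auto
    finally show "(\<integral>\<^sup>+v. ennreal ((\<integral>g. f (g *v v) \<partial>\<nu>)\<^sup>2) \<partial>lborel) \<le> ennreal (1 - min (d / 2) (1 / 2)) * (\<integral>\<^sup>+v. ennreal ((f v)\<^sup>2) \<partial>lborel)"
      unfolding s(1) p_def .
  qed (use \<open>d > 0\<close> in auto)
qed

section \<open>Markov chains\<close>

lemma
  assumes "markov_chain P X k \<xi>"
  shows markov_prob_space: "prob_space P"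
    and markov_meas: "n \<ge> 1 \<Longrightarrow> \<xi> n \<in> P \<rightarrow>\<^sub>M X"
    and markov_kernel: "n \<ge> 1 \<Longrightarrow> k n \<in> X \<rightarrow>\<^sub>M prob_algebra X"
  using assms by (auto simp: markov_chain_def)

lemma natural_filtration_subalgebra:
  assumes "markov_chain P X k \<xi>"
  shows "subalgebra P (natural_filtration P X \<xi> n)"
proof -
  have "(\<lambda>\<omega>. \<lambda>i\<in>{1..n}. \<xi> i \<omega>) \<in> P \<rightarrow>\<^sub>M Pi\<^sub>M {1..n} (\<lambda>_. X)"
    using markov_meas[OF assms] by (intro measurable_restrict) auto
  from measurable_sets[OF this] measurable_space[OF this] show ?thesis
    unfolding subalgebra_def natural_filtration_def
    by (auto simp: sets_vimage_algebra2 space_vimage_algebra)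
qed

lemma natural_filtration_measurable:
  assumes "markov_chain P X k \<xi>" "1 \<le> i" "i \<le> n"
  shows "\<xi> i \<in> natural_filtration P X \<xi> n \<rightarrow>\<^sub>M X"
proof -
  have "(\<lambda>\<omega>. \<lambda>i\<in>{1..n}. \<xi> i \<omega>) \<in> P \<rightarrow>\<^sub>M Pi\<^sub>M {1..n} (\<lambda>_. X)"
    using markov_meas[OF assms(1)] by (intro measurable_restrict) auto
  then have "(\<lambda>\<omega>. \<lambda>i\<in>{1..n}. \<xi> i \<omega>) \<in> natural_filtration P X \<xi> n \<rightarrow>\<^sub>M Pi\<^sub>M {1..n} (\<lambda>_. X)"
    unfolding natural_filtration_def by (intro measurable_vimage_algebra1) (auto dest: measurable_space)
  from measurable_compose[OF this measurable_component_singleton[of i]] assms(2,3)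
  show ?thesis by simp
qed

text \<open>The defining property of the chain, integrated over an event of the past.\<close>

lemma markov_rectangle:
  assumes mc: "markov_chain P X k \<xi>" and n: "n \<ge> 1"
    and A: "A \<in> sets (natural_filtration P X \<xi> n)" and B: "B \<in> sets X"
  shows "emeasure P (A \<inter> (\<xi> (Suc n) -` B \<inter> space P)) = (\<integral>\<^sup>+\<omega>. indicator A \<omega> * emeasure (k n (\<xi> n \<omega>)) B \<partial>P)"
proof -
  interpret prob_space P by (rule markov_prob_space[OF mc])
  let ?F = "natural_filtration P X \<xi> n"
  have sub: "subalgebra P ?F" by (rule natural_filtration_subalgebra[OF mc])
  interpret finite_measure_subalgebra P ?F by unfold_locales (rule sub)
  interpret sigma_finite_subalgebra P ?F
    by (rule finite_measure_subalgebra_is_sigma_finite) unfold_locales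
  note [measurable] = markov_meas[OF mc, of "Suc n", simplified] markov_meas[OF mc n] B
  have Am[measurable]: "A \<in> sets P" using A sub by (auto simp: subalgebra_def)
  have kn[measurable]: "k n \<in> X \<rightarrow>\<^sub>M subprob_algebra X" by (rule measurable_prob_algebraD[OF markov_kernel[OF mc n]])
  have km[measurable]: "(\<lambda>\<omega>. measure (k n (\<xi> n \<omega>)) B) \<in> borel_measurable P"
    unfolding measure_def by (intro borel_measurable_enn2real measurable_compose[OF markov_meas[OF mc n]
        measurable_compose[OF kn measurable_emeasure_subprob_algebra[OF B]]])
  have ps: "prob_space (k n (\<xi> n \<omega>))" if "\<omega> \<in> space P" for \<omega>
    using measurable_space[OF markov_kernel[OF mc n]] measurable_space[OF markov_meas[OF mc n] that]
    by (auto simp: space_prob_algebra)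
  have ae: "AE \<omega> in P. real_cond_exp P ?F (\<lambda>\<omega>. indicator B (\<xi> (Suc n) \<omega>)) \<omega> = measure (k n (\<xi> n \<omega>)) B"
    using mc n B unfolding markov_chain_def by blast
  have "measure P (A \<inter> (\<xi> (Suc n) -` B \<inter> space P)) = (\<integral>\<omega>. indicator A \<omega> * indicator B (\<xi> (Suc n) \<omega>) \<partial>P)"
  proof -
    have "measure P (A \<inter> (\<xi> (Suc n) -` B \<inter> space P)) = (\<integral>\<omega>. indicator (A \<inter> (\<xi> (Suc n) -` B \<inter> space P)) \<omega> \<partial>P)" by simp
    also have "\<dots> = (\<integral>\<omega>. indicator A \<omega> * indicator B (\<xi> (Suc n) \<omega>) \<partial>P)"
      by (intro Bochner_Integration.integral_cong) (auto simp: indicator_def)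
    finally show ?thesis .
  qed
  also have "\<dots> = (\<integral>\<omega>. indicator A \<omega> * real_cond_exp P ?F (\<lambda>\<omega>. indicator B (\<xi> (Suc n) \<omega>)) \<omega> \<partial>P)"
    using A by (intro real_cond_exp_intg(2)[symmetric])
      (auto intro!: integrable_const_bound[of _ 1] AE_I2 simp: indicator_def)
  also have "\<dots> = (\<integral>\<omega>. indicator A \<omega> * measure (k n (\<xi> n \<omega>)) B \<partial>P)"
    using ae by (intro integral_cong_AE) auto
  finally have eq: "measure P (A \<inter> (\<xi> (Suc n) -` B \<inter> space P)) = (\<integral>\<omega>. indicator A \<omega> * measure (k n (\<xi> n \<omega>)) B \<partial>P)" .
  have "emeasure P (A \<inter> (\<xi> (Suc n) -` B \<inter> space P)) = ennreal (\<integral>\<omega>. indicator A \<omega> * measure (k n (\<xi> n \<omega>)) B \<partial>P)"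
    by (simp add: emeasure_eq_measure eq)
  also have "\<dots> = (\<integral>\<^sup>+\<omega>. ennreal (indicator A \<omega> * measure (k n (\<xi> n \<omega>)) B) \<partial>P)"
  proof (intro nn_integral_eq_integral[symmetric] integrable_const_bound[of _ 1])
    show "AE \<omega> in P. norm (indicator A \<omega> * measure (k n (\<xi> n \<omega>)) B) \<le> 1"
      using prob_space.prob_le_1[OF ps] by (intro AE_I2) (simp add: indicator_def)
  qed auto
  also have "\<dots> = (\<integral>\<^sup>+\<omega>. indicator A \<omega> * emeasure (k n (\<xi> n \<omega>)) B \<partial>P)"
    using ps by (intro nn_integral_cong)
      (auto simp: indicator_def prob_space_def finite_measure.emeasure_eq_measure)
  finally show ?thesis .
qed

text \<open>The Markov property for a function of the past and of the next state: both sides are integrals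
  against measures on the product space that agree on rectangles.\<close>

lemma markov_nn_integral:
  assumes mc: "markov_chain P X k \<xi>" and n: "n \<ge> 1"
    and Z: "Z \<in> natural_filtration P X \<xi> n \<rightarrow>\<^sub>M N" and h: "h \<in> borel_measurable (N \<Otimes>\<^sub>M X)"
  shows "(\<integral>\<^sup>+\<omega>. h (Z \<omega>, \<xi> (Suc n) \<omega>) \<partial>P) = (\<integral>\<^sup>+\<omega>. \<integral>\<^sup>+y. h (Z \<omega>, y) \<partial>k n (\<xi> n \<omega>) \<partial>P)"
proof -
  interpret prob_space P by (rule markov_prob_space[OF mc])
  let ?F = "natural_filtration P X \<xi> n"
  have sub: "subalgebra P ?F" by (rule natural_filtration_subalgebra[OF mc])
  have Zm[measurable]: "Z \<in> P \<rightarrow>\<^sub>M N" by (rule measurable_from_subalg[OF sub Z])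
  note [measurable] = markov_meas[OF mc, of "Suc n", simplified] markov_meas[OF mc n] h
  have kn: "k n \<in> X \<rightarrow>\<^sub>M subprob_algebra X" by (rule measurable_prob_algebraD[OF markov_kernel[OF mc n]])
  have k\<xi>[measurable]: "(\<lambda>\<omega>. k n (\<xi> n \<omega>)) \<in> P \<rightarrow>\<^sub>M subprob_algebra X"
    using measurable_compose[OF markov_meas[OF mc n] kn] .
  have ks: "sets (k n (\<xi> n \<omega>)) = sets X" "prob_space (k n (\<xi> n \<omega>))" if "\<omega> \<in> space P" for \<omega>
    using measurable_space[OF markov_kernel[OF mc n]] measurable_space[OF markov_meas[OF mc n] that]
    by (auto simp: space_prob_algebra)
  define L where "L \<omega> = distr (k n (\<xi> n \<omega>)) (N \<Otimes>\<^sub>M X) (\<lambda>y. (Z \<omega>, y))" for \<omega>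
  have Lm: "L \<in> P \<rightarrow>\<^sub>M subprob_algebra (N \<Otimes>\<^sub>M X)"
    unfolding L_def by (rule measurable_distr2[OF _ k\<xi>]) measurable
  have ne: "space P \<noteq> {}" by (rule not_empty)
  have pm: "(\<lambda>y. (Z \<omega>, y)) \<in> k n (\<xi> n \<omega>) \<rightarrow>\<^sub>M N \<Otimes>\<^sub>M X" if "\<omega> \<in> space P" for \<omega>
    using measurable_space[OF Zm that] ks[OF that] by (simp cong: measurable_cong_sets)
  have "distr P (N \<Otimes>\<^sub>M X) (\<lambda>\<omega>. (Z \<omega>, \<xi> (Suc n) \<omega>)) = P \<bind> L"
  proof (rule measure_eqI_generator_eq[OF Int_stable_pair_measure_generator pair_measure_closed])
    have sb: "sets (P \<bind> L) = sets (N \<Otimes>\<^sub>M X)" by (rule sets_bind[OF _ ne]) (simp add: L_def)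
    let ?E = "{A \<times> B |A B. A \<in> sets N \<and> B \<in> sets X}"
    show "sets (distr P (N \<Otimes>\<^sub>M X) (\<lambda>\<omega>. (Z \<omega>, \<xi> (Suc n) \<omega>))) = sigma_sets (space N \<times> space X) ?E"
      by (simp add: sets_pair_measure)
    show "sets (P \<bind> L) = sigma_sets (space N \<times> space X) ?E"
      by (simp add: sb sets_pair_measure)
    show "range (\<lambda>_ :: nat. space N \<times> space X) \<subseteq> ?E" by auto
    show "emeasure (distr P (N \<Otimes>\<^sub>M X) (\<lambda>\<omega>. (Z \<omega>, \<xi> (Suc n) \<omega>))) (space N \<times> space X) \<noteq> \<infinity>"
      by (subst emeasure_distr) (auto simp: emeasure_eq_measure)
    fix E assume "E \<in> ?E"
    then obtain A B where E: "E = A \<times> B" and A: "A \<in> sets N" and B: "B \<in> sets X" by auto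
    have "emeasure (distr P (N \<Otimes>\<^sub>M X) (\<lambda>\<omega>. (Z \<omega>, \<xi> (Suc n) \<omega>))) E
        = emeasure P ((Z -` A \<inter> space P) \<inter> (\<xi> (Suc n) -` B \<inter> space P))"
      using A B by (subst emeasure_distr) (auto simp: E intro!: arg_cong[of _ _ "emeasure P"])
    also have "\<dots> = (\<integral>\<^sup>+\<omega>. indicator (Z -` A \<inter> space P) \<omega> * emeasure (k n (\<xi> n \<omega>)) B \<partial>P)"
      using measurable_sets[OF Z A] sub by (intro markov_rectangle[OF mc n _ B]) (simp add: subalgebra_def)
    also have "\<dots> = (\<integral>\<^sup>+\<omega>. emeasure (L \<omega>) E \<partial>P)"
    proof (rule nn_integral_cong)
      fix \<omega> assume \<omega>: "\<omega> \<in> space P"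
      have "emeasure (L \<omega>) E = emeasure (k n (\<xi> n \<omega>)) ((\<lambda>y. (Z \<omega>, y)) -` E \<inter> space (k n (\<xi> n \<omega>)))"
        unfolding L_def using A B by (subst emeasure_distr[OF pm[OF \<omega>]]) (auto simp: E)
      also have "(\<lambda>y. (Z \<omega>, y)) -` E \<inter> space (k n (\<xi> n \<omega>)) = (if Z \<omega> \<in> A then B else {})"
        using sets.sets_into_space[OF B] sets_eq_imp_space_eq[OF ks(1)[OF \<omega>]] by (auto simp: E)
      finally show "indicator (Z -` A \<inter> space P) \<omega> * emeasure (k n (\<xi> n \<omega>)) B = emeasure (L \<omega>) E"
        using \<omega> by (simp add: indicator_def)
    qed
    also have "\<dots> = emeasure (P \<bind> L) E"
      using A B by (intro emeasure_bind[OF ne Lm, symmetric]) (auto simp: E)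
    finally show "emeasure (distr P (N \<Otimes>\<^sub>M X) (\<lambda>\<omega>. (Z \<omega>, \<xi> (Suc n) \<omega>))) E = emeasure (P \<bind> L) E" .
  qed auto
  then have "(\<integral>\<^sup>+z. h z \<partial>distr P (N \<Otimes>\<^sub>M X) (\<lambda>\<omega>. (Z \<omega>, \<xi> (Suc n) \<omega>))) = (\<integral>\<^sup>+z. h z \<partial>(P \<bind> L))" by simp
  also have "\<dots> = (\<integral>\<^sup>+\<omega>. \<integral>\<^sup>+z. h z \<partial>L \<omega> \<partial>P)"
    by (rule nn_integral_bind[OF h Lm])
  also have "\<dots> = (\<integral>\<^sup>+\<omega>. \<integral>\<^sup>+y. h (Z \<omega>, y) \<partial>k n (\<xi> n \<omega>) \<partial>P)"
    unfolding L_def by (intro nn_integral_cong nn_integral_distr[OF pm]) auto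
  finally show ?thesis by (simp add: nn_integral_distr)
qed

lemma markov_marginal_nn_integral:
  assumes mc: "markov_chain P X k \<xi>" and n: "n \<ge> 1" and f[measurable]: "f \<in> borel_measurable X"
  shows "(\<integral>\<^sup>+y. f y \<partial>distr P X (\<xi> (Suc n))) = (\<integral>\<^sup>+x. \<integral>\<^sup>+y. f y \<partial>k n x \<partial>distr P X (\<xi> n))"
proof -
  note [measurable] = markov_meas[OF mc, of "Suc n", simplified] markov_meas[OF mc n]
  have kn: "k n \<in> X \<rightarrow>\<^sub>M subprob_algebra X" by (rule measurable_prob_algebraD[OF markov_kernel[OF mc n]])
  have [measurable]: "(\<lambda>x. \<integral>\<^sup>+y. f y \<partial>k n x) \<in> borel_measurable X"
    by (rule measurable_compose[OF kn nn_integral_measurable_subprob_algebra[OF f]])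
  have "(\<integral>\<^sup>+\<omega>. f (snd (\<xi> n \<omega>, \<xi> (Suc n) \<omega>)) \<partial>P) = (\<integral>\<^sup>+\<omega>. \<integral>\<^sup>+y. f (snd (\<xi> n \<omega>, y)) \<partial>k n (\<xi> n \<omega>) \<partial>P)"
    using natural_filtration_measurable[OF mc n order_refl]
    by (intro markov_nn_integral[OF mc n, where h="\<lambda>p. f (snd p)"]) auto
  then show ?thesis by (simp add: nn_integral_distr)
qed

text \<open>The seminorm may vanish on \<open>f\<close>; then arbitrarily large multiples of \<open>f\<close> lie in the unit ball, and the
  image of \<open>f\<close> has norm \<open>0\<close>.\<close>

lemma kernel_l2_bound:
  assumes op: "op_norm0 \<mu>' \<mu> (kernel_op \<kappa>) \<le> ereal c" and f: "f \<in> l2_space0 \<mu>'"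
  shows "l2_norm \<mu> (kernel_op \<kappa> f) \<le> c * l2_norm \<mu>' f"
proof -
  have scale: "r * l2_norm \<mu> (kernel_op \<kappa> f) \<le> c" if r: "r \<ge> 0" "r * l2_norm \<mu>' f \<le> 1" for r
  proof -
    have rf: "(\<lambda>x. r * f x) \<in> l2_space0 \<mu>'"
      using f by (auto simp: l2_space0_def l2_space_def power_mult_distrib)
    have norm_r: "l2_norm M (\<lambda>x. r * g x) = r * l2_norm M g" for M and g :: "'b \<Rightarrow> real"
      using r(1) by (simp add: l2_norm_def power_mult_distrib real_sqrt_mult)
    have "ereal (l2_norm \<mu> (kernel_op \<kappa> (\<lambda>x. r * f x))) \<le> op_norm0 \<mu>' \<mu> (kernel_op \<kappa>)"
      unfolding op_norm0_def using rf r(2) by (intro SUP_upper) (simp add: norm_r)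
    moreover have "kernel_op \<kappa> (\<lambda>x. r * f x) = (\<lambda>x. r * kernel_op \<kappa> f x)"
      by (auto simp: kernel_op_def)
    ultimately show ?thesis using op order_trans by (fastforce simp: norm_r)
  qed
  have nn: "0 \<le> l2_norm \<mu> (kernel_op \<kappa> f)" "0 \<le> l2_norm \<mu>' f" by (auto simp: l2_norm_def)
  show ?thesis
  proof (cases "l2_norm \<mu>' f = 0")
    case False
    then show ?thesis using scale[of "1 / l2_norm \<mu>' f"] nn by (simp add: field_simps)
  next
    case True
    have "l2_norm \<mu> (kernel_op \<kappa> f) = 0"
    proof (rule ccontr)
      assume "l2_norm \<mu> (kernel_op \<kappa> f) \<noteq> 0"
      then have pos: "l2_norm \<mu> (kernel_op \<kappa> f) > 0" using nn by simp
      then have "(\<bar>c\<bar> + 1) / l2_norm \<mu> (kernel_op \<kappa> f) * l2_norm \<mu> (kernel_op \<kappa> f) = \<bar>c\<bar> + 1"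
        by simp
      moreover have "(\<bar>c\<bar> + 1) / l2_norm \<mu> (kernel_op \<kappa> f) * l2_norm \<mu> (kernel_op \<kappa> f) \<le> c"
        using pos True by (intro scale) auto
      ultimately show False by linarith
    qed
    then show ?thesis using True by simp
  qed
qed

text \<open>Splitting \<open>f\<close> into its mean and its centred part turns the bound on \<open>op_norm0\<close> into an inequality
  between nonnegative quantities, which can later be integrated over \<open>v\<close>.\<close>

lemma kernel_square_bound:
  fixes P :: "'w measure" and X :: "'x measure"
  assumes mc: "markov_chain P X k \<xi>" and n: "n \<ge> 1" and c: "0 \<le> c"
    and op: "op_norm0 (distr P X (\<xi> (Suc n))) (distr P X (\<xi> n)) (kernel_op (k n)) \<le> ereal c"
    and f[measurable]: "f \<in> borel_measurable X" and bd: "\<And>x. x \<in> space X \<Longrightarrow> 0 \<le> f x \<and> f x \<le> 1"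
  shows "(\<integral>x. kernel_op (k n) f x \<partial>distr P X (\<xi> n)) = (\<integral>x. f x \<partial>distr P X (\<xi> (Suc n)))"
    and "(\<integral>x. (kernel_op (k n) f x)\<^sup>2 \<partial>distr P X (\<xi> n))
      \<le> c\<^sup>2 * (\<integral>x. (f x)\<^sup>2 \<partial>distr P X (\<xi> (Suc n))) + (1 - c\<^sup>2) * (\<integral>x. f x \<partial>distr P X (\<xi> (Suc n)))\<^sup>2"
proof -
  interpret P: prob_space P by (rule markov_prob_space[OF mc])
  define \<mu> where "\<mu> = distr P X (\<xi> n)"
  define \<mu>' where "\<mu>' = distr P X (\<xi> (Suc n))"
  interpret \<mu>: prob_space \<mu> unfolding \<mu>_def by (rule P.prob_space_distr[OF markov_meas[OF mc n]])
  interpret \<mu>': prob_space \<mu>' unfolding \<mu>'_def by (rule P.prob_space_distr[OF markov_meas[OF mc]]) simp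
  have [simp, measurable_cong]: "sets \<mu> = sets X" "sets \<mu>' = sets X" by (simp_all add: \<mu>_def \<mu>'_def)
  have [simp]: "space \<mu> = space X" "space \<mu>' = space X" by (simp_all add: \<mu>_def \<mu>'_def)
  have [simp]: "measure \<mu>' (space X) = 1" using \<mu>'.prob_space by simp
  have kn: "k n \<in> X \<rightarrow>\<^sub>M subprob_algebra X" by (rule measurable_prob_algebraD[OF markov_kernel[OF mc n]])
  have ks: "sets (k n x) = sets X" "prob_space (k n x)" if "x \<in> space X" for x
    using measurable_space[OF markov_kernel[OF mc n] that] by (auto simp: space_prob_algebra)
  have sp: "space (k n x) = space X" if "x \<in> space X" for x using sets_eq_imp_space_eq[OF ks(1)[OF that]] .
  let ?K = "kernel_op (k n)"
  have [measurable]: "?K g \<in> borel_measurable X" if "g \<in> borel_measurable X" for g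
    unfolding kernel_op_def by (rule measurable_compose[OF kn integral_measurable_subprob_algebra[OF that]])
  have fi: "integrable (k n x) f" if "x \<in> space X" for x
  proof -
    interpret prob_space "k n x" by (rule ks[OF that])
    show ?thesis using bd sp[OF that] ks[OF that] f
      by (intro integrable_const_bound[of _ 1]) (auto intro!: AE_I2 cong: measurable_cong_sets)
  qed
  have Kf: "0 \<le> ?K f x \<and> ?K f x \<le> 1" if "x \<in> space X" for x
  proof -
    interpret prob_space "k n x" by (rule ks[OF that])
    have "?K f x \<le> (\<integral>y. 1 \<partial>k n x)" unfolding kernel_op_def
      using bd sp[OF that] fi[OF that] by (intro integral_mono) auto
    moreover have "0 \<le> ?K f x" unfolding kernel_op_def using bd sp[OF that] by (intro integral_nonneg_AE AE_I2) auto
    ultimately show ?thesis by (simp add: prob_space)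
  qed
  have fint: "integrable \<mu>' f" "integrable \<mu>' (\<lambda>x. (f x)\<^sup>2)"
    using bd by (auto intro!: \<mu>'.integrable_const_bound[of _ 1] AE_I2 simp: power_le_one)
  have Kint: "integrable \<mu> (?K f)" "integrable \<mu> (\<lambda>x. (?K f x)\<^sup>2)"
    using Kf by (auto intro!: \<mu>.integrable_const_bound[of _ 1] AE_I2 simp: power_le_one)
  define m where "m = (\<integral>x. f x \<partial>\<mu>')"
  have mean: "(\<integral>x. ?K f x \<partial>\<mu>) = m"
  proof -
    have "ennreal (\<integral>x. ?K f x \<partial>\<mu>) = (\<integral>\<^sup>+x. ennreal (?K f x) \<partial>\<mu>)"
      using Kf Kint by (intro nn_integral_eq_integral[symmetric] AE_I2) auto
    also have "\<dots> = (\<integral>\<^sup>+x. \<integral>\<^sup>+y. ennreal (f y) \<partial>k n x \<partial>\<mu>)"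
      unfolding kernel_op_def using bd fi sp
      by (intro nn_integral_cong nn_integral_eq_integral[symmetric] AE_I2) auto
    also have "\<dots> = (\<integral>\<^sup>+y. ennreal (f y) \<partial>\<mu>')"
      unfolding \<mu>_def \<mu>'_def by (rule markov_marginal_nn_integral[OF mc n, symmetric]) measurable
    also have "\<dots> = ennreal m"
      unfolding m_def using bd fint by (intro nn_integral_eq_integral AE_I2) auto
    finally show ?thesis
      unfolding m_def using Kf bd by (subst (asm) ennreal_inj) (auto intro!: integral_nonneg_AE AE_I2)
  qed
  then show "(\<integral>x. kernel_op (k n) f x \<partial>distr P X (\<xi> n)) = (\<integral>x. f x \<partial>distr P X (\<xi> (Suc n)))"
    by (simp add: \<mu>_def \<mu>'_def m_def)
  let ?f = "\<lambda>x. f x - m"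
  have sq: "(\<integral>x. (g x - m)\<^sup>2 \<partial>M) = (\<integral>x. (g x)\<^sup>2 \<partial>M) - m\<^sup>2"
    if "prob_space M" "integrable M g" "integrable M (\<lambda>x. (g x)\<^sup>2)" "(\<integral>x. g x \<partial>M) = m" for M and g :: "'x \<Rightarrow> real"
  proof -
    interpret M: prob_space M by (rule that(1))
    have "(\<integral>x. (g x - m)\<^sup>2 \<partial>M) = (\<integral>x. (g x)\<^sup>2 + m\<^sup>2 - 2 * m * g x \<partial>M)"
      by (simp add: power2_eq_square algebra_simps)
    also have "\<dots> = (\<integral>x. (g x)\<^sup>2 \<partial>M) + m\<^sup>2 - 2 * m * m"
      using that by (simp add: M.prob_space)
    finally show ?thesis by (simp add: power2_eq_square)
  qed
  have "?f \<in> l2_space0 \<mu>'"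
  proof -
    have "integrable \<mu>' (\<lambda>x. (f x)\<^sup>2 + m\<^sup>2 - 2 * f x * m)" using fint by simp
    then have "integrable \<mu>' (\<lambda>x. (f x - m)\<^sup>2)" by (simp add: power2_diff)
    then show ?thesis using fint by (simp add: l2_space0_def l2_space_def m_def \<mu>'.prob_space)
  qed
  from kernel_l2_bound[OF op[folded \<mu>_def \<mu>'_def] this]
  have "(l2_norm \<mu> (?K ?f))\<^sup>2 \<le> (c * l2_norm \<mu>' ?f)\<^sup>2" by (intro power_mono) (auto simp: l2_norm_def)
  then have "(\<integral>x. (?K ?f x)\<^sup>2 \<partial>\<mu>) \<le> c\<^sup>2 * (\<integral>x. (?f x)\<^sup>2 \<partial>\<mu>')"
    by (simp add: l2_norm_def power_mult_distrib)
  moreover have "(\<integral>x. (?K ?f x)\<^sup>2 \<partial>\<mu>) = (\<integral>x. (?K f x - m)\<^sup>2 \<partial>\<mu>)"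
  proof (rule Bochner_Integration.integral_cong)
    fix x assume "x \<in> space \<mu>"
    then have x: "x \<in> space X" by simp
    interpret kx: prob_space "k n x" by (rule ks(2)[OF x])
    show "(?K ?f x)\<^sup>2 = (?K f x - m)\<^sup>2"
      using fi[OF x] by (simp add: kernel_op_def kx.prob_space)
  qed simp
  ultimately have "(\<integral>x. (?K f x)\<^sup>2 \<partial>\<mu>) - m\<^sup>2 \<le> c\<^sup>2 * ((\<integral>x. (f x)\<^sup>2 \<partial>\<mu>') - m\<^sup>2)"
    using sq[OF \<mu>.prob_space_axioms Kint mean] sq[OF \<mu>'.prob_space_axioms fint m_def[symmetric]] by simp
  then have "(\<integral>x. (?K f x)\<^sup>2 \<partial>\<mu>) \<le> c\<^sup>2 * (\<integral>x. (f x)\<^sup>2 \<partial>\<mu>') + (1 - c\<^sup>2) * m\<^sup>2"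
    by (simp add: algebra_simps)
  then show "(\<integral>x. (kernel_op (k n) f x)\<^sup>2 \<partial>distr P X (\<xi> n))
      \<le> c\<^sup>2 * (\<integral>x. (f x)\<^sup>2 \<partial>distr P X (\<xi> (Suc n))) + (1 - c\<^sup>2) * (\<integral>x. f x \<partial>distr P X (\<xi> (Suc n)))\<^sup>2"
    by (simp add: \<mu>_def \<mu>'_def m_def)
qed

section \<open>Energies of vector-valued functions on the phase space\<close>

text \<open>The square of the norm of \<open>F\<close> in \<open>L^2 (\<mu>; L^2 (\<real>^n))\<close>; the mean energy is that of the part of \<open>F\<close>
  that is constant on the phase space.  All functions considered take values in \<open>[0, 1]\<close>, so integrals
  over the phase space are finite.\<close>

definition energy :: "'x measure \<Rightarrow> ('x \<Rightarrow> real^'n \<Rightarrow> real) \<Rightarrow> ennreal" where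
  "energy \<mu> F = (\<integral>\<^sup>+v. \<integral>\<^sup>+x. ennreal ((F x v)\<^sup>2) \<partial>\<mu> \<partial>lborel)"

definition mean_energy :: "'x measure \<Rightarrow> ('x \<Rightarrow> real^'n \<Rightarrow> real) \<Rightarrow> ennreal" where
  "mean_energy \<mu> F = (\<integral>\<^sup>+v. ennreal ((\<integral>x. F x v \<partial>\<mu>)\<^sup>2) \<partial>lborel)"

definition unit_valued :: "'x measure \<Rightarrow> ('x \<Rightarrow> real^'n \<Rightarrow> real) \<Rightarrow> bool" where
  "unit_valued X F \<longleftrightarrow> (\<lambda>(x, v). F x v) \<in> borel_measurable (X \<Otimes>\<^sub>M borel) \<and>
     (\<forall>x\<in>space X. \<forall>v. 0 \<le> F x v \<and> F x v \<le> 1)"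

definition shift :: "('x \<Rightarrow> real^'n^'n) \<Rightarrow> ('x \<Rightarrow> real^'n \<Rightarrow> real) \<Rightarrow> 'x \<Rightarrow> real^'n \<Rightarrow> real" where
  "shift h F x v = F x (h x *v v)"

definition kernel_avg :: "('x \<Rightarrow> 'x measure) \<Rightarrow> ('x \<Rightarrow> real^'n \<Rightarrow> real) \<Rightarrow> 'x \<Rightarrow> real^'n \<Rightarrow> real" where
  "kernel_avg \<kappa> F x v = kernel_op \<kappa> (\<lambda>y. F y v) x"

lemma unit_valued_measurable:
  assumes "unit_valued X F"
  shows "(\<lambda>(x, v). F x v) \<in> borel_measurable (X \<Otimes>\<^sub>M borel)" "(\<lambda>x. F x v) \<in> borel_measurable X"
proof -
  show *: "(\<lambda>(x, v). F x v) \<in> borel_measurable (X \<Otimes>\<^sub>M borel)" using assms by (simp add: unit_valued_def)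
  have "(\<lambda>x. (x, v)) \<in> X \<rightarrow>\<^sub>M X \<Otimes>\<^sub>M borel" by simp
  from measurable_compose[OF this *] show "(\<lambda>x. F x v) \<in> borel_measurable X" by simp
qed

lemma unit_valued_bounds:
  assumes "unit_valued X F" "x \<in> space X"
  shows "0 \<le> F x v" "F x v \<le> 1" "\<bar>F x v\<bar> \<le> 1" "(F x v)\<^sup>2 \<le> 1"
  using assms by (auto simp: unit_valued_def power_le_one abs_le_iff intro: order_trans[of _ 0])

lemma unit_valued_shift:
  assumes F: "unit_valued X F" and [measurable]: "h \<in> borel_measurable X"
  shows "unit_valued X (shift h F)"
  unfolding unit_valued_def
proof
  have [measurable]: "(\<lambda>p. (fst p, h (fst p) *v snd p)) \<in> X \<Otimes>\<^sub>M borel \<rightarrow>\<^sub>M X \<Otimes>\<^sub>M borel" by measurable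
  from measurable_compose[OF this unit_valued_measurable(1)[OF F]]
  show "(\<lambda>(x, v). shift h F x v) \<in> borel_measurable (X \<Otimes>\<^sub>M borel)"
    by (simp add: shift_def case_prod_unfold)
qed (use F in \<open>auto simp: unit_valued_def shift_def\<close>)

lemma unit_valued_integrable:
  assumes F: "unit_valued X F" and "prob_space \<mu>" and s: "sets \<mu> = sets X"
  shows "integrable \<mu> (\<lambda>x. F x v)" "integrable \<mu> (\<lambda>x. (F x v)\<^sup>2)"
proof -
  interpret prob_space \<mu> by fact
  have sp: "space \<mu> = space X" using sets_eq_imp_space_eq[OF s] .
  have m: "(\<lambda>x. F x v) \<in> borel_measurable \<mu>"
    using unit_valued_measurable(2)[OF F] s by (simp cong: measurable_cong_sets)
  show "integrable \<mu> (\<lambda>x. F x v)"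
    by (rule integrable_const_bound[OF _ m, of 1]) (auto intro!: AE_I2 simp: sp unit_valued_bounds[OF F])
  show "integrable \<mu> (\<lambda>x. (F x v)\<^sup>2)"
    using m by (intro integrable_const_bound[of _ 1]) (auto intro!: AE_I2 simp: sp unit_valued_bounds[OF F])
qed

lemma unit_valued_mean:
  assumes F: "unit_valued X F" and \<mu>: "prob_space \<mu>" and s: "sets \<mu> = sets X"
  shows "(\<lambda>v. \<integral>x. F x v \<partial>\<mu>) \<in> borel_measurable borel" "0 \<le> (\<integral>x. F x v \<partial>\<mu>)" "(\<integral>x. F x v \<partial>\<mu>) \<le> 1"
    "(\<integral>x. F x v \<partial>\<mu>)\<^sup>2 \<le> (\<integral>x. (F x v)\<^sup>2 \<partial>\<mu>)"
    "(\<integral>x. (F x v - (\<integral>x. F x v \<partial>\<mu>))\<^sup>2 \<partial>\<mu>) = (\<integral>x. (F x v)\<^sup>2 \<partial>\<mu>) - (\<integral>x. F x v \<partial>\<mu>)\<^sup>2"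
proof -
  interpret prob_space \<mu> by fact
  have sp: "space \<mu> = space X" using sets_eq_imp_space_eq[OF s] .
  note int = unit_valued_integrable[OF F \<mu> s]
  have "(\<lambda>(x, v). F x v) \<in> borel_measurable (\<mu> \<Otimes>\<^sub>M borel)"
    using unit_valued_measurable(1)[OF F] s by (simp cong: measurable_cong_sets sets_pair_measure_cong)
  then have "(\<lambda>(v, x). F x v) \<in> borel_measurable (borel \<Otimes>\<^sub>M \<mu>)"
    by (subst measurable_pair_swap_iff) (simp add: case_prod_unfold)
  then show "(\<lambda>v. \<integral>x. F x v \<partial>\<mu>) \<in> borel_measurable borel"
    by (rule borel_measurable_lebesgue_integral)
  show "0 \<le> (\<integral>x. F x v \<partial>\<mu>)"
    by (intro integral_nonneg_AE AE_I2) (simp add: sp unit_valued_bounds[OF F])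
  have "(\<integral>x. F x v \<partial>\<mu>) \<le> (\<integral>x. 1 \<partial>\<mu>)"
    using int by (intro integral_mono) (auto simp: sp unit_valued_bounds[OF F])
  then show "(\<integral>x. F x v \<partial>\<mu>) \<le> 1" by (simp add: prob_space)
  define m where "m = (\<integral>x. F x v \<partial>\<mu>)"
  have "(\<integral>x. (F x v - m)\<^sup>2 \<partial>\<mu>) = (\<integral>x. (F x v)\<^sup>2 + m\<^sup>2 - 2 * m * F x v \<partial>\<mu>)"
    by (simp add: power2_eq_square algebra_simps)
  also have "\<dots> = (\<integral>x. (F x v)\<^sup>2 \<partial>\<mu>) + m\<^sup>2 - 2 * m * m"
    using int by (simp add: prob_space m_def)
  finally have eq: "(\<integral>x. (F x v - m)\<^sup>2 \<partial>\<mu>) = (\<integral>x. (F x v)\<^sup>2 \<partial>\<mu>) - m\<^sup>2" by (simp add: power2_eq_square)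
  then show "(\<integral>x. (F x v - (\<integral>x. F x v \<partial>\<mu>))\<^sup>2 \<partial>\<mu>) = (\<integral>x. (F x v)\<^sup>2 \<partial>\<mu>) - (\<integral>x. F x v \<partial>\<mu>)\<^sup>2" by (simp add: m_def)
  have "0 \<le> (\<integral>x. (F x v - m)\<^sup>2 \<partial>\<mu>)" by simp
  then have "m\<^sup>2 \<le> (\<integral>x. (F x v)\<^sup>2 \<partial>\<mu>)" using eq by linarith
  then show "(\<integral>x. F x v \<partial>\<mu>)\<^sup>2 \<le> (\<integral>x. (F x v)\<^sup>2 \<partial>\<mu>)" by (simp add: m_def)
qed

lemma energy_eq:
  assumes F: "unit_valued X F" and \<mu>: "prob_space \<mu>" and s: "sets \<mu> = sets X"
  shows "energy \<mu> F = (\<integral>\<^sup>+v. ennreal (\<integral>x. (F x v)\<^sup>2 \<partial>\<mu>) \<partial>lborel)"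
  unfolding energy_def using unit_valued_integrable[OF assms]
  by (intro nn_integral_cong nn_integral_eq_integral) auto

lemma unit_valued_square:
  "unit_valued X F \<Longrightarrow> unit_valued X (\<lambda>x v. (F x v)\<^sup>2)"
  unfolding unit_valued_def case_prod_unfold by (auto simp: power_le_one)

lemma mean_energy_le:
  assumes F: "unit_valued X F" and \<mu>: "prob_space \<mu>" and s: "sets \<mu> = sets X"
  shows "mean_energy \<mu> F \<le> energy \<mu> F"
  unfolding energy_eq[OF assms] mean_energy_def
  by (intro nn_integral_mono ennreal_leI unit_valued_mean[OF assms])

lemma energy_shift:
  fixes F :: "'x \<Rightarrow> real^'n \<Rightarrow> real"
  assumes F: "unit_valued X F" and h[measurable]: "h \<in> borel_measurable X" and SL: "\<And>x. x \<in> space X \<Longrightarrow> h x \<in> SL"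
    and \<mu>: "prob_space \<mu>" and s: "sets \<mu> = sets X"
  shows "energy \<mu> (shift h F) = energy \<mu> F"
proof -
  interpret prob_space \<mu> by fact
  interpret P: pair_sigma_finite \<mu> "lborel :: (real^'n) measure" ..
  have sp: "space \<mu> = space X" using sets_eq_imp_space_eq[OF s] .
  have tonelli: "energy \<mu> G = (\<integral>\<^sup>+x. \<integral>\<^sup>+v. ennreal ((G x v)\<^sup>2) \<partial>lborel \<partial>\<mu>)" if "unit_valued X G" for G :: "'x \<Rightarrow> real^'n \<Rightarrow> real"
  proof -
    have "(\<lambda>(x, v). G x v) \<in> borel_measurable (\<mu> \<Otimes>\<^sub>M lborel)"
      using unit_valued_measurable(1)[OF that] s by (simp cong: measurable_cong_sets sets_pair_measure_cong)
    then have "(\<lambda>(x, v). ennreal ((G x v)\<^sup>2)) \<in> borel_measurable (\<mu> \<Otimes>\<^sub>M lborel)"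
      unfolding case_prod_unfold by measurable
    then show ?thesis unfolding energy_def by (rule P.Fubini')
  qed
  have Fm: "F x \<in> borel_measurable borel" if "x \<in> space X" for x
    using measurable_compose[OF measurable_Pair1'[OF that] unit_valued_measurable(1)[OF F]] by simp
  show ?thesis
    unfolding tonelli[OF F] tonelli[OF unit_valued_shift[OF F h]]
  proof (rule nn_integral_cong)
    fix x assume "x \<in> space \<mu>"
    then have x: "x \<in> space X" by (simp add: sp)
    note [measurable] = Fm[OF x]
    show "(\<integral>\<^sup>+v. ennreal ((shift h F x v)\<^sup>2) \<partial>lborel) = (\<integral>\<^sup>+v. ennreal ((F x v)\<^sup>2) \<partial>lborel)"
      unfolding shift_def using SL[OF x] by (intro nn_integral_SL) auto
  qed
qed

text \<open>With \<open>w\<close> the mean of \<open>F\<close>, the mean of \<open>shift h F\<close> is the average of \<open>w\<close> over \<open>h\<close>, which the gap makes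
  short, plus a term that is at most as long as the fluctuation \<open>F - w\<close>.  The squares are separated by
  \<open>(p + q)^2 \<le> (1 + d / 2) p^2 + (1 + 2 / d) q^2\<close>, where \<open>(1 + d / 2) (1 - d) \<le> 1 - d / 2\<close>; the energy of
  the fluctuation is \<open>energy \<mu> F - mean_energy \<mu> F\<close>.\<close>

lemma mean_energy_shift:
  fixes F :: "'x \<Rightarrow> real^'n \<Rightarrow> real"
  assumes F: "unit_valued X F" and h[measurable]: "h \<in> borel_measurable X" and SL: "\<And>x. x \<in> space X \<Longrightarrow> h x \<in> SL"
    and \<mu>: "prob_space \<mu>" and s: "sets \<mu> = sets X" and fin: "energy \<mu> F < \<infinity>"
    and d: "0 < d" "d \<le> 1 / 2"
    and gap: "\<And>f :: real^'n \<Rightarrow> real. f \<in> borel_measurable borel \<Longrightarrow> (\<And>v. 0 \<le> f v \<and> f v \<le> 1) \<Longrightarrow>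
      (\<integral>\<^sup>+v. ennreal ((f v)\<^sup>2) \<partial>lborel) < \<infinity> \<Longrightarrow>
      (\<integral>\<^sup>+v. ennreal ((\<integral>x. f (h x *v v) \<partial>\<mu>)\<^sup>2) \<partial>lborel) \<le> ennreal (1 - d) * (\<integral>\<^sup>+v. ennreal ((f v)\<^sup>2) \<partial>lborel)"
  shows "mean_energy \<mu> (shift h F) + ennreal (1 + 2 / d) * mean_energy \<mu> F
    \<le> ennreal (1 - d / 2) * mean_energy \<mu> F + ennreal (1 + 2 / d) * energy \<mu> F"
proof -
  interpret prob_space \<mu> by fact
  have sp: "space \<mu> = space X" using sets_eq_imp_space_eq[OF s] .
  define w where "w v = (\<integral>x. F x v \<partial>\<mu>)" for v
  note wm = unit_valued_mean[OF F \<mu> s, folded w_def]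
  have wu: "unit_valued X (\<lambda>x. w)"
    using wm(1) wm(2,3) by (simp add: unit_valued_def case_prod_unfold)
  let ?sF = "shift h F" and ?sw = "shift h (\<lambda>x. w)"
  have sFu: "unit_valued X ?sF" and swu: "unit_valued X ?sw" using F wu h by (auto intro: unit_valued_shift)
  note iF = unit_valued_integrable[OF sFu \<mu> s] and iw = unit_valued_integrable[OF swu \<mu> s]
  define G where "G x v = \<bar>F x v - w v\<bar>" for x v
  have Gu: "unit_valued X G"
  proof -
    have "(\<lambda>(x, v). F x v) \<in> borel_measurable (X \<Otimes>\<^sub>M borel)" "w \<in> borel_measurable borel"
      using unit_valued_measurable[OF F] wm(1) by auto
    then have "(\<lambda>(x, v). G x v) \<in> borel_measurable (X \<Otimes>\<^sub>M borel)"
      unfolding G_def case_prod_unfold by measurable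
    moreover have "0 \<le> G x v \<and> G x v \<le> 1" if "x \<in> space X" for x v
      using unit_valued_bounds(1,2)[OF F that, of v] wm(2,3)[of v] by (auto simp: G_def abs_le_iff)
    ultimately show ?thesis by (simp add: unit_valued_def)
  qed
  note Gm = unit_valued_mean[OF Gu \<mu> s]
  have sGu: "unit_valued X (shift h G)" using Gu h by (rule unit_valued_shift)
  note iG = unit_valued_integrable[OF sGu \<mu> s]
  \<comment> \<open>Pythagoras for the mean and the fluctuation of \<open>F\<close>.\<close>
  have fluct: "energy \<mu> G + mean_energy \<mu> F = energy \<mu> F"
  proof -
    have sqm: "(\<lambda>v. \<integral>x. (G x v)\<^sup>2 \<partial>\<mu>) \<in> borel_measurable borel"
      using unit_valued_mean(1)[OF unit_valued_square[OF Gu] \<mu> s] .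
    have "energy \<mu> G + mean_energy \<mu> F = (\<integral>\<^sup>+v. ennreal (\<integral>x. (G x v)\<^sup>2 \<partial>\<mu>) + ennreal ((w v)\<^sup>2) \<partial>lborel)"
      unfolding energy_eq[OF Gu \<mu> s] mean_energy_def w_def[symmetric]
      using sqm wm(1) by (intro nn_integral_add[symmetric]) auto
    also have "\<dots> = (\<integral>\<^sup>+v. ennreal (\<integral>x. (F x v)\<^sup>2 \<partial>\<mu>) \<partial>lborel)"
    proof (rule nn_integral_cong)
      fix v
      have "(\<integral>x. (G x v)\<^sup>2 \<partial>\<mu>) = (\<integral>x. (F x v)\<^sup>2 \<partial>\<mu>) - (w v)\<^sup>2"
        unfolding G_def using wm(5)[of v] by simp
      moreover have "0 \<le> (\<integral>x. (G x v)\<^sup>2 \<partial>\<mu>)" by simp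
      ultimately show "ennreal (\<integral>x. (G x v)\<^sup>2 \<partial>\<mu>) + ennreal ((w v)\<^sup>2) = ennreal (\<integral>x. (F x v)\<^sup>2 \<partial>\<mu>)"
        by (simp flip: ennreal_plus)
    qed
    finally show ?thesis by (simp add: energy_eq[OF F \<mu> s])
  qed
  have wfin: "(\<integral>\<^sup>+v. ennreal ((w v)\<^sup>2) \<partial>lborel) = mean_energy \<mu> F" by (simp add: mean_energy_def w_def)
  have mfin: "mean_energy \<mu> F < \<infinity>" using mean_energy_le[OF F \<mu> s] fin by (rule le_less_trans)
  have gap_w: "(\<integral>\<^sup>+v. ennreal ((\<integral>x. ?sw x v \<partial>\<mu>)\<^sup>2) \<partial>lborel) \<le> ennreal (1 - d) * mean_energy \<mu> F"
    unfolding shift_def wfin[symmetric] using wm mfin by (intro gap) (auto simp: wfin)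
  have "mean_energy \<mu> ?sF \<le> (\<integral>\<^sup>+v. ennreal (1 + d / 2) * ennreal ((\<integral>x. ?sw x v \<partial>\<mu>)\<^sup>2) + ennreal (1 + 2 / d) * ennreal (\<integral>x. (shift h G x v)\<^sup>2 \<partial>\<mu>) \<partial>lborel)"
    unfolding mean_energy_def
  proof (rule nn_integral_mono)
    fix v
    define p where "p = (\<integral>x. ?sw x v \<partial>\<mu>)"
    define q where "q = (\<integral>x. ?sF x v - ?sw x v \<partial>\<mu>)"
    define r where "r = (\<integral>x. (shift h G x v)\<^sup>2 \<partial>\<mu>)"
    have m: "(\<integral>x. ?sF x v \<partial>\<mu>) = p + q" using iF iw by (simp add: p_def q_def)
    have "\<bar>q\<bar> \<le> (\<integral>x. shift h G x v \<partial>\<mu>)"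
    proof -
      have "\<bar>q\<bar> \<le> (\<integral>x. \<bar>?sF x v - ?sw x v\<bar> \<partial>\<mu>)" unfolding q_def by (rule integral_abs_bound)
      then show ?thesis by (simp add: shift_def G_def)
    qed
    then have "q\<^sup>2 \<le> (\<integral>x. shift h G x v \<partial>\<mu>)\<^sup>2" by (metis abs_ge_zero power2_abs power_mono)
    also have "\<dots> \<le> r" unfolding r_def by (rule unit_valued_mean[OF sGu \<mu> s])
    finally have q: "q\<^sup>2 \<le> r" .
    have "0 \<le> (d / 2 * p - q)\<^sup>2 * (2 / d)" using d by simp
    also have "\<dots> = d / 2 * p\<^sup>2 + 2 / d * q\<^sup>2 - 2 * p * q"
      using d by (simp add: power2_eq_square field_simps)
    finally have "(p + q)\<^sup>2 \<le> (1 + d / 2) * p\<^sup>2 + (1 + 2 / d) * q\<^sup>2"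
      by (simp add: power2_eq_square algebra_simps)
    also have "\<dots> \<le> (1 + d / 2) * p\<^sup>2 + (1 + 2 / d) * r"
      using q d by (intro add_left_mono mult_left_mono) auto
    finally have "ennreal ((p + q)\<^sup>2) \<le> ennreal ((1 + d / 2) * p\<^sup>2 + (1 + 2 / d) * r)" by (rule ennreal_leI)
    also have "\<dots> = ennreal (1 + d / 2) * ennreal (p\<^sup>2) + ennreal (1 + 2 / d) * ennreal r"
    proof -
      have "0 \<le> r" by (simp add: r_def)
      then show ?thesis using d by (simp add: ennreal_mult' ennreal_plus)
    qed
    finally show "ennreal ((\<integral>x. ?sF x v \<partial>\<mu>)\<^sup>2) \<le> ennreal (1 + d / 2) * ennreal ((\<integral>x. ?sw x v \<partial>\<mu>)\<^sup>2) + ennreal (1 + 2 / d) * ennreal (\<integral>x. (shift h G x v)\<^sup>2 \<partial>\<mu>)"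
      unfolding m p_def[symmetric] r_def[symmetric] .
  qed
  also have "\<dots> = ennreal (1 + d / 2) * (\<integral>\<^sup>+v. ennreal ((\<integral>x. ?sw x v \<partial>\<mu>)\<^sup>2) \<partial>lborel) + ennreal (1 + 2 / d) * energy \<mu> (shift h G)"
  proof -
    have [measurable]: "(\<lambda>v. \<integral>x. ?sw x v \<partial>\<mu>) \<in> borel_measurable borel" "(\<lambda>v. \<integral>x. (shift h G x v)\<^sup>2 \<partial>\<mu>) \<in> borel_measurable borel"
      using unit_valued_mean(1)[OF swu \<mu> s] unit_valued_mean(1)[OF unit_valued_square[OF sGu] \<mu> s] by auto
    show ?thesis unfolding energy_eq[OF sGu \<mu> s]
      by (subst nn_integral_add) (auto simp: nn_integral_cmult)
  qed
  also have "\<dots> \<le> ennreal (1 + d / 2) * (ennreal (1 - d) * mean_energy \<mu> F) + ennreal (1 + 2 / d) * energy \<mu> G"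
    using gap_w energy_shift[OF Gu h SL \<mu> s] by (intro add_mono mult_left_mono) auto
  also have "\<dots> \<le> ennreal (1 - d / 2) * mean_energy \<mu> F + ennreal (1 + 2 / d) * energy \<mu> G"
  proof -
    have "(1 + d / 2) * (1 - d) \<le> 1 - d / 2" using d by (simp add: algebra_simps)
    then have "ennreal (1 + d / 2) * ennreal (1 - d) \<le> ennreal (1 - d / 2)"
      using d by (subst ennreal_mult[symmetric]) (auto intro!: ennreal_leI simp del: ennreal_plus)
    then show ?thesis unfolding mult.assoc[symmetric] by (intro add_right_mono mult_right_mono) auto
  qed
  finally have "mean_energy \<mu> ?sF + ennreal (1 + 2 / d) * mean_energy \<mu> F
    \<le> (ennreal (1 - d / 2) * mean_energy \<mu> F + ennreal (1 + 2 / d) * energy \<mu> G) + ennreal (1 + 2 / d) * mean_energy \<mu> F"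
    by (rule add_right_mono)
  also have "\<dots> = ennreal (1 - d / 2) * mean_energy \<mu> F + ennreal (1 + 2 / d) * energy \<mu> F"
    unfolding fluct[symmetric] by (simp add: distrib_left add.assoc)
  finally show ?thesis .
qed

section \<open>Contraction over two steps\<close>

lemma
  fixes F :: "'x \<Rightarrow> real^'n \<Rightarrow> real"
  assumes F: "unit_valued X F" and mc: "markov_chain P X k \<xi>" and n: "n \<ge> 1"
  shows kernel_avg_nn_integral: "x \<in> space X \<Longrightarrow> ennreal (kernel_avg (k n) F x v) = (\<integral>\<^sup>+y. ennreal (F y v) \<partial>k n x)"
    and unit_valued_kernel_avg: "unit_valued X (kernel_avg (k n) F)"
proof -
  have kn: "k n \<in> X \<rightarrow>\<^sub>M subprob_algebra X" by (rule measurable_prob_algebraD[OF markov_kernel[OF mc n]])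
  have ks: "sets (k n x) = sets X" "prob_space (k n x)" if "x \<in> space X" for x
    using measurable_space[OF markov_kernel[OF mc n] that] by (auto simp: space_prob_algebra)
  have nn: "0 \<le> kernel_avg (k n) F x v" "kernel_avg (k n) F x v \<le> 1" if "x \<in> space X" for x v
    using unit_valued_mean(2,3)[OF F ks(2,1)[OF that]] by (auto simp: kernel_avg_def kernel_op_def)
  show eq: "ennreal (kernel_avg (k n) F x v) = (\<integral>\<^sup>+y. ennreal (F y v) \<partial>k n x)" if x: "x \<in> space X" for x v
    unfolding kernel_avg_def kernel_op_def
  proof (rule nn_integral_eq_integral[symmetric])
    show "integrable (k n x) (\<lambda>y. F y v)" by (rule unit_valued_integrable[OF F ks(2,1)[OF x]])
    show "AE y in k n x. 0 \<le> F y v"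
      using unit_valued_bounds(1)[OF F] sets_eq_imp_space_eq[OF ks(1)[OF x]] by (intro AE_I2) auto
  qed
  have m: "(\<lambda>p. \<integral>\<^sup>+y. ennreal (F y (snd p)) \<partial>k n (fst p)) \<in> borel_measurable (X \<Otimes>\<^sub>M (borel :: (real^'n) measure))"
  proof (rule nn_integral_measurable_subprob_algebra2)
    show "(\<lambda>p. k n (fst p)) \<in> X \<Otimes>\<^sub>M borel \<rightarrow>\<^sub>M subprob_algebra X"
      using measurable_compose[OF measurable_fst kn] .
    have "(\<lambda>q. (snd q, snd (fst q))) \<in> (X \<Otimes>\<^sub>M (borel :: (real^'n) measure)) \<Otimes>\<^sub>M X \<rightarrow>\<^sub>M X \<Otimes>\<^sub>M borel" by measurable
    from measurable_compose[OF this unit_valued_measurable(1)[OF F]]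
    show "(\<lambda>(p, y). ennreal (F y (snd p))) \<in> borel_measurable ((X \<Otimes>\<^sub>M borel) \<Otimes>\<^sub>M X)"
      by (simp add: case_prod_unfold)
  qed
  have "(\<lambda>p. enn2real (\<integral>\<^sup>+y. ennreal (F y (snd p)) \<partial>k n (fst p))) \<in> borel_measurable (X \<Otimes>\<^sub>M (borel :: (real^'n) measure))"
    using m by (rule borel_measurable_enn2real)
  moreover have "enn2real (\<integral>\<^sup>+y. ennreal (F y (snd p)) \<partial>k n (fst p)) = kernel_avg (k n) F (fst p) (snd p)"
    if "p \<in> space (X \<Otimes>\<^sub>M (borel :: (real^'n) measure))" for p
  proof -
    have "fst p \<in> space X" using that by (auto simp: space_pair_measure)
    then show ?thesis by (simp add: eq[symmetric] nn)
  qed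
  ultimately have "(\<lambda>p. kernel_avg (k n) F (fst p) (snd p)) \<in> borel_measurable (X \<Otimes>\<^sub>M borel)"
    by (simp cong: measurable_cong)
  then show "unit_valued X (kernel_avg (k n) F)"
    using nn by (simp add: unit_valued_def case_prod_unfold)
qed

lemma
  fixes F :: "'x \<Rightarrow> real^'n \<Rightarrow> real"
  assumes F: "unit_valued X F" and mc: "markov_chain P X k \<xi>" and n: "n \<ge> 1" and c: "0 \<le> c" "c \<le> 1"
    and op: "op_norm0 (distr P X (\<xi> (Suc n))) (distr P X (\<xi> n)) (kernel_op (k n)) \<le> ereal c"
  shows mean_energy_kernel_avg: "mean_energy (distr P X (\<xi> n)) (kernel_avg (k n) F) = mean_energy (distr P X (\<xi> (Suc n))) F"
    and energy_kernel_avg: "energy (distr P X (\<xi> n)) (kernel_avg (k n) F)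
      \<le> ennreal (c\<^sup>2) * energy (distr P X (\<xi> (Suc n))) F + ennreal (1 - c\<^sup>2) * mean_energy (distr P X (\<xi> (Suc n))) F"
proof -
  interpret P: prob_space P by (rule markov_prob_space[OF mc])
  have \<mu>: "prob_space (distr P X (\<xi> n))" "prob_space (distr P X (\<xi> (Suc n)))"
    using markov_meas[OF mc] n by (auto intro!: P.prob_space_distr)
  have c2: "0 \<le> 1 - c\<^sup>2" using c by (simp add: power_le_one)
  note KF = unit_valued_kernel_avg[OF F mc n]
  note sq = kernel_square_bound[OF mc n c(1) op unit_valued_measurable(2)[OF F] conjI[OF unit_valued_bounds(1,2)[OF F]]]
  show "mean_energy (distr P X (\<xi> n)) (kernel_avg (k n) F) = mean_energy (distr P X (\<xi> (Suc n))) F"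
    unfolding mean_energy_def kernel_avg_def by (simp add: sq(1))
  have [measurable]: "(\<lambda>v. \<integral>x. (F x v)\<^sup>2 \<partial>distr P X (\<xi> (Suc n))) \<in> borel_measurable borel"
    "(\<lambda>v. \<integral>x. F x v \<partial>distr P X (\<xi> (Suc n))) \<in> borel_measurable borel"
    using unit_valued_mean(1)[OF unit_valued_square[OF F] \<mu>(2)] unit_valued_mean(1)[OF F \<mu>(2)] by auto
  have "energy (distr P X (\<xi> n)) (kernel_avg (k n) F)
      = (\<integral>\<^sup>+v. ennreal (\<integral>x. (kernel_op (k n) (\<lambda>y. F y v) x)\<^sup>2 \<partial>distr P X (\<xi> n)) \<partial>lborel)"
    by (subst energy_eq[OF KF \<mu>(1)]) (simp_all add: kernel_avg_def)
  also have "\<dots> \<le> (\<integral>\<^sup>+v. ennreal (c\<^sup>2) * ennreal (\<integral>x. (F x v)\<^sup>2 \<partial>distr P X (\<xi> (Suc n)))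
      + ennreal (1 - c\<^sup>2) * ennreal ((\<integral>x. F x v \<partial>distr P X (\<xi> (Suc n)))\<^sup>2) \<partial>lborel)"
  proof (rule nn_integral_mono)
    fix v
    have "ennreal (\<integral>x. (kernel_op (k n) (\<lambda>y. F y v) x)\<^sup>2 \<partial>distr P X (\<xi> n))
        \<le> ennreal (c\<^sup>2 * (\<integral>x. (F x v)\<^sup>2 \<partial>distr P X (\<xi> (Suc n))) + (1 - c\<^sup>2) * (\<integral>x. F x v \<partial>distr P X (\<xi> (Suc n)))\<^sup>2)"
      by (rule ennreal_leI) (rule sq(2))
    also have "\<dots> = ennreal (c\<^sup>2) * ennreal (\<integral>x. (F x v)\<^sup>2 \<partial>distr P X (\<xi> (Suc n)))
      + ennreal (1 - c\<^sup>2) * ennreal ((\<integral>x. F x v \<partial>distr P X (\<xi> (Suc n)))\<^sup>2)"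
      using c2 by (subst ennreal_plus) (auto simp: ennreal_mult')
    finally show "ennreal (\<integral>x. (kernel_op (k n) (\<lambda>y. F y v) x)\<^sup>2 \<partial>distr P X (\<xi> n)) \<le> \<dots>" .
  qed
  also have "\<dots> = ennreal (c\<^sup>2) * energy (distr P X (\<xi> (Suc n))) F + ennreal (1 - c\<^sup>2) * mean_energy (distr P X (\<xi> (Suc n))) F"
    by (subst nn_integral_add) (auto simp: nn_integral_cmult energy_eq[OF F \<mu>(2)] mean_energy_def)
  finally show "energy (distr P X (\<xi> n)) (kernel_avg (k n) F)
      \<le> ennreal (c\<^sup>2) * energy (distr P X (\<xi> (Suc n))) F + ennreal (1 - c\<^sup>2) * mean_energy (distr P X (\<xi> (Suc n))) F" .
qed

definition two_step_rate :: "real \<Rightarrow> real \<Rightarrow> real" where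
  "two_step_rate c d = (1 + 2 / d) / (1 + 2 / d + (1 - c\<^sup>2) * d / 2)"

lemma two_step_rate_bounds:
  assumes "0 \<le> c" "c < 1" "0 < d"
  shows "0 < two_step_rate c d" "two_step_rate c d < 1"
proof -
  have "c\<^sup>2 < 1" using assms by (simp add: power_less_one_iff abs_square_less_1)
  then have "0 < (1 - c\<^sup>2) * d / 2" "0 < 1 + 2 / d" using assms by (auto simp: add_pos_pos)
  then show "0 < two_step_rate c d" "two_step_rate c d < 1" by (auto simp: two_step_rate_def)
qed

text \<open>\<open>A2\<close>, \<open>A1\<close>, \<open>A0\<close> are the energies before the first kernel and after the first and the second one; \<open>b\<close> and
  \<open>b'\<close> are the mean energies before and after the random matrix in between.  A large fluctuation \<open>A1 - b\<close>
  comes from a still larger one that the first kernel has shrunk, and is therefore at most a multiple of the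
  loss \<open>A2 - A1\<close>; if instead it is small, \<open>b'\<close> is small by the gap, and the second kernel loses energy.\<close>

lemma two_step_arithmetic:
  fixes A0 A1 A2 b b' :: real
  assumes c: "0 \<le> c" "c < 1" and d: "0 < d" "d \<le> 1 / 2"
    and A1: "A1 \<le> c\<^sup>2 * A2 + (1 - c\<^sup>2) * b" and A0: "A0 \<le> c\<^sup>2 * A1 + (1 - c\<^sup>2) * b'"
    and b: "b \<le> A1" "b \<le> A2" "b' \<le> A1"
    and gap: "b' + (1 + 2 / d) * b \<le> (1 - d / 2) * b + (1 + 2 / d) * A1"
  shows "A0 \<le> two_step_rate c d * A2"
proof -
  define s where "s = c\<^sup>2"
  have s: "0 \<le> s" "s < 1" using c by (auto simp: s_def power_less_one_iff abs_square_less_1)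
  define L where "L = 1 + 2 / d"
  have L: "L \<ge> 1" using d by (simp add: L_def)
  define e where "e = (1 - s) * d / 2"
  have "0 < e" using s d by (simp add: e_def)
  have "(1 - s) * b \<le> (1 - s) * A2" using s b by (intro mult_left_mono) auto
  then have A12: "A1 \<le> A2" using A1 by (simp add: s_def[symmetric] algebra_simps)
  have "(1 - s) * b' \<le> (1 - s) * A1" using s b by (intro mult_left_mono) auto
  then have A01: "A0 \<le> A1" using A0 by (simp add: s_def[symmetric] algebra_simps)
  have fl: "(1 - s) * (A1 - b) \<le> s * (A2 - A1)" using A1 by (simp add: s_def[symmetric] algebra_simps)
  also have "\<dots> \<le> 1 * (A2 - A1)" using s A12 by (intro mult_right_mono) auto
  finally have fl: "(1 - s) * (A1 - b) \<le> A2 - A1" by simp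
  have "b' \<le> (1 - d / 2) * b + L * (A1 - b)" using gap[folded L_def] by (simp only: right_diff_distrib)
  also have "\<dots> \<le> (1 - d / 2) * A1 + L * (A1 - b)" using b d by (intro add_right_mono mult_left_mono) auto
  finally have "(1 - s) * b' \<le> (1 - s) * ((1 - d / 2) * A1 + L * (A1 - b))" using s by (intro mult_left_mono) auto
  also have "\<dots> = (1 - s) * (1 - d / 2) * A1 + L * ((1 - s) * (A1 - b))" by (simp add: algebra_simps)
  also have "\<dots> \<le> (1 - s) * (1 - d / 2) * A1 + L * (A2 - A1)" using fl L by (intro add_left_mono mult_left_mono) auto
  finally have "A0 \<le> (1 - e) * A1 + L * (A2 - A1)"
    using A0 by (simp add: s_def[symmetric] e_def algebra_simps)
  then have "A0 \<le> L * A2 - (L + e - 1) * A1" by (simp add: algebra_simps)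
  also have "(L + e - 1) * A0 \<le> (L + e - 1) * A1" using A01 L \<open>0 < e\<close> by (intro mult_left_mono) auto
  then have "L * A2 - (L + e - 1) * A1 \<le> L * A2 - (L + e - 1) * A0" by simp
  finally have "(L + e) * A0 \<le> L * A2" by (simp add: algebra_simps)
  then have "A0 \<le> L * A2 / (L + e)" using L \<open>0 < e\<close> by (simp add: field_simps)
  then show ?thesis by (simp add: two_step_rate_def L_def e_def s_def)
qed

text \<open>The spectral gap enters only through \<open>gap\<close>; here \<open>h n x\<close> stands for the product of \<open>a n\<close> and the
  random matrix at the state \<open>x\<close>.\<close>

locale gap_chain =
  fixes P :: "'w measure" and X :: "'x measure" and k \<xi> and h :: "nat \<Rightarrow> 'x \<Rightarrow> real^'n^'n" and c d :: real
  assumes mc: "markov_chain P X k \<xi>"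
    and h_meas: "\<And>n. n \<ge> 1 \<Longrightarrow> h n \<in> borel_measurable X"
    and h_SL: "\<And>n x. n \<ge> 1 \<Longrightarrow> x \<in> space X \<Longrightarrow> h n x \<in> SL"
    and c: "0 \<le> c" "c < 1"
    and op: "\<And>n. n \<ge> 1 \<Longrightarrow> op_norm0 (distr P X (\<xi> (Suc n))) (distr P X (\<xi> n)) (kernel_op (k n)) \<le> ereal c"
    and d: "0 < d" "d \<le> 1 / 2"
    and gap: "\<And>n (f :: real^'n \<Rightarrow> real). n \<ge> 1 \<Longrightarrow> f \<in> borel_measurable borel \<Longrightarrow> (\<And>v. 0 \<le> f v \<and> f v \<le> 1) \<Longrightarrow>
      (\<integral>\<^sup>+v. ennreal ((f v)\<^sup>2) \<partial>lborel) < \<infinity> \<Longrightarrow>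
      (\<integral>\<^sup>+v. ennreal ((\<integral>x. f (h n x *v v) \<partial>distr P X (\<xi> n))\<^sup>2) \<partial>lborel) \<le> ennreal (1 - d) * (\<integral>\<^sup>+v. ennreal ((f v)\<^sup>2) \<partial>lborel)"
begin

sublocale P: prob_space P by (rule markov_prob_space[OF mc])

abbreviation "\<mu> n \<equiv> distr P X (\<xi> n)"

lemma \<mu>_prob: "n \<ge> 1 \<Longrightarrow> prob_space (\<mu> n)"
  using markov_meas[OF mc] by (auto intro!: P.prob_space_distr)

text \<open>\<open>backward r j x v\<close> is the conditional probability, given that the chain is at \<open>x\<close> at time \<open>j\<close>, that the
  next \<open>r\<close> matrices move \<open>v\<close> into the unit ball.\<close>

primrec backward :: "nat \<Rightarrow> nat \<Rightarrow> 'x \<Rightarrow> real^'n \<Rightarrow> real" where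
  "backward 0 j = (\<lambda>x v. indicator (cball 0 1) v)"
| "backward (Suc r) j = kernel_avg (k j) (shift (h (Suc j)) (backward r (Suc j)))"

lemma backward_unit_valued: "j \<ge> 1 \<Longrightarrow> unit_valued X (backward r j)"
proof (induction r arbitrary: j)
  case 0
  have [measurable]: "cball 0 1 \<in> sets (borel :: (real^'n) measure)" by simp
  show ?case by (simp add: unit_valued_def case_prod_unfold indicator_def)
next
  case (Suc r)
  then show ?case using h_meas by (auto intro!: unit_valued_kernel_avg[OF _ mc] unit_valued_shift)
qed

lemma kernel_avg_energy_le:
  assumes "j \<ge> 1" "unit_valued X F"
  shows "energy (\<mu> j) (kernel_avg (k j) F) \<le> energy (\<mu> (Suc j)) (F :: 'x \<Rightarrow> real^'n \<Rightarrow> real)"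
proof -
  have "c\<^sup>2 \<le> 1" using c by (simp add: power_le_one)
  have "energy (\<mu> j) (kernel_avg (k j) F) \<le> ennreal (c\<^sup>2) * energy (\<mu> (Suc j)) F + ennreal (1 - c\<^sup>2) * mean_energy (\<mu> (Suc j)) F"
    using assms c op by (intro energy_kernel_avg[OF _ mc]) auto
  also have "\<dots> \<le> ennreal (c\<^sup>2) * energy (\<mu> (Suc j)) F + ennreal (1 - c\<^sup>2) * energy (\<mu> (Suc j)) F"
    using assms \<mu>_prob[of "Suc j"] by (intro add_left_mono mult_left_mono mean_energy_le) auto
  also have "\<dots> = (ennreal (c\<^sup>2) + ennreal (1 - c\<^sup>2)) * energy (\<mu> (Suc j)) F" by (simp add: distrib_right)
  also have "ennreal (c\<^sup>2) + ennreal (1 - c\<^sup>2) = 1" using \<open>c\<^sup>2 \<le> 1\<close> by (subst ennreal_plus[symmetric]) auto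
  finally show ?thesis by simp
qed

lemma two_step_contraction:
  fixes V :: "'x \<Rightarrow> real^'n \<Rightarrow> real"
  assumes j: "j \<ge> 1" and V: "unit_valued X V" and fin: "energy (\<mu> (Suc (Suc j))) V < \<infinity>"
  shows "energy (\<mu> j) (kernel_avg (k j) (shift (h (Suc j)) (kernel_avg (k (Suc j)) V)))
    \<le> ennreal (two_step_rate c d) * energy (\<mu> (Suc (Suc j))) V"
proof -
  define W where "W = kernel_avg (k (Suc j)) V"
  have W: "unit_valued X W" unfolding W_def using V by (intro unit_valued_kernel_avg[OF _ mc]) auto
  have sW: "unit_valued X (shift (h (Suc j)) W)" using W h_meas by (intro unit_valued_shift) auto
  define A2 where "A2 = energy (\<mu> (Suc (Suc j))) V"
  define b where "b = mean_energy (\<mu> (Suc j)) W"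
  define A1 where "A1 = energy (\<mu> (Suc j)) W"
  define b' where "b' = mean_energy (\<mu> (Suc j)) (shift (h (Suc j)) W)"
  define A0 where "A0 = energy (\<mu> j) (kernel_avg (k j) (shift (h (Suc j)) W))"
  have b_eq: "b = mean_energy (\<mu> (Suc (Suc j))) V"
    unfolding b_def W_def using V c op by (intro mean_energy_kernel_avg[OF _ mc]) auto
  have sh: "energy (\<mu> (Suc j)) (shift (h (Suc j)) W) = A1"
    unfolding A1_def using W h_meas h_SL \<mu>_prob[of "Suc j"] by (intro energy_shift) auto
  have ineqs: "A1 \<le> ennreal (c\<^sup>2) * A2 + ennreal (1 - c\<^sup>2) * b" "A0 \<le> ennreal (c\<^sup>2) * A1 + ennreal (1 - c\<^sup>2) * b'"
    "b \<le> A1" "b \<le> A2" "b' \<le> A1"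
  proof -
    show "A1 \<le> ennreal (c\<^sup>2) * A2 + ennreal (1 - c\<^sup>2) * b"
      unfolding A1_def A2_def b_eq W_def using V c op by (intro energy_kernel_avg[OF _ mc]) auto
    show "A0 \<le> ennreal (c\<^sup>2) * A1 + ennreal (1 - c\<^sup>2) * b'"
      unfolding A0_def sh[symmetric] b'_def using sW c op j by (intro energy_kernel_avg[OF _ mc]) auto
    show "b \<le> A1" unfolding b_def A1_def using W \<mu>_prob[of "Suc j"] by (intro mean_energy_le) auto
    show "b \<le> A2" unfolding b_eq A2_def using V \<mu>_prob[of "Suc (Suc j)"] by (intro mean_energy_le) auto
    show "b' \<le> A1" unfolding b'_def sh[symmetric] using sW \<mu>_prob[of "Suc j"] by (intro mean_energy_le) auto
  qed
  have "A1 \<le> A2" unfolding A1_def A2_def W_def using V by (intro kernel_avg_energy_le) auto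
  then have finA1: "A1 < \<infinity>" using fin by (simp add: A2_def)
  have "A0 \<le> A1" unfolding A0_def sh[symmetric] using sW j by (intro kernel_avg_energy_le) auto
  have g: "b' + ennreal (1 + 2 / d) * b \<le> ennreal (1 - d / 2) * b + ennreal (1 + 2 / d) * A1"
    unfolding b'_def b_def A1_def
    using W h_meas h_SL \<mu>_prob[of "Suc j"] finA1 gap[of "Suc j"] d by (intro mean_energy_shift) (auto simp: A1_def)
  obtain rA2 where rA2: "A2 = ennreal rA2" "rA2 \<ge> 0" using fin unfolding A2_def by (metis enn2real_nonneg ennreal_enn2real infinity_ennreal_def)
  obtain rA1 where rA1: "A1 = ennreal rA1" "rA1 \<ge> 0" using finA1 by (metis enn2real_nonneg ennreal_enn2real infinity_ennreal_def)
  have "A0 < \<infinity>" "b < \<infinity>" "b' < \<infinity>" using \<open>A0 \<le> A1\<close> ineqs(3,5) finA1 by auto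
  then obtain rA0 rb rb' where r: "A0 = ennreal rA0" "rA0 \<ge> 0" "b = ennreal rb" "rb \<ge> 0" "b' = ennreal rb'" "rb' \<ge> 0"
    by (metis enn2real_nonneg ennreal_enn2real infinity_ennreal_def)
  have c2: "0 \<le> 1 - c\<^sup>2" using c by (simp add: power_le_one)
  have d2: "0 \<le> 1 - d / 2" "0 \<le> 1 + 2 / d" using d by auto
  have conv: "ennreal x * ennreal y + ennreal z * ennreal w = ennreal (x * y + z * w)"
    if "0 \<le> x" "0 \<le> y" "0 \<le> z" "0 \<le> w" for x y z w
    using that by (simp add: ennreal_plus ennreal_mult)
  have conv1: "ennreal y + ennreal z * ennreal w = ennreal (y + z * w)"
    if "0 \<le> y" "0 \<le> z" "0 \<le> w" for y z w
    using that by (simp add: ennreal_plus ennreal_mult)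
  have "rA0 \<le> two_step_rate c d * rA2"
  proof (rule two_step_arithmetic[OF c d])
    show "rA1 \<le> c\<^sup>2 * rA2 + (1 - c\<^sup>2) * rb"
      using ineqs(1) r rA1 rA2 c2 by (simp add: conv del: ennreal_plus)
    show "rA0 \<le> c\<^sup>2 * rA1 + (1 - c\<^sup>2) * rb'"
      using ineqs(2) r rA1 rA2 c2 by (simp add: conv del: ennreal_plus)
    show "rb \<le> rA1" "rb \<le> rA2" "rb' \<le> rA1" using ineqs(3-5) r rA1 rA2 by auto
    show "rb' + (1 + 2 / d) * rb \<le> (1 - d / 2) * rb + (1 + 2 / d) * rA1"
      using g r rA1 rA2 d2 by (simp add: conv conv1 del: ennreal_plus)
  qed
  then have "A0 \<le> ennreal (two_step_rate c d * rA2)" unfolding r(1) by (rule ennreal_leI)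
  also have "\<dots> = ennreal (two_step_rate c d) * A2"
    unfolding rA2(1) using rA2 two_step_rate_bounds[OF c d(1)] by (intro ennreal_mult) auto
  finally show ?thesis by (simp add: A0_def A2_def W_def)
qed

text \<open>Each pair of steps gains one factor; a single step does not increase the energy.\<close>

lemma backward_energy:
  "j \<ge> 1 \<Longrightarrow> energy (\<mu> j) (backward r j) \<le> ennreal (two_step_rate c d ^ (r div 2)) * emeasure lborel (cball 0 1 :: (real^'n) set)"
proof (induction r arbitrary: j rule: induct_nat_012)
  case (0 j)
  interpret \<mu>: prob_space "\<mu> j" by (rule \<mu>_prob[OF 0])
  have "energy (\<mu> j) (backward 0 j) = (\<integral>\<^sup>+v. indicator (cball 0 1 :: (real^'n) set) v \<partial>lborel)"
    unfolding energy_def by (intro nn_integral_cong) (auto simp: indicator_def \<mu>.emeasure_space_1[simplified])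
  then show ?case by simp
next
  case (1 j)
  interpret \<mu>: prob_space "\<mu> (Suc j)" by (rule \<mu>_prob) simp
  have "energy (\<mu> j) (backward (Suc 0) j) \<le> energy (\<mu> (Suc j)) (shift (h (Suc j)) (backward 0 (Suc j)))"
    using 1 backward_unit_valued[of "Suc j" 0] h_meas by (auto intro!: kernel_avg_energy_le unit_valued_shift simp del: backward.simps(1))
  also have "\<dots> = energy (\<mu> (Suc j)) (backward 0 (Suc j))"
    using backward_unit_valued[of "Suc j" 0] h_meas h_SL \<mu>_prob[of "Suc j"] by (intro energy_shift) auto
  also have "\<dots> = (\<integral>\<^sup>+v. indicator (cball 0 1 :: (real^'n) set) v \<partial>lborel)"
    unfolding energy_def by (intro nn_integral_cong) (auto simp: indicator_def \<mu>.emeasure_space_1[simplified])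
  finally show ?case by simp
next
  case (ge2 r j)
  let ?V = "shift (h (Suc (Suc j))) (backward r (Suc (Suc j)))"
  have V: "unit_valued X ?V" using backward_unit_valued[of "Suc (Suc j)" r] h_meas by (auto intro!: unit_valued_shift)
  have "energy (\<mu> (Suc (Suc j))) ?V = energy (\<mu> (Suc (Suc j))) (backward r (Suc (Suc j)))"
    using backward_unit_valued[of "Suc (Suc j)" r] h_meas h_SL \<mu>_prob[of "Suc (Suc j)"] by (intro energy_shift) auto
  also have "\<dots> \<le> ennreal (two_step_rate c d ^ (r div 2)) * emeasure lborel (cball 0 1 :: (real^'n) set)"
    by (rule ge2(1)) simp
  finally have EV: "energy (\<mu> (Suc (Suc j))) ?V \<le> ennreal (two_step_rate c d ^ (r div 2)) * emeasure lborel (cball 0 1 :: (real^'n) set)" .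
  also have "\<dots> < \<infinity>" using emeasure_lborel_cball_finite[of "0 :: real^'n" 1] by (simp add: ennreal_mult_less_top)
  finally have "energy (\<mu> j) (backward (Suc (Suc r)) j) \<le> ennreal (two_step_rate c d) * energy (\<mu> (Suc (Suc j))) ?V"
    using two_step_contraction[OF ge2(3) V] by simp
  also have "\<dots> \<le> ennreal (two_step_rate c d) * (ennreal (two_step_rate c d ^ (r div 2)) * emeasure lborel (cball 0 1 :: (real^'n) set))"
    using EV by (rule mult_left_mono) simp
  also have "\<dots> = ennreal (two_step_rate c d ^ (Suc (Suc r) div 2)) * emeasure lborel (cball 0 1 :: (real^'n) set)"
    using two_step_rate_bounds[OF c d(1)] by (simp add: ennreal_mult mult.assoc)
  finally show ?case .
qed

end

section \<open>Growth of the products\<close>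

lemma borel_measurable_mat_mat [measurable (raw)]:
  fixes f :: "'a \<Rightarrow> real^'n^'m" and g :: "'a \<Rightarrow> real^'k^'n"
  assumes "f \<in> borel_measurable N" "g \<in> borel_measurable N"
  shows "(\<lambda>x. f x ** g x) \<in> borel_measurable N"
  using assms by (rule borel_measurable_continuous_Pair)
    (unfold matrix_matrix_mult_def, intro continuous_intros)

text \<open>The norm of the type of matrices is continuous, hence measurable, and equivalent to the operator
  norm.\<close>

lemma
  fixes A :: "real^'n^'n"
  shows norm_le_mat_norm: "norm A \<le> real CARD('n) ^ 2 * mat_norm A"
    and norm_matrix_vector_le: "norm (A *v v) \<le> real CARD('n) ^ 2 * norm A * norm v"
proof -
  have "norm A \<le> (\<Sum>i\<in>UNIV. norm (A $ i))" unfolding norm_vec_def by (rule L2_set_le_sum) simp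
  also have "\<dots> \<le> (\<Sum>i\<in>UNIV. \<Sum>j\<in>UNIV. \<bar>A $ i $ j\<bar>)" by (intro sum_mono norm_le_l1_cart)
  also have "\<dots> \<le> (\<Sum>i\<in>(UNIV :: 'n set). \<Sum>j\<in>(UNIV :: 'n set). mat_norm A)"
    unfolding mat_norm_def by (intro sum_mono matrix_component_le_onorm)
  finally show "norm A \<le> real CARD('n) ^ 2 * mat_norm A" by (simp add: power2_eq_square)
  have "\<bar>A $ i $ j\<bar> \<le> norm A" for i j
    using component_le_norm_cart[of "A $ i" j] Finite_Cartesian_Product.norm_nth_le[where x=A and i=i] by linarith
  then have "onorm ((*v) A) \<le> real CARD('n) * real CARD('n) * norm A" by (rule onorm_le_matrix_component)
  moreover have "norm (A *v v) \<le> onorm ((*v) A) * norm v" by (intro onorm matrix_vector_mul_bounded_linear)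
  ultimately show "norm (A *v v) \<le> real CARD('n) ^ 2 * norm A * norm v"
    unfolding power2_eq_square by (meson mult_right_mono norm_ge_zero order_trans)
qed

context gap_chain
begin

primrec S :: "nat \<Rightarrow> 'w \<Rightarrow> real^'n^'n" where
  "S 0 = (\<lambda>\<omega>. mat 1)"
| "S (Suc n) = (\<lambda>\<omega>. h (Suc n) (\<xi> (Suc n) \<omega>) ** S n \<omega>)"

lemma S_measurable_filtration: "j \<le> n \<Longrightarrow> S j \<in> borel_measurable (natural_filtration P X \<xi> n)"
proof (induction j)
  case (Suc j)
  have "(\<lambda>\<omega>. h (Suc j) (\<xi> (Suc j) \<omega>)) \<in> borel_measurable (natural_filtration P X \<xi> n)"
    using measurable_compose[OF natural_filtration_measurable[OF mc, of "Suc j" n] h_meas] Suc by simp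
  then show ?case using Suc by simp
qed simp

lemma S_measurable: "S n \<in> borel_measurable P"
  using measurable_from_subalg[OF natural_filtration_subalgebra[OF mc] S_measurable_filtration[OF order_refl]] .

lemma backward_representation:
  "j \<ge> 1 \<Longrightarrow> (\<integral>\<^sup>+\<omega>. indicator (cball 0 1) (S (j + r) \<omega> *v v) \<partial>P) = (\<integral>\<^sup>+\<omega>. ennreal (backward r j (\<xi> j \<omega>) (S j \<omega> *v v)) \<partial>P)"
proof (induction r arbitrary: j)
  case 0
  show ?case by (intro nn_integral_cong) (auto simp: indicator_def)
next
  case (Suc r)
  let ?V = "shift (h (Suc j)) (backward r (Suc j))"
  have V: "unit_valued X ?V" using backward_unit_valued[of "Suc j" r] h_meas by (auto intro!: unit_valued_shift)
  have "(\<integral>\<^sup>+\<omega>. indicator (cball 0 1) (S (j + Suc r) \<omega> *v v) \<partial>P) = (\<integral>\<^sup>+\<omega>. ennreal (backward r (Suc j) (\<xi> (Suc j) \<omega>) (S (Suc j) \<omega> *v v)) \<partial>P)"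
    using Suc.IH[of "Suc j"] by simp
  also have "\<dots> = (\<integral>\<^sup>+\<omega>. ennreal (?V (snd (S j \<omega> *v v, \<xi> (Suc j) \<omega>)) (fst (S j \<omega> *v v, \<xi> (Suc j) \<omega>))) \<partial>P)"
    by (simp add: shift_def matrix_vector_mul_assoc)
  also have "\<dots> = (\<integral>\<^sup>+\<omega>. \<integral>\<^sup>+y. ennreal (?V (snd (S j \<omega> *v v, y)) (fst (S j \<omega> *v v, y))) \<partial>k j (\<xi> j \<omega>) \<partial>P)"
  proof (rule markov_nn_integral[OF mc Suc.prems])
    show "(\<lambda>\<omega>. S j \<omega> *v v) \<in> borel_measurable (natural_filtration P X \<xi> j)"
      using S_measurable_filtration[OF order_refl] by simp
    have "(\<lambda>p. (snd p, fst p)) \<in> (borel :: (real^'n) measure) \<Otimes>\<^sub>M X \<rightarrow>\<^sub>M X \<Otimes>\<^sub>M borel" by measurable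
    from measurable_compose[OF this unit_valued_measurable(1)[OF V]]
    show "(\<lambda>p. ennreal (?V (snd p) (fst p))) \<in> borel_measurable ((borel :: (real^'n) measure) \<Otimes>\<^sub>M X)"
      by (simp add: case_prod_unfold)
  qed
  also have "\<dots> = (\<integral>\<^sup>+\<omega>. ennreal (backward (Suc r) j (\<xi> j \<omega>) (S j \<omega> *v v)) \<partial>P)"
  proof (rule nn_integral_cong)
    fix \<omega> assume "\<omega> \<in> space P"
    then have "\<xi> j \<omega> \<in> space X" using measurable_space[OF markov_meas[OF mc Suc.prems]] by blast
    then show "(\<integral>\<^sup>+y. ennreal (?V (snd (S j \<omega> *v v, y)) (fst (S j \<omega> *v v, y))) \<partial>k j (\<xi> j \<omega>)) = ennreal (backward (Suc r) j (\<xi> j \<omega>) (S j \<omega> *v v))"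
      using kernel_avg_nn_integral[OF V mc Suc.prems] by simp
  qed
  finally show ?case .
qed

lemma return_energy:
  assumes "n \<ge> 1"
  shows "(\<integral>\<^sup>+v. (\<integral>\<^sup>+\<omega>. indicator (cball 0 1) (S n \<omega> *v v) \<partial>P)\<^sup>2 \<partial>lborel)
    \<le> ennreal (two_step_rate c d ^ ((n - 1) div 2)) * emeasure lborel (cball 0 1 :: (real^'n) set)"
proof -
  let ?W = "backward (n - 1) 1"
  let ?V = "shift (h 1) ?W"
  have W: "unit_valued X ?W" by (rule backward_unit_valued) simp
  have V: "unit_valued X ?V" using W h_meas by (auto intro!: unit_valued_shift)
  have \<mu>1: "prob_space (\<mu> 1)" by (rule \<mu>_prob) simp
  have "(\<integral>\<^sup>+\<omega>. indicator (cball 0 1) (S n \<omega> *v v) \<partial>P) = ennreal (\<integral>x. ?V x v \<partial>\<mu> 1)" for v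
  proof -
    have "(\<integral>\<^sup>+\<omega>. indicator (cball 0 1) (S n \<omega> *v v) \<partial>P) = (\<integral>\<^sup>+\<omega>. ennreal (?W (\<xi> 1 \<omega>) (S 1 \<omega> *v v)) \<partial>P)"
      using backward_representation[of 1 "n - 1" v] assms by simp
    also have "\<dots> = (\<integral>\<^sup>+\<omega>. ennreal (?V (\<xi> 1 \<omega>) v) \<partial>P)" by (simp add: shift_def)
    also have "\<dots> = (\<integral>\<^sup>+x. ennreal (?V x v) \<partial>\<mu> 1)"
      using markov_meas[OF mc, of 1] unit_valued_measurable(2)[OF V] by (subst nn_integral_distr) auto
    also have "\<dots> = ennreal (\<integral>x. ?V x v \<partial>\<mu> 1)"
      using unit_valued_integrable(1)[OF V \<mu>1] unit_valued_bounds(1)[OF V] by (intro nn_integral_eq_integral AE_I2) auto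
    finally show ?thesis .
  qed
  moreover have "(ennreal (\<integral>x. ?V x v \<partial>\<mu> 1))\<^sup>2 = ennreal ((\<integral>x. ?V x v \<partial>\<mu> 1)\<^sup>2)" for v
    using unit_valued_mean(2)[OF V \<mu>1] by (intro ennreal_power) simp
  ultimately have "(\<integral>\<^sup>+v. (\<integral>\<^sup>+\<omega>. indicator (cball 0 1) (S n \<omega> *v v) \<partial>P)\<^sup>2 \<partial>lborel) = mean_energy (\<mu> 1) ?V"
    by (simp add: mean_energy_def)
  also have "\<dots> \<le> energy (\<mu> 1) ?V" using V \<mu>1 by (intro mean_energy_le) auto
  also have "\<dots> = energy (\<mu> 1) ?W" using W h_meas h_SL \<mu>1 by (intro energy_shift) auto
  also have "\<dots> \<le> ennreal (two_step_rate c d ^ ((n - 1) div 2)) * emeasure lborel (cball 0 1 :: (real^'n) set)"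
    by (rule backward_energy) simp
  finally show ?thesis .
qed

text \<open>On the event in question the ball of radius \<open>s\<close> is mapped into the unit ball, so its volume times
  the square of the probability is bounded by \<open>return_energy\<close>.\<close>

lemma small_norm_probability:
  assumes n: "n \<ge> 1" and R: "R > 0"
  shows "(measure P {\<omega> \<in> space P. norm (S n \<omega>) \<le> R})\<^sup>2
    \<le> (real CARD('n) ^ 2 * R) ^ CARD('n) * two_step_rate c d ^ ((n - 1) div 2)"
proof -
  define E where "E = {\<omega> \<in> space P. norm (S n \<omega>) \<le> R}"
  note [measurable] = S_measurable
  have [measurable]: "E \<in> sets P" unfolding E_def by measurable
  define p where "p = measure P E"
  define s where "s = 1 / (real CARD('n) ^ 2 * R)"
  have "s > 0" using R by (simp add: s_def)
  let ?u = "unit_ball_vol (real CARD('n))"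
  define \<rho> where "\<rho> = two_step_rate c d ^ ((n - 1) div 2)"
  have "\<rho> \<ge> 0" using two_step_rate_bounds[OF c d(1)] by (simp add: \<rho>_def)
  have "ennreal (p\<^sup>2) * indicator (cball 0 s) v \<le> (\<integral>\<^sup>+\<omega>. indicator (cball 0 1) (S n \<omega> *v v) \<partial>P)\<^sup>2" for v
  proof (cases "v \<in> cball 0 s")
    case True
    have "indicator E \<omega> \<le> (indicator (cball 0 1) (S n \<omega> *v v) :: ennreal)" for \<omega>
    proof (cases "\<omega> \<in> E")
      case \<omega>: True
      have "norm (S n \<omega> *v v) \<le> real CARD('n) ^ 2 * norm (S n \<omega>) * norm v" by (rule norm_matrix_vector_le)
      also have "\<dots> \<le> real CARD('n) ^ 2 * R * s" using \<omega> True R by (intro mult_mono) (auto simp: E_def)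
      also have "\<dots> = 1" using R by (simp add: s_def)
      finally show ?thesis using \<omega> by simp
    qed simp
    then have "(\<integral>\<^sup>+\<omega>. indicator E \<omega> \<partial>P) \<le> (\<integral>\<^sup>+\<omega>. indicator (cball 0 1) (S n \<omega> *v v) \<partial>P)" by (intro nn_integral_mono)
    then have "ennreal p \<le> (\<integral>\<^sup>+\<omega>. indicator (cball 0 1) (S n \<omega> *v v) \<partial>P)" by (simp add: p_def P.emeasure_eq_measure)
    then have "(ennreal p)\<^sup>2 \<le> (\<integral>\<^sup>+\<omega>. indicator (cball 0 1) (S n \<omega> *v v) \<partial>P)\<^sup>2" by (rule power_mono) simp
    then show ?thesis using True by (simp add: ennreal_power p_def)
  qed simp
  then have "(\<integral>\<^sup>+v. ennreal (p\<^sup>2) * indicator (cball 0 s :: (real^'n) set) v \<partial>lborel)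
      \<le> (\<integral>\<^sup>+v. (\<integral>\<^sup>+\<omega>. indicator (cball 0 1) (S n \<omega> *v v) \<partial>P)\<^sup>2 \<partial>lborel)" by (intro nn_integral_mono)
  also have "\<dots> \<le> ennreal \<rho> * emeasure lborel (cball 0 1 :: (real^'n) set)"
    unfolding \<rho>_def by (rule return_energy[OF n])
  finally have "ennreal (p\<^sup>2) * emeasure lborel (cball 0 s :: (real^'n) set) \<le> ennreal \<rho> * emeasure lborel (cball 0 1 :: (real^'n) set)"
    by (simp add: nn_integral_cmult_indicator)
  then have "ennreal (p\<^sup>2 * (?u * s ^ CARD('n))) \<le> ennreal (\<rho> * ?u)"
    using \<open>s > 0\<close> \<open>\<rho> \<ge> 0\<close> by (simp add: emeasure_cball ennreal_mult)
  then have "p\<^sup>2 * (?u * s ^ CARD('n)) \<le> \<rho> * ?u"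
    using \<open>\<rho> \<ge> 0\<close> by (subst (asm) ennreal_le_iff) auto
  then have "p\<^sup>2 * s ^ CARD('n) \<le> \<rho>"
    using unit_ball_vol_pos[of "real CARD('n)"] by (simp add: mult.left_commute mult.commute)
  then have "p\<^sup>2 \<le> (1 / s) ^ CARD('n) * \<rho>"
    using \<open>s > 0\<close> by (simp add: power_one_over field_simps)
  then show ?thesis by (simp add: p_def E_def \<rho>_def s_def)
qed

lemma exponential_growth: "\<exists>l>0. AE \<omega> in P. eventually (\<lambda>n. mat_norm (S n \<omega>) > exp (l * real n)) sequentially"
proof -
  define m where "m = real CARD('n)"
  have m: "m \<ge> 1" by (simp add: m_def Suc_le_eq)
  define K where "K = m ^ 2"
  have K: "K > 0" using m by (simp add: K_def)
  define \<rho> where "\<rho> = two_step_rate c d"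
  have \<rho>: "0 < \<rho>" "\<rho> < 1" using two_step_rate_bounds[OF c d(1)] by (auto simp: \<rho>_def)
  define \<tau> where "\<tau> = - ln \<rho>"
  have \<tau>: "\<tau> > 0" using \<rho> by (simp add: \<tau>_def)
  \<comment> \<open>With this rate the volume factor \<open>exp (l m n)\<close> consumes only half of the decay \<open>exp (- \<tau> n / 2)\<close>.\<close>
  define l where "l = \<tau> / (4 * m)"
  have l: "l > 0" using \<tau> m by (simp add: l_def)
  note [measurable] = S_measurable
  define E where "E n = {\<omega> \<in> space P. norm (S n \<omega>) \<le> K * exp (l * real n)}" for n
  define C where "C = (K * K) ^ CARD('n) * exp \<tau>"
  have "C \<ge> 0" using K by (simp add: C_def)
  have bound: "measure P (E n) \<le> sqrt C * exp (- \<tau> / 8) ^ n" if n: "n \<ge> 1" for n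
  proof -
    have "(measure P (E n))\<^sup>2 \<le> (K * (K * exp (l * real n))) ^ CARD('n) * \<rho> ^ ((n - 1) div 2)"
      unfolding E_def K_def m_def \<rho>_def using m by (intro small_norm_probability n) (simp add: m_def)
    also have "(K * (K * exp (l * real n))) ^ CARD('n) = (K * K) ^ CARD('n) * exp (\<tau> * real n / 4)"
    proof -
      have "exp (l * real n) ^ CARD('n) = exp (\<tau> * real n / 4)"
        using m by (simp add: exp_of_nat_mult[symmetric] l_def m_def)
      then show ?thesis by (simp add: power_mult_distrib)
    qed
    also have "\<rho> ^ ((n - 1) div 2) = exp (- \<tau> * real ((n - 1) div 2))"
      using \<rho> by (simp add: \<tau>_def exp_of_nat2_mult)
    also have "(K * K) ^ CARD('n) * exp (\<tau> * real n / 4) * exp (- \<tau> * real ((n - 1) div 2)) \<le>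
        (K * K) ^ CARD('n) * exp (\<tau> * real n / 4) * exp (\<tau> - \<tau> * real n / 2)"
    proof (rule mult_left_mono)
      have "real n / 2 - 1 \<le> real ((n - 1) div 2)" using n by linarith
      then have "\<tau> * (real n / 2 - 1) \<le> \<tau> * real ((n - 1) div 2)" using \<tau> by (intro mult_left_mono) auto
      then show "exp (- \<tau> * real ((n - 1) div 2)) \<le> exp (\<tau> - \<tau> * real n / 2)" by (simp add: algebra_simps)
    qed (use K in auto)
    also have "\<dots> = C * exp (- \<tau> * real n / 4)"
      by (simp add: C_def mult.assoc exp_add[symmetric]) 
    also have "\<dots> = (sqrt C * exp (- \<tau> / 8) ^ n)\<^sup>2"
      using \<open>C \<ge> 0\<close> by (simp add: power_mult_distrib exp_of_nat_mult[symmetric])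
    finally show ?thesis by (rule power2_le_imp_le) (use \<open>C \<ge> 0\<close> in simp)
  qed
  have "summable (\<lambda>n. sqrt C * exp (- \<tau> / 8) ^ n)"
    using \<tau> by (intro summable_mult summable_geometric) simp
  then have "summable (\<lambda>n. measure P (E n))"
    by (rule summable_comparison_test'[of _ 1]) (use bound in simp)
  then have "AE \<omega> in P. eventually (\<lambda>n. \<omega> \<in> space P - E n) sequentially"
    by (intro borel_cantelli_AE1) (auto simp: E_def P.emeasure_eq_measure)
  then have "AE \<omega> in P. eventually (\<lambda>n. mat_norm (S n \<omega>) > exp (l * real n)) sequentially"
  proof eventually_elim
    case (elim \<omega>)
    then show ?case
    proof eventually_elim
      case (elim n)
      then have "K * exp (l * real n) < norm (S n \<omega>)" by (auto simp: E_def)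
      also have "\<dots> \<le> K * mat_norm (S n \<omega>)" unfolding K_def m_def by (rule norm_le_mat_norm)
      finally show ?case using K by simp
    qed
  qed
  then show ?thesis using l by blast
qed

end

theorem mainTheorem3:
  fixes P :: "'w measure" and X :: "'x measure"
    and \<xi> :: "nat \<Rightarrow> 'w \<Rightarrow> 'x"
    and k :: "nat \<Rightarrow> 'x \<Rightarrow> 'x measure"
    and \<gg> :: "nat \<Rightarrow> 'x \<Rightarrow> real^'m^'m"
    and \<mu> :: "nat \<Rightarrow> 'x measure"
    and \<nu> :: "nat \<Rightarrow> (real^'m^'m) measure"
    and a :: "nat \<Rightarrow> real^'m^'m"
    and C :: real
  assumes chain: "markov_chain P X k \<xi>"
    and \<mu>_def: "\<And>n. n \<ge> 1 \<Longrightarrow> \<mu> n = distr P X (\<xi> n)"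
    and \<gg>_measurable: "\<And>n. n \<ge> 1 \<Longrightarrow> \<gg> n \<in> X \<rightarrow>\<^sub>M restrict_space borel SL"
    and \<nu>_def: "\<And>n. n \<ge> 1 \<Longrightarrow> \<nu> n = distr P (restrict_space borel SL) (\<lambda>\<omega>. \<gg> n (\<xi> n \<omega>))"
    and I: "\<exists>c<1. \<forall>n\<ge>1. op_norm0 (\<mu> (Suc n)) (\<mu> n) (kernel_op (k n)) \<le> ereal c"
    and II: "\<exists>M. compactin (weak_topology SL) M \<and> (\<forall>n\<ge>1. \<nu> n \<in> M) \<and>
      (\<forall>\<nu>'\<in>M. \<not> (\<exists>\<kappa>\<in>prob_measures_on (sphere 0 1 :: (real^'m) set).
                    \<forall>g\<in>G_group \<nu>'. preserves g \<kappa>))"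
    and a_SL: "\<And>j. j \<ge> 1 \<Longrightarrow> a j \<in> SL"
    and a_bounded: "\<And>j. j \<ge> 1 \<Longrightarrow> mat_norm (a j) \<le> C"
  shows "\<exists>l>0. AE \<omega> in P.
    liminf (\<lambda>n. ereal (1 / real n * ln (mat_norm (interleaved_prod a (\<lambda>j. \<gg> j (\<xi> j \<omega>)) n))))
      \<ge> ereal l"
proof -
  obtain c0 where c0: "c0 < 1" "\<And>n. n \<ge> 1 \<Longrightarrow> op_norm0 (\<mu> (Suc n)) (\<mu> n) (kernel_op (k n)) \<le> ereal c0"
    using I by blast
  \<comment> \<open>A contraction bound is squared below, so it has to be nonnegative.\<close>
  define c where "c = max c0 0"
  have c: "0 \<le> c" "c < 1" "ereal c0 \<le> ereal c" using c0(1) by (auto simp: c_def)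
  obtain M where M: "compactin (weak_topology SL) M" "\<And>n. n \<ge> 1 \<Longrightarrow> \<nu> n \<in> M"
    "\<forall>\<nu>'\<in>M. \<not> (\<exists>\<kappa>\<in>prob_measures_on (sphere 0 1 :: (real^'m) set). \<forall>g\<in>G_group \<nu>'. preserves g \<kappa>)"
    using II by blast
  from spectral_gap[OF M(1,3)] obtain d where d: "0 < d" "d \<le> 1 / 2"
    and gap: "\<forall>\<nu>\<in>M. \<forall>f\<in>borel_measurable borel. (\<forall>v :: real^'m. 0 \<le> f v \<and> f v \<le> 1) \<longrightarrow>
      (\<integral>\<^sup>+v. ennreal ((f v)\<^sup>2) \<partial>lborel) < \<infinity> \<longrightarrow>
      (\<integral>\<^sup>+v. ennreal ((\<integral>g. f (g *v v) \<partial>\<nu>)\<^sup>2) \<partial>lborel) \<le> ennreal (1 - d) * (\<integral>\<^sup>+v. ennreal ((f v)\<^sup>2) \<partial>lborel)"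
    by (elim exE conjE) (rule that)
  define h where "h n x = a n ** \<gg> n x" for n x
  have g_SL: "\<gg> n x \<in> SL" if "n \<ge> 1" "x \<in> space X" for n x
    using measurable_space[OF \<gg>_measurable[OF that(1)] that(2)] by (simp add: space_restrict_space)
  have g_borel: "\<gg> n \<in> borel_measurable X" if "n \<ge> 1" for n
    using \<gg>_measurable[OF that] by (simp add: measurable_restrict_space2_iff)
  interpret gap_chain P X k \<xi> h c d
  proof
    show "markov_chain P X k \<xi>" by (rule chain)
    show "h n \<in> borel_measurable X" if "n \<ge> 1" for n
      unfolding h_def using g_borel[OF that] by measurable
    show "h n x \<in> SL" if "n \<ge> 1" "x \<in> space X" for n x
      unfolding h_def using a_SL g_SL that by simp
    show "op_norm0 (distr P X (\<xi> (Suc n))) (distr P X (\<xi> n)) (kernel_op (k n)) \<le> ereal c" if "n \<ge> 1" for n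
      using c0(2)[OF that] c(3) \<mu>_def[of n] \<mu>_def[of "Suc n"] that by (auto intro: order_trans)
    show "(\<integral>\<^sup>+v. ennreal ((\<integral>x. f (h n x *v v) \<partial>distr P X (\<xi> n))\<^sup>2) \<partial>lborel) \<le> ennreal (1 - d) * (\<integral>\<^sup>+v. ennreal ((f v)\<^sup>2) \<partial>lborel)"
      if n: "n \<ge> 1" and f[measurable]: "f \<in> borel_measurable borel" and bd: "\<And>v. 0 \<le> f v \<and> f v \<le> 1"
        and fin: "(\<integral>\<^sup>+v. ennreal ((f v)\<^sup>2) \<partial>lborel) < \<infinity>" for n and f :: "real^'m \<Rightarrow> real"
    proof -
      let ?f = "\<lambda>v. f (a n *v v)"
      have sq: "(\<integral>\<^sup>+v. ennreal ((?f v)\<^sup>2) \<partial>lborel) = (\<integral>\<^sup>+v. ennreal ((f v)\<^sup>2) \<partial>lborel)"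
        using a_SL[OF n] by (intro nn_integral_SL) auto
      have "(\<integral>x. f (h n x *v v) \<partial>distr P X (\<xi> n)) = (\<integral>g. ?f (g *v v) \<partial>\<nu> n)" for v
      proof -
        have \<xi>m: "\<xi> n \<in> P \<rightarrow>\<^sub>M X" by (rule markov_meas[OF chain n])
        note [measurable] = g_borel[OF n]
        have "(\<integral>x. f (h n x *v v) \<partial>distr P X (\<xi> n)) = (\<integral>\<omega>. f (h n (\<xi> n \<omega>) *v v) \<partial>P)"
          unfolding h_def by (rule integral_distr[OF \<xi>m]) measurable
        moreover have "(\<integral>g. ?f (g *v v) \<partial>\<nu> n) = (\<integral>\<omega>. ?f (\<gg> n (\<xi> n \<omega>) *v v) \<partial>P)"
          unfolding \<nu>_def[OF n]
          by (intro integral_distr measurable_compose[OF \<xi>m \<gg>_measurable[OF n]] measurable_restrict_space1) measurable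
        ultimately show ?thesis by (simp add: h_def matrix_vector_mul_assoc)
      qed
      moreover have "(\<integral>\<^sup>+v. ennreal ((\<integral>g. ?f (g *v v) \<partial>\<nu> n)\<^sup>2) \<partial>lborel) \<le> ennreal (1 - d) * (\<integral>\<^sup>+v. ennreal ((?f v)\<^sup>2) \<partial>lborel)"
        using M(2)[OF n] bd fin sq by (intro gap[rule_format]) auto
      ultimately show ?thesis by (simp add: sq)
    qed
  qed (use c d in auto)
  have S_eq: "S n \<omega> = interleaved_prod a (\<lambda>j. \<gg> j (\<xi> j \<omega>)) n" for n \<omega>
  proof (induction n)
    case (Suc n)
    have "S (Suc n) \<omega> = h (Suc n) (\<xi> (Suc n) \<omega>) ** S n \<omega>" by simp
    then show ?case by (simp only: Suc interleaved_prod.simps h_def[of "Suc n"])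
  qed simp
  obtain l where "l > 0" and l: "AE \<omega> in P. eventually (\<lambda>n. mat_norm (S n \<omega>) > exp (l * real n)) sequentially"
    using exponential_growth by blast
  from l have "AE \<omega> in P. ereal l \<le> liminf (\<lambda>n. ereal (1 / real n * ln (mat_norm (interleaved_prod a (\<lambda>j. \<gg> j (\<xi> j \<omega>)) n))))"
  proof eventually_elim
    case (elim \<omega>)
    show ?case
    proof (rule Liminf_bounded)
      show "eventually (\<lambda>n. ereal l \<le> ereal (1 / real n * ln (mat_norm (interleaved_prod a (\<lambda>j. \<gg> j (\<xi> j \<omega>)) n)))) sequentially"
        using elim eventually_gt_at_top[of 0]
      proof eventually_elim
        case (elim n)
        then have "l * real n < ln (mat_norm (S n \<omega>))"
          by (metis exp_gt_zero ln_exp ln_less_cancel_iff order_less_trans)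
        then have "l \<le> 1 / real n * ln (mat_norm (S n \<omega>))" using elim by (simp add: field_simps)
        then show ?case by (simp add: S_eq)
      qed
    qed
  qed
  then show ?thesis using \<open>l > 0\<close> by blast
qed

end
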